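(* Let $\Bbbk$ be a field of characteristic zero or odd characteristic, let $\mathbb{X}$ be a locally algebraic superscheme over $\Bbbk$ and let $x\in\mathbb{X}(\Bbbk)$. Then for every $A\in\mathsf{SAlg}_{\Bbbk}$ $$\mathbb{N}_x(\mathbb{X})(A)=\mathbb{X}(\pi_A)^{-1}(x_{\widetilde{A}}).$$
   Context: All superalgebras are associative, unital, supercommutative $\mathbb{Z}_2$-graded $\Bbbk$-algebras; $\mathsf{SAlg}_{\Bbbk}$ is their category, with parity-preserving homomorphisms. A superscheme is identified with its functor of points $\mathbb{X}:\mathsf{SAlg}_{\Bbbk}\to\mathsf{Sets}$, $\mathbb{X}(A)=\mathrm{Mor}(\mathrm{SSpec}(A),X)$; it is locally algebraic if it is locally of finite type over $\Bbbk$. For $A\in\mathsf{SAlg}_{\Bbbk}$, $\mathrm{nil}(A)$ is the superideal of all nilpotent elements of $A$, $\widetilde{A}=A/\mathrm{nil}(A)$, $\pi_A:A\to\widetilde{A}$ is the quotient morphism, and $x_{A}$ denotes the image of $x$ under $\mathbb{X}(\Bbbk)\to\mathbb{X}(A)$. Formal neighborhood: choose an open affine supersubscheme $\mathbb{U}$ of $\mathbb{X}$ with $x\in\mathbb{U}(\Bbbk)$, with coordinate superalgebra $\mathcal{O}(\mathbb{U})$, and let $\mathfrak{M}_x=\ker(x:\mathcal{O}(\mathbb{U})\to\Bbbk)$. $\mathbb{N}_{n,x}(\mathbb{X})$ is the closed supersubscheme of $\mathbb{U}$ represented by $\mathcal{O}(\mathbb{U})/\mathfrak{M}_x^{n+1}$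 (it does not depend on the choice of $\mathbb{U}$ and is a subfunctor of $\mathbb{X}$), and $\mathbb{N}_x(\mathbb{X})=\bigcup_{n\ge1}\mathbb{N}_{n,x}(\mathbb{X})$. *)

theory Defs
  imports
    "HOL-Analysis.Abstract_Topology"
    "HOL-Algebra.Subrings"
    "HOL-Algebra.Ideal_Product"
begin

section \<open>Superalgebras over a field\<close>

record ('k, 'a) superalg = "('k, 'a) module" +
  even_part :: "'a set"
  odd_part :: "'a set"

locale superalgebra = K: field K + A: ring A + module K A
  for K :: "('k, 'm) ring_scheme" and A :: "('k, 'a, 'n) superalg_scheme" +
  assumes smult_mult_left: "\<lbrakk>c \<in> carrier K; a \<in> carrier A; b \<in> carrier A\<rbrakk>
      \<Longrightarrow> (c \<odot>\<^bsub>A\<^esub> a) \<otimes>\<^bsub>A\<^esub> b = c \<odot>\<^bsub>A\<^esub> (a \<otimes>\<^bsub>A\<^esub> b)"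
    and smult_mult_right: "\<lbrakk>c \<in> carrier K; a \<in> carrier A; b \<in> carrier A\<rbrakk>
      \<Longrightarrow> a \<otimes>\<^bsub>A\<^esub> (c \<odot>\<^bsub>A\<^esub> b) = c \<odot>\<^bsub>A\<^esub> (a \<otimes>\<^bsub>A\<^esub> b)"
    and even_submodule: "submodule (even_part A) K A"
    and odd_submodule: "submodule (odd_part A) K A"
    and even_plus_odd: "even_part A <+>\<^bsub>A\<^esub> odd_part A = carrier A"
    and even_inter_odd: "even_part A \<inter> odd_part A = {\<zero>\<^bsub>A\<^esub>}"
    and one_even: "\<one>\<^bsub>A\<^esub> \<in> even_part A"
    and even_even: "\<lbrakk>a \<in> even_part A; b \<in> even_part A\<rbrakk> \<Longrightarrow> a \<otimes>\<^bsub>A\<^esub> b \<in> even_part A"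
    and even_odd: "\<lbrakk>a \<in> even_part A; b \<in> odd_part A\<rbrakk> \<Longrightarrow> a \<otimes>\<^bsub>A\<^esub> b \<in> odd_part A"
    and odd_even: "\<lbrakk>a \<in> odd_part A; b \<in> even_part A\<rbrakk> \<Longrightarrow> a \<otimes>\<^bsub>A\<^esub> b \<in> odd_part A"
    and odd_odd: "\<lbrakk>a \<in> odd_part A; b \<in> odd_part A\<rbrakk> \<Longrightarrow> a \<otimes>\<^bsub>A\<^esub> b \<in> even_part A"
    and even_central: "\<lbrakk>a \<in> even_part A; b \<in> carrier A\<rbrakk> \<Longrightarrow> a \<otimes>\<^bsub>A\<^esub> b = b \<otimes>\<^bsub>A\<^esub> a"
    and odd_anticommute: "\<lbrakk>a \<in> odd_part A; b \<in> odd_part A\<rbrakk>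
      \<Longrightarrow> a \<otimes>\<^bsub>A\<^esub> b = \<ominus>\<^bsub>A\<^esub> (b \<otimes>\<^bsub>A\<^esub> a)"

definition superalg_hom ::
  "('k, 'm) ring_scheme \<Rightarrow> ('k, 'a, 'n) superalg_scheme \<Rightarrow> ('k, 'b, 'l) superalg_scheme \<Rightarrow> ('a \<Rightarrow> 'b) set"
  where "superalg_hom K A B = {\<phi> \<in> ring_hom A B.
    (\<forall>c\<in>carrier K. \<forall>a\<in>carrier A. \<phi> (c \<odot>\<^bsub>A\<^esub> a) = c \<odot>\<^bsub>B\<^esub> \<phi> a) \<and>
    \<phi> ` even_part A \<subseteq> even_part B \<and> \<phi> ` odd_part A \<subseteq> odd_part B}"

definition finitely_generated :: "('k, 'm) ring_scheme \<Rightarrow> ('k, 'a, 'n) superalg_scheme \<Rightarrow> bool"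
  where "finitely_generated K A \<longleftrightarrow>
    (\<exists>G. finite G \<and> G \<subseteq> carrier A \<and>
      (\<forall>H. subring H A \<and> submodule H K A \<and> G \<subseteq> H \<longrightarrow> H = carrier A))"

definition field_superalg :: "'k ring \<Rightarrow> ('k, 'k) superalg"
  where "field_superalg K = \<lparr>carrier = carrier K, mult = mult K, one = one K,
    zero = zero K, add = add K, smult = mult K, even_part = carrier K, odd_part = {\<zero>\<^bsub>K\<^esub>}\<rparr>"

definition unit_hom :: "('k, 'a) superalg \<Rightarrow> 'k \<Rightarrow> 'a"
  where "unit_hom A c = c \<odot>\<^bsub>A\<^esub> \<one>\<^bsub>A\<^esub>"

definition nilradical :: "('k, 'a) superalg \<Rightarrow> 'a set"
  where "nilradical A = {a \<in> carrier A. \<exists>n::nat. a [^]\<^bsub>A\<^esub> n = \<zero>\<^bsub>A\<^esub>}"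

definition quot_map :: "('k, 'a) superalg \<Rightarrow> 'a set \<Rightarrow> 'a \<Rightarrow> 'a set"
  where "quot_map A I a = I +>\<^bsub>A\<^esub> a"

definition quot_superalg :: "('k, 'a) superalg \<Rightarrow> 'a set \<Rightarrow> ('k, 'a set) superalg"
  where "quot_superalg A I = \<lparr>carrier = carrier (A Quot I), mult = mult (A Quot I),
    one = one (A Quot I), zero = zero (A Quot I), add = add (A Quot I),
    smult = (\<lambda>c X. \<Union>a\<in>X. quot_map A I (c \<odot>\<^bsub>A\<^esub> a)),
    even_part = quot_map A I ` even_part A, odd_part = quot_map A I ` odd_part A\<rparr>"

definition ideal_power :: "('k, 'a) superalg \<Rightarrow> 'a set \<Rightarrow> nat \<Rightarrow> 'a set"
  where "ideal_power A I n = I [^]\<^bsub>ideals_set A\<^esub> n"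

text \<open>The characteristic, with value 0 if no positive multiple of 1 vanishes:
  \<open>group.ord\<close> is 0 for elements of infinite order.\<close>

definition field_char :: "'k ring \<Rightarrow> nat"
  where "field_char K = group.ord (add_monoid K) \<one>\<^bsub>K\<^esub>"


section \<open>Localization at even denominators\<close>

definition fraction :: "('k, 'a) superalg \<Rightarrow> 'a set \<Rightarrow> 'a \<Rightarrow> 'a \<Rightarrow> ('a \<times> 'a) set"
  where "fraction A S a s = {(b, t). b \<in> carrier A \<and> t \<in> S \<and>
    (\<exists>u\<in>S. u \<otimes>\<^bsub>A\<^esub> (t \<otimes>\<^bsub>A\<^esub> a) = u \<otimes>\<^bsub>A\<^esub> (s \<otimes>\<^bsub>A\<^esub> b))}"

definition localization :: "('k, 'a) superalg \<Rightarrow> 'a set \<Rightarrow> ('k, ('a \<times> 'a) set) superalg"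
  where "localization A S = \<lparr>
    carrier = {fraction A S a s |a s. a \<in> carrier A \<and> s \<in> S},
    mult = (\<lambda>X Y. \<Union>(a, s)\<in>X. \<Union>(b, t)\<in>Y. fraction A S (a \<otimes>\<^bsub>A\<^esub> b) (s \<otimes>\<^bsub>A\<^esub> t)),
    one = fraction A S \<one>\<^bsub>A\<^esub> \<one>\<^bsub>A\<^esub>,
    zero = fraction A S \<zero>\<^bsub>A\<^esub> \<one>\<^bsub>A\<^esub>,
    add = (\<lambda>X Y. \<Union>(a, s)\<in>X. \<Union>(b, t)\<in>Y.
      fraction A S ((t \<otimes>\<^bsub>A\<^esub> a) \<oplus>\<^bsub>A\<^esub> (s \<otimes>\<^bsub>A\<^esub> b)) (s \<otimes>\<^bsub>A\<^esub> t)),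
    smult = (\<lambda>c X. \<Union>(a, s)\<in>X. fraction A S (c \<odot>\<^bsub>A\<^esub> a) s),
    even_part = {fraction A S a s |a s. a \<in> even_part A \<and> s \<in> S},
    odd_part = {fraction A S a s |a s. a \<in> odd_part A \<and> s \<in> S}\<rparr>"


section \<open>Geometric superspaces\<close>

text \<open>A topological space with a presheaf of superalgebras; \<open>sect X U\<close> and \<open>res X U V\<close>
  are meaningful only for open sets \<open>V \<subseteq> U\<close>.\<close>

record ('k, 'p, 's) superspace =
  base :: "'p topology"
  sect :: "'p set \<Rightarrow> ('k, 's) superalg"
  res :: "'p set \<Rightarrow> 'p set \<Rightarrow> 's \<Rightarrow> 's"

definition germ :: "('k, 'p, 's) superspace \<Rightarrow> 'p \<Rightarrow> 'p set \<Rightarrow> 's \<Rightarrow> ('p set \<times> 's) set"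
  where "germ X x U s = {(V, t). openin (base X) V \<and> x \<in> V \<and> t \<in> carrier (sect X V) \<and>
    (\<exists>W. openin (base X) W \<and> x \<in> W \<and> W \<subseteq> U \<inter> V \<and> res X U W s = res X V W t)}"

definition stalk :: "('k, 'p, 's) superspace \<Rightarrow> 'p \<Rightarrow> ('p set \<times> 's) set ring"
  where "stalk X x = \<lparr>
    carrier = {germ X x U s |U s. openin (base X) U \<and> x \<in> U \<and> s \<in> carrier (sect X U)},
    mult = (\<lambda>G H. \<Union>(U, s)\<in>G. \<Union>(V, t)\<in>H.
      germ X x (U \<inter> V) (res X U (U \<inter> V) s \<otimes>\<^bsub>sect X (U \<inter> V)\<^esub> res X V (U \<inter> V) t)),
    one = germ X x (topspace (base X)) \<one>\<^bsub>sect X (topspace (base X))\<^esub>,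
    zero = germ X x (topspace (base X)) \<zero>\<^bsub>sect X (topspace (base X))\<^esub>,
    add = (\<lambda>G H. \<Union>(U, s)\<in>G. \<Union>(V, t)\<in>H.
      germ X x (U \<inter> V) (res X U (U \<inter> V) s \<oplus>\<^bsub>sect X (U \<inter> V)\<^esub> res X V (U \<inter> V) t))\<rparr>"

text \<open>\<open>maximalideal\<close> refers to two-sided ideals. In a supercommutative superalgebra over a field
  of characteristic different from 2 every odd element generates an ideal of square zero, so a
  maximal two-sided ideal contains the odd part and is a maximal superideal.\<close>

locale geometric_superspace =
  fixes K :: "'k ring" and X :: "('k, 'p, 's) superspace"
  assumes sect_superalgebra: "openin (base X) U \<Longrightarrow> superalgebra K (sect X U)"
    and res_hom: "\<lbrakk>openin (base X) U; openin (base X) V; V \<subseteq> U\<rbrakk>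
      \<Longrightarrow> res X U V \<in> superalg_hom K (sect X U) (sect X V)"
    and res_id: "\<lbrakk>openin (base X) U; s \<in> carrier (sect X U)\<rbrakk> \<Longrightarrow> res X U U s = s"
    and res_res: "\<lbrakk>openin (base X) U; openin (base X) V; openin (base X) W; W \<subseteq> V; V \<subseteq> U;
      s \<in> carrier (sect X U)\<rbrakk> \<Longrightarrow> res X V W (res X U V s) = res X U W s"
    and separated: "\<lbrakk>\<And>V. V \<in> \<V> \<Longrightarrow> openin (base X) V;
      s \<in> carrier (sect X (\<Union>\<V>)); t \<in> carrier (sect X (\<Union>\<V>));
      \<And>V. V \<in> \<V> \<Longrightarrow> res X (\<Union>\<V>) V s = res X (\<Union>\<V>) V t\<rbrakk> \<Longrightarrow> s = t"
    and gluing: "\<lbrakk>\<And>V. V \<in> \<V> \<Longrightarrow> openin (base X) V;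
      \<And>V. V \<in> \<V> \<Longrightarrow> \<sigma> V \<in> carrier (sect X V);
      \<And>V W. \<lbrakk>V \<in> \<V>; W \<in> \<V>\<rbrakk> \<Longrightarrow> res X V (V \<inter> W) (\<sigma> V) = res X W (V \<inter> W) (\<sigma> W)\<rbrakk>
      \<Longrightarrow> \<exists>s\<in>carrier (sect X (\<Union>\<V>)). \<forall>V\<in>\<V>. res X (\<Union>\<V>) V s = \<sigma> V"
    and local_stalks: "x \<in> topspace (base X) \<Longrightarrow> \<exists>!M. maximalideal M (stalk X x)"

definition stalk_max :: "('k, 'p, 's) superspace \<Rightarrow> 'p \<Rightarrow> ('p set \<times> 's) set set"
  where "stalk_max X x = (THE M. maximalideal M (stalk X x))"

definition open_subspace :: "('k, 'p, 's) superspace \<Rightarrow> 'p set \<Rightarrow> ('k, 'p, 's) superspace"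
  where "open_subspace X U = \<lparr>base = subtopology (base X) U, sect = sect X, res = res X\<rparr>"


section \<open>Morphisms of superspaces\<close>

text \<open>A morphism \<open>X \<rightarrow> Y\<close> is a pair of a continuous map and a family, indexed by the opens \<open>V\<close>
  of \<open>Y\<close>, of comorphisms from the sections of \<open>Y\<close> over \<open>V\<close> to the sections of \<open>X\<close> over the
  preimage of \<open>V\<close>. All components are extensional, so that equality in HOL is equality of
  morphisms.\<close>

type_synonym ('p, 's, 'q, 't) morphism = "('p \<Rightarrow> 'q) \<times> ('q set \<Rightarrow> 't \<Rightarrow> 's)"

definition preimage_in :: "('k, 'p, 's) superspace \<Rightarrow> ('p \<Rightarrow> 'q) \<Rightarrow> 'q set \<Rightarrow> 'p set"
  where "preimage_in X f V = {x \<in> topspace (base X). f x \<in> V}"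

definition stalk_map :: "('k, 'p, 's) superspace \<Rightarrow> ('p, 's, 'q, 't) morphism \<Rightarrow> 'p \<Rightarrow>
    ('q set \<times> 't) set \<Rightarrow> ('p set \<times> 's) set"
  where "stalk_map X f x G =
    (\<Union>(V, t)\<in>G. germ X x (preimage_in X (fst f) V) (snd f V t))"

definition Mor :: "'k ring \<Rightarrow> ('k, 'p, 's) superspace \<Rightarrow> ('k, 'q, 't) superspace \<Rightarrow>
    ('p, 's, 'q, 't) morphism set"
  where "Mor K X Y = {f.
    fst f \<in> extensional (topspace (base X)) \<and>
    continuous_map (base X) (base Y) (fst f) \<and>
    snd f \<in> extensional {V. openin (base Y) V} \<and>
    (\<forall>V. openin (base Y) V \<longrightarrow>
      snd f V \<in> extensional (carrier (sect Y V)) \<and>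
      snd f V \<in> superalg_hom K (sect Y V) (sect X (preimage_in X (fst f) V))) \<and>
    (\<forall>V W. openin (base Y) V \<and> openin (base Y) W \<and> W \<subseteq> V \<longrightarrow>
      (\<forall>t\<in>carrier (sect Y V). snd f W (res Y V W t) =
        res X (preimage_in X (fst f) V) (preimage_in X (fst f) W) (snd f V t))) \<and>
    (\<forall>x\<in>topspace (base X). stalk_map X f x ` stalk_max Y (fst f x) \<subseteq> stalk_max X x)}"

definition id_mor :: "('k, 'p, 's) superspace \<Rightarrow> ('p, 's, 'p, 's) morphism"
  where "id_mor X = (\<lambda>x\<in>topspace (base X). x,
    \<lambda>V\<in>{V. openin (base X) V}. \<lambda>s\<in>carrier (sect X V). s)"

text \<open>The composite \<open>g \<circ> f\<close> of \<open>f : X \<rightarrow> Y\<close> and \<open>g : Y \<rightarrow> Z\<close>.\<close>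

definition comp_mor :: "('k, 'p, 's) superspace \<Rightarrow> ('k, 'q, 't) superspace \<Rightarrow>
    ('k, 'r, 'u) superspace \<Rightarrow> ('q, 't, 'r, 'u) morphism \<Rightarrow> ('p, 's, 'q, 't) morphism \<Rightarrow>
    ('p, 's, 'r, 'u) morphism"
  where "comp_mor X Y Z g f = (\<lambda>x\<in>topspace (base X). fst g (fst f x),
    \<lambda>W\<in>{W. openin (base Z) W}. \<lambda>s\<in>carrier (sect Z W).
      snd f (preimage_in Y (fst g) W) (snd g W s))"

definition isomorphic :: "'k ring \<Rightarrow> ('k, 'p, 's) superspace \<Rightarrow> ('k, 'q, 't) superspace \<Rightarrow> bool"
  where "isomorphic K X Y \<longleftrightarrow> (\<exists>f\<in>Mor K X Y. \<exists>g\<in>Mor K Y X.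
    comp_mor X Y X g f = id_mor X \<and> comp_mor Y X Y f g = id_mor Y)"


section \<open>The superspectrum\<close>

definition prime_spectrum :: "('k, 'a) superalg \<Rightarrow> 'a set set"
  where "prime_spectrum A = {p. primeideal p (A\<lparr>carrier := even_part A\<rparr>)}"

definition zariski :: "('k, 'a) superalg \<Rightarrow> 'a set topology"
  where "zariski A = topology_generated_by
    {{p \<in> prime_spectrum A. f \<notin> p} |f. f \<in> even_part A}"

abbreviation loc_at :: "('k, 'a) superalg \<Rightarrow> 'a set \<Rightarrow> ('k, ('a \<times> 'a) set) superalg"
  where "loc_at A p \<equiv> localization A (even_part A - p)"

definition SSpec_sections ::
  "('k, 'a) superalg \<Rightarrow> 'a set set \<Rightarrow> ('a set \<Rightarrow> ('a \<times> 'a) set) set"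
  where "SSpec_sections A U = {s \<in> (\<Pi>\<^sub>E p\<in>U. carrier (loc_at A p)).
    \<forall>p\<in>U. \<exists>V a f. openin (zariski A) V \<and> p \<in> V \<and> V \<subseteq> U \<and> a \<in> carrier A \<and> f \<in> even_part A \<and>
      (\<forall>q\<in>V. f \<notin> q \<and> s q = fraction A (even_part A - q) a f)}"

definition SSpec :: "('k, 'a) superalg \<Rightarrow> ('k, 'a set, 'a set \<Rightarrow> ('a \<times> 'a) set) superspace"
  where "SSpec A = \<lparr>
    base = zariski A,
    sect = (\<lambda>U. \<lparr>
      carrier = SSpec_sections A U,
      mult = (\<lambda>s t. \<lambda>p\<in>U. s p \<otimes>\<^bsub>loc_at A p\<^esub> t p),
      one = (\<lambda>p\<in>U. \<one>\<^bsub>loc_at A p\<^esub>),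
      zero = (\<lambda>p\<in>U. \<zero>\<^bsub>loc_at A p\<^esub>),
      add = (\<lambda>s t. \<lambda>p\<in>U. s p \<oplus>\<^bsub>loc_at A p\<^esub> t p),
      smult = (\<lambda>c s. \<lambda>p\<in>U. c \<odot>\<^bsub>loc_at A p\<^esub> s p),
      even_part = {s \<in> SSpec_sections A U. \<forall>p\<in>U. s p \<in> even_part (loc_at A p)},
      odd_part = {s \<in> SSpec_sections A U. \<forall>p\<in>U. s p \<in> odd_part (loc_at A p)}\<rparr>),
    res = (\<lambda>U V s. restrict s V)\<rparr>"

definition global_section :: "('k, 'a) superalg \<Rightarrow> 'a \<Rightarrow> 'a set \<Rightarrow> ('a \<times> 'a) set"
  where "global_section A a =
    (\<lambda>p\<in>topspace (zariski A). fraction A (even_part A - p) a \<one>\<^bsub>A\<^esub>)"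

text \<open>The morphism \<open>SSpec B \<rightarrow> SSpec A\<close> induced by \<open>\<phi> : A \<rightarrow> B\<close>; on stalks it sends
  \<open>a / f\<close> to \<open>\<phi> a / \<phi> f\<close>.\<close>

definition SSpec_point_map :: "('k, 'a) superalg \<Rightarrow> ('k, 'b) superalg \<Rightarrow> ('a \<Rightarrow> 'b) \<Rightarrow> 'b set \<Rightarrow> 'a set"
  where "SSpec_point_map A B \<phi> =
    (\<lambda>q\<in>topspace (zariski B). {a \<in> even_part A. \<phi> a \<in> q})"

definition SSpec_map :: "('k, 'a) superalg \<Rightarrow> ('k, 'b) superalg \<Rightarrow> ('a \<Rightarrow> 'b) \<Rightarrow>
    ('b set, 'b set \<Rightarrow> ('b \<times> 'b) set, 'a set, 'a set \<Rightarrow> ('a \<times> 'a) set) morphism"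
  where "SSpec_map A B \<phi> = (SSpec_point_map A B \<phi>,
    \<lambda>V\<in>{V. openin (zariski A) V}. \<lambda>s\<in>SSpec_sections A V.
      \<lambda>q\<in>preimage_in (SSpec B) (SSpec_point_map A B \<phi>) V.
        \<Union>(a, f)\<in>s (SSpec_point_map A B \<phi> q). fraction B (even_part B - q) (\<phi> a) (\<phi> f))"


section \<open>Superschemes and their functors of points\<close>

text \<open>If the open subspace on \<open>U\<close> is \<open>SSpec B\<close> for a superalgebra \<open>B\<close> over any carrier type, then
  \<open>B\<close> is isomorphic to \<open>sect X U\<close>; hence letting \<open>B\<close> range over the carrier type of the
  sections of \<open>X\<close> loses nothing.\<close>

definition affine_open :: "'k ring \<Rightarrow> ('k, 'p, 's) superspace \<Rightarrow> 'p set \<Rightarrow> bool"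
  where "affine_open K X U \<longleftrightarrow> openin (base X) U \<and>
    (\<exists>B :: ('k, 's) superalg. superalgebra K B \<and> isomorphic K (open_subspace X U) (SSpec B))"

definition superscheme :: "'k ring \<Rightarrow> ('k, 'p, 's) superspace \<Rightarrow> bool"
  where "superscheme K X \<longleftrightarrow> geometric_superspace K X \<and>
    (\<forall>x\<in>topspace (base X). \<exists>U. affine_open K X U \<and> x \<in> U)"

definition locally_algebraic :: "'k ring \<Rightarrow> ('k, 'p, 's) superspace \<Rightarrow> bool"
  where "locally_algebraic K X \<longleftrightarrow> superscheme K X \<and>
    (\<forall>x\<in>topspace (base X). \<exists>U. affine_open K X U \<and> x \<in> U \<and> finitely_generated K (sect X U))"

type_synonym ('a, 'p, 's) point =
  "('a set, 'a set \<Rightarrow> ('a \<times> 'a) set, 'p, 's) morphism"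

definition points :: "'k ring \<Rightarrow> ('k, 'p, 's) superspace \<Rightarrow> ('k, 'a) superalg \<Rightarrow> ('a, 'p, 's) point set"
  where "points K X A = Mor K (SSpec A) X"

definition points_map :: "('k, 'p, 's) superspace \<Rightarrow> ('k, 'a) superalg \<Rightarrow> ('k, 'b) superalg \<Rightarrow>
    ('a \<Rightarrow> 'b) \<Rightarrow> ('a, 'p, 's) point \<Rightarrow> ('b, 'p, 's) point"
  where "points_map X A B \<phi> g = comp_mor (SSpec B) (SSpec A) X g (SSpec_map A B \<phi>)"

definition base_point :: "'k ring \<Rightarrow> ('k, 'p, 's) superspace \<Rightarrow> ('k, 'p, 's) point \<Rightarrow>
    ('k, 'a) superalg \<Rightarrow> ('a, 'p, 's) point"
  where "base_point K X x A = points_map X (field_superalg K) A (unit_hom A) x"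

definition open_points :: "'k ring \<Rightarrow> ('k, 'p, 's) superspace \<Rightarrow> 'p set \<Rightarrow> ('k, 'a) superalg \<Rightarrow>
    ('a, 'p, 's) point set"
  where "open_points K X U A =
    {g \<in> points K X A. fst g ` topspace (base (SSpec A)) \<subseteq> U}"

text \<open>The closed supersubscheme of the affine open \<open>U\<close> represented by the quotient of the
  coordinate superalgebra \<open>sect X U\<close> by the superideal \<open>I\<close>, as a subfunctor of \<open>X\<close>. An
  \<open>A\<close>-point \<open>g\<close> of \<open>U\<close> corresponds to the homomorphism \<open>sect X U \<rightarrow> A\<close> whose composite with the
  isomorphism \<open>global_section A\<close> onto the global sections of \<open>SSpec A\<close> is the comorphism of \<open>g\<close>
  over \<open>U\<close>.\<close>

definition closed_points :: "'k ring \<Rightarrow> ('k, 'p, 's) superspace \<Rightarrow> 'p set \<Rightarrow> 's set \<Rightarrow>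
    ('k, 'a) superalg \<Rightarrow> ('a, 'p, 's) point set"
  where "closed_points K X U I A = {g \<in> open_points K X U A.
    \<exists>\<psi>\<in>superalg_hom K (quot_superalg (sect X U) I) A.
      \<forall>s\<in>carrier (sect X U). snd g U s = global_section A (\<psi> (quot_map (sect X U) I s))}"


section \<open>The formal neighborhood of a rational point\<close>

text \<open>The kernel of \<open>x : sect X U \<rightarrow> K\<close>, with \<open>K\<close> identified with the global sections of its
  superspectrum.\<close>

definition point_ideal :: "'k ring \<Rightarrow> ('k, 'p, 's) superspace \<Rightarrow> 'p set \<Rightarrow> ('k, 'p, 's) point \<Rightarrow> 's set"
  where "point_ideal K X U x =
    a_kernel (sect X U)
      (sect (SSpec (field_superalg K)) (topspace (base (SSpec (field_superalg K))))) (snd x U)"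

text \<open>An arbitrary choice; the neighborhoods defined from it do not depend on it.\<close>

definition affine_nbhd :: "'k ring \<Rightarrow> ('k, 'p, 's) superspace \<Rightarrow> ('k, 'p, 's) point \<Rightarrow> 'p set"
  where "affine_nbhd K X x =
    (SOME U. affine_open K X U \<and> x \<in> open_points K X U (field_superalg K))"

definition inf_nbhd :: "'k ring \<Rightarrow> ('k, 'p, 's) superspace \<Rightarrow> ('k, 'p, 's) point \<Rightarrow> nat \<Rightarrow>
    ('k, 'a) superalg \<Rightarrow> ('a, 'p, 's) point set"
  where "inf_nbhd K X x n A =
    (let U = affine_nbhd K X x
     in closed_points K X U (ideal_power (sect X U) (point_ideal K X U x) (n + 1)) A)"

definition formal_nbhd :: "'k ring \<Rightarrow> ('k, 'p, 's) superspace \<Rightarrow> ('k, 'p, 's) point \<Rightarrow>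
    ('k, 'a) superalg \<Rightarrow> ('a, 'p, 's) point set"
  where "formal_nbhd K X x A = (\<Union>n\<in>{1..}. inf_nbhd K X x n A)"

end

theory Submission
  imports Defs
begin

text \<open>A map \<open>g : SSpec A \<rightarrow> X\<close> reduces to the constant point \<open>x\<close> over \<open>A / nil A\<close> exactly if two
things hold: topologically it is constant with value the underlying point \<open>y\<close> of \<open>x\<close>, and for
every open \<open>W\<close> around \<open>y\<close> the homomorphism \<open>g\<^sub>W : O(W) \<rightarrow> A\<close> agrees modulo \<open>nil A\<close> with the
evaluation \<open>x\<^sub>W : O(W) \<rightarrow> K \<rightarrow> A\<close> (\<open>reduction_eq_base_point_iff\<close>). The homomorphism \<open>g\<^sub>W\<close> exists because
the global sections of \<open>SSpec A\<close> are the elements of \<open>A\<close> (\<open>global_section_surj\<close>,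
\<open>global_section_inj\<close>, packaged in \<open>lift_to_global\<close>); constancy is detected because
\<open>SSpec (A / nil A) \<rightarrow> SSpec A\<close> is onto, every prime of the even part containing the even nilpotents.

Let \<open>U\<close> be the chosen affine neighborhood and \<open>M\<close> the kernel of \<open>x\<^sub>U\<close>.

If \<open>g\<close> lies in the formal neighborhood, then \<open>g\<^sub>U\<close> kills a power of \<open>M\<close>, so \<open>g\<^sub>U(m)\<close> is nilpotent
for \<open>m \<in> M\<close>. A function that is invertible near \<open>g(p)\<close> pulls back to a unit near \<open>p\<close>, hence no
even \<open>m \<in> M\<close> is invertible near a value of \<open>g\<close>; on an affine open this pins the value down to \<open>y\<close>
(\<open>point_eq_rational_point\<close>). On \<open>U\<close> itself \<open>g\<^sub>U\<close> and \<open>x\<^sub>U\<close> agree modulo nilpotents, and a section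
over any other open around \<open>y\<close> is, near \<open>y\<close>, a fraction of functions on \<open>U\<close>, so that the congruence
spreads to all of them (\<open>congruence_spreads\<close>).

If conversely \<open>g\<close> reduces to \<open>x\<close>, then \<open>g\<close> maps into \<open>U\<close>, and it remains to see that \<open>g\<^sub>U(M)\<close> lies in
a nilpotent ideal of \<open>A\<close>. Near \<open>y\<close> there is an affine open \<open>V\<close> with finitely generated coordinate
superalgebra. The differences \<open>g\<^sub>V(s) - x\<^sub>V(s)\<close> for \<open>s\<close> in a finite set of generators are finitely many
nilpotent elements, and in a supercommutative algebra these generate a nilpotent ideal \<open>J\<close>
(\<open>finite_in_nilpotent_ideal\<close>); hence \<open>g\<^sub>V\<close> and \<open>x\<^sub>V\<close> agree modulo \<open>J\<close>
(\<open>finitely_generated_congruence\<close>). Spreading this congruence from \<open>V\<close> to \<open>U\<close> gives \<open>g\<^sub>U(M) \<subseteq> J\<close>.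

Characteristic different from two enters through the vanishing of squares of odd elements: with it
the nilpotent elements form an ideal, and an odd element generates a nilpotent one.\<close>

section \<open>The even part and its prime ideals\<close>

text \<open>The superalgebras whose spectrum is formed carry no further record fields; fixing that type
lets the functions on such superalgebras be used inside the locale.\<close>

locale supercomm = superalgebra K A
  for K :: "'k ring" and A :: "('k, 'a) superalg" (structure)
begin

abbreviation A\<^sub>0 :: "'a set" where "A\<^sub>0 \<equiv> even_part A"
abbreviation A\<^sub>1 :: "'a set" where "A\<^sub>1 \<equiv> odd_part A"

lemma even_carrier [simp]: "a \<in> A\<^sub>0 \<Longrightarrow> a \<in> carrier A"
  and odd_carrier [simp]: "b \<in> A\<^sub>1 \<Longrightarrow> b \<in> carrier A"
  using submoduleE(1)[OF even_submodule] submoduleE(1)[OF odd_submodule] by auto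

lemma even_zero [simp]: "\<zero> \<in> A\<^sub>0" and odd_zero [simp]: "\<zero> \<in> A\<^sub>1"
  using even_inter_odd by auto

lemma even_add [simp]: "a \<in> A\<^sub>0 \<Longrightarrow> b \<in> A\<^sub>0 \<Longrightarrow> a \<oplus> b \<in> A\<^sub>0"
  and odd_add [simp]: "a \<in> A\<^sub>1 \<Longrightarrow> b \<in> A\<^sub>1 \<Longrightarrow> a \<oplus> b \<in> A\<^sub>1"
  using submoduleE(5)[OF even_submodule] submoduleE(5)[OF odd_submodule] by auto

lemma even_neg [simp]: "a \<in> A\<^sub>0 \<Longrightarrow> \<ominus> a \<in> A\<^sub>0"
  and odd_neg [simp]: "b \<in> A\<^sub>1 \<Longrightarrow> \<ominus> b \<in> A\<^sub>1"
  using submoduleE(3)[OF even_submodule] submoduleE(3)[OF odd_submodule] by auto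

lemma even_minus [simp]: "a \<in> A\<^sub>0 \<Longrightarrow> b \<in> A\<^sub>0 \<Longrightarrow> a \<ominus> b \<in> A\<^sub>0"
  by (simp add: a_minus_def)

lemma even_smult [simp]: "c \<in> carrier K \<Longrightarrow> a \<in> A\<^sub>0 \<Longrightarrow> c \<odot> a \<in> A\<^sub>0"
  and odd_smult [simp]: "c \<in> carrier K \<Longrightarrow> b \<in> A\<^sub>1 \<Longrightarrow> c \<odot> b \<in> A\<^sub>1"
  using submoduleE(4)[OF even_submodule] submoduleE(4)[OF odd_submodule] by auto

lemmas parity_simps [simp] = one_even even_even even_odd odd_even odd_odd

lemma even_pow [simp]: "a \<in> A\<^sub>0 \<Longrightarrow> a [^] (n::nat) \<in> A\<^sub>0"
  by (induction n) auto

lemma even_odd_decomp: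
  assumes "a \<in> carrier A"
  obtains a0 a1 where "a0 \<in> A\<^sub>0" "a1 \<in> A\<^sub>1" "a = a0 \<oplus> a1"
proof -
  have "a \<in> A\<^sub>0 <+> A\<^sub>1" using assms even_plus_odd by simp
  then show thesis using that by (auto simp: set_add_def')
qed

lemma even_odd_unique:
  assumes "a0 \<in> A\<^sub>0" "b0 \<in> A\<^sub>0" "a1 \<in> A\<^sub>1" "b1 \<in> A\<^sub>1" "a0 \<oplus> a1 = b0 \<oplus> b1"
  shows "a0 = b0" "a1 = b1"
proof -
  have "a0 \<oplus> a1 \<oplus> (\<ominus> b0 \<oplus> \<ominus> a1) = b0 \<oplus> b1 \<oplus> (\<ominus> b0 \<oplus> \<ominus> a1)"
    using assms by simp
  moreover have "a0 \<oplus> a1 \<oplus> (\<ominus> b0 \<oplus> \<ominus> a1) = a0 \<oplus> \<ominus> b0"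
    unfolding A.a_assoc[OF assms(1)[THEN even_carrier] assms(3)[THEN odd_carrier]]
    using assms(1-4) by (simp add: A.a_assoc A.a_lcomm[of a1 "\<ominus> b0"] A.r_neg)
  moreover have "b0 \<oplus> b1 \<oplus> (\<ominus> b0 \<oplus> \<ominus> a1) = b1 \<oplus> \<ominus> a1"
    using assms by (simp add: A.a_assoc A.a_lcomm[of b0 b1] A.r_neg1 A.r_neg2)
  ultimately have eq: "a0 \<oplus> \<ominus> b0 = b1 \<oplus> \<ominus> a1" by simp
  have "a0 \<oplus> \<ominus> b0 \<in> A\<^sub>0" using assms by simp
  moreover have "a0 \<oplus> \<ominus> b0 \<in> A\<^sub>1" unfolding eq using assms by simp
  ultimately have "a0 \<oplus> \<ominus> b0 = \<zero>" using even_inter_odd by auto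
  then show "a0 = b0" using assms by (simp add: A.minus_equality A.add.inv_solve_right' )
  then show "a1 = b1" using assms by simp
qed

lemma even_comm: "a \<in> A\<^sub>0 \<Longrightarrow> b \<in> carrier A \<Longrightarrow> b \<otimes> a = a \<otimes> b"
  by (rule even_central[symmetric])

lemma even_lcomm: "a \<in> A\<^sub>0 \<Longrightarrow> b \<in> carrier A \<Longrightarrow> c \<in> carrier A \<Longrightarrow> b \<otimes> (a \<otimes> c) = a \<otimes> (b \<otimes> c)"
  using A.m_assoc[of b a c] A.m_assoc[of a b c] even_central[of a b] by simp

lemma even_interchange:
  "\<lbrakk>s \<in> A\<^sub>0; t \<in> A\<^sub>0; a \<in> carrier A; b \<in> carrier A\<rbrakk>
    \<Longrightarrow> (s \<otimes> t) \<otimes> (a \<otimes> b) = (s \<otimes> a) \<otimes> (t \<otimes> b)"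
  by (simp add: A.m_assoc even_lcomm[of t a b])

lemma even_pow_mult:
  "\<lbrakk>u \<in> A\<^sub>0; a \<in> carrier A\<rbrakk> \<Longrightarrow> (u \<otimes> a) [^] (n::nat) = u [^] n \<otimes> a [^] n"
  by (induction n) (auto simp: even_interchange[symmetric])

lemma smult_one_mult: "c \<in> carrier K \<Longrightarrow> a \<in> carrier A \<Longrightarrow> (c \<odot> \<one>) \<otimes> a = c \<odot> a"
  by (simp add: smult_mult_left)

text \<open>The ideals of the ring of even elements. Closure conditions avoid passing to a separate ring
whenever an ideal is to be exhibited; \<open>prime_spectrum_iff\<close> makes the link with the primes.\<close>

definition even_ideal :: "'a set \<Rightarrow> bool" where
  "even_ideal I \<longleftrightarrow> I \<subseteq> A\<^sub>0 \<and> \<zero> \<in> I \<and> (\<forall>a\<in>I. \<forall>b\<in>I. a \<oplus> b \<in> I) \<and> (\<forall>c\<in>A\<^sub>0. \<forall>a\<in>I. c \<otimes> a \<in> I)"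

lemma even_cring: "cring (A\<lparr>carrier := A\<^sub>0\<rparr>)"
proof -
  have "subring A\<^sub>0 A"
    by (rule A.subringI) auto
  then have "ring (A\<lparr>carrier := A\<^sub>0\<rparr>)" by (rule A.subring_is_ring)
  moreover have "comm_monoid (A\<lparr>carrier := A\<^sub>0\<rparr>)"
    by (rule comm_monoidI) (auto simp: A.m_assoc intro: even_central)
  ultimately show ?thesis by (simp add: cring_def)
qed

lemma prime_spectrum_iff:
  "p \<in> prime_spectrum A \<longleftrightarrow> even_ideal p \<and> \<one> \<notin> p \<and>
    (\<forall>a\<in>A\<^sub>0. \<forall>b\<in>A\<^sub>0. a \<otimes> b \<in> p \<longrightarrow> a \<in> p \<or> b \<in> p)"
proof
  assume "p \<in> prime_spectrum A"
  then interpret P: primeideal p "A\<lparr>carrier := A\<^sub>0\<rparr>"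
    by (simp add: prime_spectrum_def)
  have "p \<subseteq> A\<^sub>0" using P.a_subset by simp
  moreover have "\<one> \<notin> p" using P.I_notcarr P.one_imp_carrier by auto
  ultimately show "even_ideal p \<and> \<one> \<notin> p \<and>
    (\<forall>a\<in>A\<^sub>0. \<forall>b\<in>A\<^sub>0. a \<otimes> b \<in> p \<longrightarrow> a \<in> p \<or> b \<in> p)"
    using additive_subgroup.zero_closed[OF P.is_additive_subgroup]
      additive_subgroup.a_closed[OF P.is_additive_subgroup] P.I_l_closed P.I_prime
    by (auto simp: even_ideal_def)
next
  assume a: "even_ideal p \<and> \<one> \<notin> p \<and>
    (\<forall>a\<in>A\<^sub>0. \<forall>b\<in>A\<^sub>0. a \<otimes> b \<in> p \<longrightarrow> a \<in> p \<or> b \<in> p)"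
  interpret E: cring "A\<lparr>carrier := A\<^sub>0\<rparr>" by (rule even_cring)
  have neg: "\<ominus>\<^bsub>A\<lparr>carrier := A\<^sub>0\<rparr>\<^esub> x \<in> p" if "x \<in> p" for x
  proof -
    have x: "x \<in> A\<^sub>0" using that a by (auto simp: even_ideal_def)
    have "(\<ominus>\<^bsub>A\<lparr>carrier := A\<^sub>0\<rparr>\<^esub> \<one>) \<otimes> x = \<ominus>\<^bsub>A\<lparr>carrier := A\<^sub>0\<rparr>\<^esub> x"
      using E.l_minus[of \<one> x] x by simp
    moreover have "(\<ominus>\<^bsub>A\<lparr>carrier := A\<^sub>0\<rparr>\<^esub> \<one>) \<in> A\<^sub>0"
      using E.a_inv_closed[of \<one>] by simp
    ultimately show ?thesis using a that by (auto simp: even_ideal_def) metis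
  qed
  have "ideal p (A\<lparr>carrier := A\<^sub>0\<rparr>)"
  proof (rule idealI[OF E.ring_axioms])
    show "subgroup p (add_monoid (A\<lparr>carrier := A\<^sub>0\<rparr>))"
      by (rule E.add.subgroupI) (use a neg in \<open>auto simp: even_ideal_def a_inv_def\<close>)
    show "x \<otimes>\<^bsub>A\<lparr>carrier := A\<^sub>0\<rparr>\<^esub> b \<in> p" "b \<otimes>\<^bsub>A\<lparr>carrier := A\<^sub>0\<rparr>\<^esub> x \<in> p"
      if "b \<in> p" "x \<in> carrier (A\<lparr>carrier := A\<^sub>0\<rparr>)" for b x
      using that a even_central[of x b] by (auto simp: even_ideal_def subset_eq) metis+
  qed
  then have "primeideal p (A\<lparr>carrier := A\<^sub>0\<rparr>)"
    by (rule primeidealI) (use a E.is_cring in auto)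
  then show "p \<in> prime_spectrum A" by (simp add: prime_spectrum_def)
qed

lemma primeD:
  assumes "p \<in> prime_spectrum A"
  shows "p \<subseteq> A\<^sub>0" "\<zero> \<in> p" "\<one> \<notin> p"
    and "\<And>a b. a \<in> p \<Longrightarrow> b \<in> p \<Longrightarrow> a \<oplus> b \<in> p"
    and "\<And>c a. c \<in> A\<^sub>0 \<Longrightarrow> a \<in> p \<Longrightarrow> c \<otimes> a \<in> p"
    and "\<And>a b. a \<in> A\<^sub>0 \<Longrightarrow> b \<in> A\<^sub>0 \<Longrightarrow> a \<otimes> b \<in> p \<Longrightarrow> a \<in> p \<or> b \<in> p"
  using assms unfolding prime_spectrum_iff even_ideal_def by auto

lemma prime_pow:
  assumes "p \<in> prime_spectrum A" "a \<in> A\<^sub>0" "a [^] (n::nat) \<in> p"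
  shows "a \<in> p"
  using assms(3)
proof (induction n)
  case 0 then show ?case using primeD[OF assms(1)] by simp
next
  case (Suc n) then show ?case using primeD(6)[OF assms(1), of "a [^] n" a] assms(2) by auto
qed

text \<open>An ideal maximal among those disjoint from \<open>S\<close> is prime: if \<open>a\<close> and \<open>b\<close> lie outside it, then
the ideals enlarged by \<open>a\<close> and by \<open>b\<close> meet \<open>S\<close>, and the product of the two meeting points would
lie in \<open>S\<close> and, if \<open>a \<otimes> b\<close> were in the ideal, also in the ideal.\<close>

lemma exists_prime_avoiding:
  assumes I: "even_ideal I" and S: "S \<subseteq> A\<^sub>0" "S \<noteq> {}" "\<And>s t. s \<in> S \<Longrightarrow> t \<in> S \<Longrightarrow> s \<otimes> t \<in> S"
    and disj: "I \<inter> S = {}"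
  shows "\<exists>p\<in>prime_spectrum A. I \<subseteq> p \<and> p \<inter> S = {}"
proof -
  define F where "F = {J. even_ideal J \<and> I \<subseteq> J \<and> J \<inter> S = {}}"
  have chain: "\<Union>C \<in> F" if C: "C \<in> chains F" "C \<noteq> {}" for C
  proof -
    have CF: "\<And>J. J \<in> C \<Longrightarrow> J \<in> F" and tot: "\<And>J L. J \<in> C \<Longrightarrow> L \<in> C \<Longrightarrow> J \<subseteq> L \<or> L \<subseteq> J"
      using C by (auto simp: chains_def chain_subset_def)
    have add: "a \<oplus> b \<in> \<Union>C" if a: "a \<in> \<Union>C" and b: "b \<in> \<Union>C" for a b
    proof -
      obtain J L where "a \<in> J" "J \<in> C" "b \<in> L" "L \<in> C" using a b by auto
      then obtain M where "a \<in> M" "b \<in> M" "M \<in> C" using tot by blast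
      then show ?thesis using CF[of M] by (auto simp: F_def even_ideal_def)
    qed
    have "even_ideal (\<Union>C)"
      unfolding even_ideal_def
      using CF C(2) add by (auto simp: F_def even_ideal_def subset_eq) blast+
    then show ?thesis using CF C(2) by (auto simp: F_def) 
  qed
  have "I \<in> F" using I disj by (simp add: F_def)
  then have "\<exists>p\<in>F. \<forall>J\<in>F. p \<subseteq> J \<longrightarrow> J = p"
    by (intro Zorn_Lemma2) (use chain in \<open>metis Sup_upper empty_iff\<close>)
  then obtain p where p: "p \<in> F" and max: "\<And>J. J \<in> F \<Longrightarrow> p \<subseteq> J \<Longrightarrow> J = p" by blast
  have pI: "even_ideal p" "I \<subseteq> p" "p \<inter> S = {}" using p by (auto simp: F_def)
  note pe = pI(1)[unfolded even_ideal_def]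
  have meets: "\<exists>i\<in>p. \<exists>c\<in>A\<^sub>0. i \<oplus> c \<otimes> a \<in> S" if a: "a \<in> A\<^sub>0" "a \<notin> p" for a
  proof (rule ccontr)
    assume no: "\<not> ?thesis"
    define J where "J = {i \<oplus> c \<otimes> a |i c. i \<in> p \<and> c \<in> A\<^sub>0}"
    have JI: "i \<oplus> c \<otimes> a \<in> J" if "i \<in> p" "c \<in> A\<^sub>0" for i c
      using that by (auto simp: J_def)
    have zJ: "i \<in> J" if "i \<in> p" for i
      using JI[OF that even_zero] a pe that by (auto simp: subset_eq)
    have "even_ideal J"
      unfolding even_ideal_def
    proof (intro conjI ballI)
      show "J \<subseteq> A\<^sub>0" using pe a by (auto simp: J_def subset_eq)
      show "\<zero> \<in> J" using zJ pe by auto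
    next
      fix x y assume "x \<in> J" "y \<in> J"
      then obtain i c j d where *: "x = i \<oplus> c \<otimes> a" "y = j \<oplus> d \<otimes> a" "i \<in> p" "j \<in> p" "c \<in> A\<^sub>0" "d \<in> A\<^sub>0"
        by (auto simp: J_def)
      then have "x \<oplus> y = (i \<oplus> j) \<oplus> (c \<oplus> d) \<otimes> a"
        using a pe by (auto simp: subset_eq A.l_distr A.a_ac)
      then show "x \<oplus> y \<in> J" using JI[of "i \<oplus> j" "c \<oplus> d"] pe * by auto
    next
      fix e x assume e: "e \<in> A\<^sub>0" and "x \<in> J"
      then obtain i c where *: "x = i \<oplus> c \<otimes> a" "i \<in> p" "c \<in> A\<^sub>0"
        by (auto simp: J_def)
      then have "e \<otimes> x = (e \<otimes> i) \<oplus> (e \<otimes> c) \<otimes> a"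
        using a e pe by (auto simp: subset_eq A.r_distr A.m_assoc)
      then show "e \<otimes> x \<in> J" using JI[of "e \<otimes> i" "e \<otimes> c"] pe e * by auto
    qed
    moreover have "J \<inter> S = {}" using no by (auto simp: J_def)
    ultimately have "J \<in> F" using zJ pI by (auto simp: F_def)
    then have "J = p" using max zJ by auto
    moreover have "a \<in> J" using JI[of \<zero> \<one>] pe a by simp
    ultimately show False using a by simp
  qed
  have "p \<in> prime_spectrum A"
    unfolding prime_spectrum_iff
  proof (intro conjI ballI impI)
    show "even_ideal p" by fact
    obtain s where "s \<in> S" using S(2) by auto
    then have "s \<in> A\<^sub>0" "s \<notin> p" using pI S(1) by auto
    then have "s \<otimes> \<one> \<notin> p" "s \<in> A\<^sub>0" by auto
    then show "\<one> \<notin> p" using pe by blast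
  next
    fix a b assume ab: "a \<in> A\<^sub>0" "b \<in> A\<^sub>0" "a \<otimes> b \<in> p"
    show "a \<in> p \<or> b \<in> p"
    proof (rule ccontr)
      assume "\<not> ?thesis"
      then obtain i c j d where *: "i \<in> p" "c \<in> A\<^sub>0" "i \<oplus> c \<otimes> a \<in> S" "j \<in> p" "d \<in> A\<^sub>0" "j \<oplus> d \<otimes> b \<in> S"
        using meets[of a] meets[of b] ab by auto
      have ij: "i \<in> A\<^sub>0" "j \<in> A\<^sub>0" using * pe by auto
      have "(i \<oplus> c \<otimes> a) \<otimes> (j \<oplus> d \<otimes> b) = (j \<oplus> d \<otimes> b) \<otimes> i \<oplus> ((c \<otimes> a) \<otimes> j \<oplus> (c \<otimes> d) \<otimes> (a \<otimes> b))"
        using * ab ij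
        by (simp add: A.l_distr A.r_distr A.m_assoc A.a_assoc even_comm[of i] even_lcomm[of d a] A.a_ac)
      also have "\<dots> \<in> p"
        using * ab ij pe by (auto simp: A.m_assoc)
      finally show False using S(3)[OF *(3,6)] pI by auto
    qed
  qed
  then show ?thesis using pI by auto
qed

text \<open>This is the source of all local-to-global arguments below: a property of \<open>h\<close> that defines an
ideal and that some \<open>h\<close> outside each prime satisfies holds for \<open>\<one>\<close>.\<close>

lemma one_in_even_ideal:
  assumes "even_ideal I" "\<And>p. p \<in> prime_spectrum A \<Longrightarrow> \<exists>h\<in>I. h \<notin> p"
  shows "\<one> \<in> I"
proof (rule ccontr)
  assume "\<one> \<notin> I"
  then have "\<exists>p\<in>prime_spectrum A. I \<subseteq> p \<and> p \<inter> {\<one>} = {}"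
    by (intro exists_prime_avoiding assms) auto
  then show False using assms(2) by auto
qed

lemma pow_in_even_ideal:
  assumes I: "even_ideal I" and h: "h \<in> A\<^sub>0"
    and "\<And>p. p \<in> prime_spectrum A \<Longrightarrow> h \<notin> p \<Longrightarrow> \<exists>k\<in>I. k \<notin> p"
  shows "\<exists>n::nat. h [^] n \<in> I"
proof (rule ccontr)
  assume no: "\<not> ?thesis"
  let ?S = "range (\<lambda>n::nat. h [^] n)"
  have "\<exists>p\<in>prime_spectrum A. I \<subseteq> p \<and> p \<inter> ?S = {}"
  proof (rule exists_prime_avoiding[OF I])
    fix s t assume "s \<in> ?S" "t \<in> ?S"
    then obtain m n :: nat where "s = h [^] m" "t = h [^] n" by auto
    then have "s \<otimes> t = h [^] (m + n)" using h by (simp add: A.nat_pow_mult)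
    then show "s \<otimes> t \<in> ?S" by auto
  qed (use h no in auto)
  then obtain p where p: "p \<in> prime_spectrum A" "I \<subseteq> p" "p \<inter> ?S = {}" by auto
  have "h [^] (1::nat) \<notin> p" using p(3) by blast
  then have "h \<notin> p" using h by simp
  then show False using assms(3) p by auto
qed


section \<open>Fractions with even denominators\<close>

lemma even_left_commute:
  "a \<in> A\<^sub>0 \<Longrightarrow> b \<in> A\<^sub>0 \<Longrightarrow> c \<in> carrier A \<Longrightarrow> a \<otimes> (b \<otimes> c) = b \<otimes> (a \<otimes> c)"
  by (simp add: even_lcomm[of b a c])

definition mult_set :: "'a set \<Rightarrow> bool" where
  "mult_set S \<longleftrightarrow> S \<subseteq> A\<^sub>0 \<and> \<one> \<in> S \<and> (\<forall>s\<in>S. \<forall>t\<in>S. s \<otimes> t \<in> S)"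

lemma mult_setD:
  assumes "mult_set S"
  shows "s \<in> S \<Longrightarrow> s \<in> A\<^sub>0" "s \<in> S \<Longrightarrow> s \<in> carrier A" "\<one> \<in> S" "s \<in> S \<Longrightarrow> t \<in> S \<Longrightarrow> s \<otimes> t \<in> S"
  using assms by (auto simp: mult_set_def)

lemma mult_set_prime: "p \<in> prime_spectrum A \<Longrightarrow> mult_set (A\<^sub>0 - p)"
  unfolding mult_set_def using primeD(3,6)[of p] by auto

lemma mem_fraction_iff:
  "(b, t) \<in> fraction A S a s \<longleftrightarrow> b \<in> carrier A \<and> t \<in> S \<and> (\<exists>u\<in>S. u \<otimes> (t \<otimes> a) = u \<otimes> (s \<otimes> b))"
  by (simp add: fraction_def)

lemma fraction_eq_iff:
  assumes S: "mult_set S" and ab: "a \<in> carrier A" "b \<in> carrier A" and st: "s \<in> S" "t \<in> S"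
  shows "fraction A S a s = fraction A S b t \<longleftrightarrow> (\<exists>u\<in>S. u \<otimes> (t \<otimes> a) = u \<otimes> (s \<otimes> b))"
proof
  assume eq: "fraction A S a s = fraction A S b t"
  have "(b, t) \<in> fraction A S b t"
    using ab st mult_setD[OF S] by (auto simp: mem_fraction_iff)
  then have "(b, t) \<in> fraction A S a s" using eq by simp
  then show "\<exists>u\<in>S. u \<otimes> (t \<otimes> a) = u \<otimes> (s \<otimes> b)" by (simp add: mem_fraction_iff)
next
  note D = mult_setD[OF S]
  have sub: "fraction A S a s \<subseteq> fraction A S b t"
    if ab: "a \<in> carrier A" "b \<in> carrier A" and st: "s \<in> S" "t \<in> S"
      and u: "u \<in> S" "u \<otimes> (t \<otimes> a) = u \<otimes> (s \<otimes> b)" for a b s t u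
  proof (clarsimp simp: mem_fraction_iff)
    fix c r v
    assume c: "c \<in> carrier A" and r: "r \<in> S" and v: "v \<in> S" "v \<otimes> (r \<otimes> a) = v \<otimes> (s \<otimes> c)"
    have ev: "u \<in> A\<^sub>0" "v \<in> A\<^sub>0" "s \<in> A\<^sub>0" "t \<in> A\<^sub>0" "r \<in> A\<^sub>0" using D u v st r by auto
    have "(u \<otimes> (v \<otimes> s)) \<otimes> (r \<otimes> b) = (v \<otimes> r) \<otimes> (u \<otimes> (s \<otimes> b))"
      using ev ab by (simp add: A.m_assoc even_left_commute)
    also have "\<dots> = (v \<otimes> r) \<otimes> (u \<otimes> (t \<otimes> a))" using u by simp
    also have "\<dots> = (u \<otimes> t) \<otimes> (v \<otimes> (r \<otimes> a))"
      using ev ab by (simp add: A.m_assoc even_left_commute)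
    also have "\<dots> = (u \<otimes> t) \<otimes> (v \<otimes> (s \<otimes> c))" using v by simp
    also have "\<dots> = (u \<otimes> (v \<otimes> s)) \<otimes> (t \<otimes> c)"
      using ev c by (simp add: A.m_assoc even_left_commute)
    finally show "\<exists>w\<in>S. w \<otimes> (r \<otimes> b) = w \<otimes> (t \<otimes> c)"
      using D(4)[OF u(1) D(4)[OF v(1) st(1)]] by blast
  qed
  assume "\<exists>u\<in>S. u \<otimes> (t \<otimes> a) = u \<otimes> (s \<otimes> b)"
  then obtain u where u: "u \<in> S" "u \<otimes> (t \<otimes> a) = u \<otimes> (s \<otimes> b)" by blast
  show "fraction A S a s = fraction A S b t"
    using sub[OF ab st u] sub[OF ab(2,1) st(2,1) u(1) u(2)[symmetric]] by simp
qed

lemma fraction_self: "\<lbrakk>mult_set S; a \<in> carrier A; s \<in> S\<rbrakk> \<Longrightarrow> (a, s) \<in> fraction A S a s"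
  using mult_setD[of S] by (auto simp: mem_fraction_iff)

lemma fraction_mult:
  assumes S: "mult_set S" and ab: "a \<in> carrier A" "b \<in> carrier A" and st: "s \<in> S" "t \<in> S"
  shows "fraction A S a s \<otimes>\<^bsub>localization A S\<^esub> fraction A S b t = fraction A S (a \<otimes> b) (s \<otimes> t)"
proof -
  note D = mult_setD[OF S]
  have eq: "fraction A S (a' \<otimes> b') (s' \<otimes> t') = fraction A S (a \<otimes> b) (s \<otimes> t)"
    if as: "(a', s') \<in> fraction A S a s" and bt: "(b', t') \<in> fraction A S b t" for a' b' s' t'
  proof -
    obtain u v where u: "u \<in> S" "u \<otimes> (s' \<otimes> a) = u \<otimes> (s \<otimes> a')"
      and v: "v \<in> S" "v \<otimes> (t' \<otimes> b) = v \<otimes> (t \<otimes> b')"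
      using as bt by (auto simp: mem_fraction_iff)
    have c: "a' \<in> carrier A" "b' \<in> carrier A" "s' \<in> S" "t' \<in> S"
      using as bt by (auto simp: mem_fraction_iff)
    have ev: "u \<in> A\<^sub>0" "v \<in> A\<^sub>0" "s \<in> A\<^sub>0" "t \<in> A\<^sub>0" "s' \<in> A\<^sub>0" "t' \<in> A\<^sub>0" using D u v st c by auto
    have "(u \<otimes> v) \<otimes> ((s \<otimes> t) \<otimes> (a' \<otimes> b')) = (u \<otimes> (s \<otimes> a')) \<otimes> (v \<otimes> (t \<otimes> b'))"
      using ev c by (simp only: even_interchange[of s t a' b']
          even_interchange[of u v "s \<otimes> a'" "t \<otimes> b'"] even_carrier A.m_closed)
    also have "\<dots> = (u \<otimes> (s' \<otimes> a)) \<otimes> (v \<otimes> (t' \<otimes> b))" using u v by simp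
    also have "\<dots> = (u \<otimes> v) \<otimes> ((s' \<otimes> t') \<otimes> (a \<otimes> b))"
      using ev ab by (simp only: even_interchange[of s' t' a b]
          even_interchange[of u v "s' \<otimes> a" "t' \<otimes> b"] even_carrier A.m_closed)
    finally show ?thesis
      using fraction_eq_iff[OF S, of "a' \<otimes> b'" "a \<otimes> b" "s' \<otimes> t'" "s \<otimes> t"]
        D(4)[OF u(1) v(1)] D(4)[OF st] D(4)[OF c(3,4)] ab c(1,2) by auto
  qed
  have "fraction A S a s \<otimes>\<^bsub>localization A S\<^esub> fraction A S b t =
      (\<Union>(a', s')\<in>fraction A S a s. \<Union>(b', t')\<in>fraction A S b t. fraction A S (a' \<otimes> b') (s' \<otimes> t'))"
    by (simp add: localization_def)
  also have "\<dots> = (\<Union>x\<in>fraction A S a s. \<Union>y\<in>fraction A S b t. fraction A S (a \<otimes> b) (s \<otimes> t))"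
    by (intro SUP_cong refl) (auto simp: eq split: prod.splits)
  also have "\<dots> = fraction A S (a \<otimes> b) (s \<otimes> t)"
    using fraction_self[OF S ab(1) st(1)] fraction_self[OF S ab(2) st(2)] by auto
  finally show ?thesis .
qed

lemma fraction_add:
  assumes S: "mult_set S" and ab: "a \<in> carrier A" "b \<in> carrier A" and st: "s \<in> S" "t \<in> S"
  shows "fraction A S a s \<oplus>\<^bsub>localization A S\<^esub> fraction A S b t
    = fraction A S ((t \<otimes> a) \<oplus> (s \<otimes> b)) (s \<otimes> t)"
proof -
  note D = mult_setD[OF S]
  have eq: "fraction A S ((t' \<otimes> a') \<oplus> (s' \<otimes> b')) (s' \<otimes> t') = fraction A S ((t \<otimes> a) \<oplus> (s \<otimes> b)) (s \<otimes> t)"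
    if as: "(a', s') \<in> fraction A S a s" and bt: "(b', t') \<in> fraction A S b t" for a' b' s' t'
  proof -
    obtain u v where u: "u \<in> S" "u \<otimes> (s' \<otimes> a) = u \<otimes> (s \<otimes> a')"
      and v: "v \<in> S" "v \<otimes> (t' \<otimes> b) = v \<otimes> (t \<otimes> b')"
      using as bt by (auto simp: mem_fraction_iff)
    have c: "a' \<in> carrier A" "b' \<in> carrier A" "s' \<in> S" "t' \<in> S"
      using as bt by (auto simp: mem_fraction_iff)
    have ev: "u \<in> A\<^sub>0" "v \<in> A\<^sub>0" "s \<in> A\<^sub>0" "t \<in> A\<^sub>0" "s' \<in> A\<^sub>0" "t' \<in> A\<^sub>0" using D u v st c by auto
    have "(u \<otimes> v) \<otimes> ((s \<otimes> t) \<otimes> ((t' \<otimes> a') \<oplus> (s' \<otimes> b')))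
        = (v \<otimes> (t \<otimes> t')) \<otimes> (u \<otimes> (s \<otimes> a')) \<oplus> (u \<otimes> (s \<otimes> s')) \<otimes> (v \<otimes> (t \<otimes> b'))"
      using ev c ab by (simp add: A.r_distr A.m_assoc even_left_commute)
    also have "\<dots> = (v \<otimes> (t \<otimes> t')) \<otimes> (u \<otimes> (s' \<otimes> a)) \<oplus> (u \<otimes> (s \<otimes> s')) \<otimes> (v \<otimes> (t' \<otimes> b))"
      using u v by simp
    also have "\<dots> = (u \<otimes> v) \<otimes> ((s' \<otimes> t') \<otimes> ((t \<otimes> a) \<oplus> (s \<otimes> b)))"
      using ev c ab by (simp add: A.r_distr A.m_assoc even_left_commute)
    finally show ?thesis
      using fraction_eq_iff[OF S, of "(t' \<otimes> a') \<oplus> (s' \<otimes> b')" "(t \<otimes> a) \<oplus> (s \<otimes> b)" "s' \<otimes> t'" "s \<otimes> t"]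
        D(4)[OF u(1) v(1)] D(4)[OF st] D(4)[OF c(3,4)] ab c(1,2) ev by auto
  qed
  have "fraction A S a s \<oplus>\<^bsub>localization A S\<^esub> fraction A S b t =
      (\<Union>(a', s')\<in>fraction A S a s. \<Union>(b', t')\<in>fraction A S b t.
        fraction A S ((t' \<otimes> a') \<oplus> (s' \<otimes> b')) (s' \<otimes> t'))"
    by (simp add: localization_def)
  also have "\<dots> = (\<Union>x\<in>fraction A S a s. \<Union>y\<in>fraction A S b t.
        fraction A S ((t \<otimes> a) \<oplus> (s \<otimes> b)) (s \<otimes> t))"
    by (intro SUP_cong refl) (auto simp: eq split: prod.splits)
  also have "\<dots> = fraction A S ((t \<otimes> a) \<oplus> (s \<otimes> b)) (s \<otimes> t)"
    using fraction_self[OF S ab(1) st(1)] fraction_self[OF S ab(2) st(2)] by auto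
  finally show ?thesis .
qed

lemma fraction_smult:
  assumes S: "mult_set S" and c: "c \<in> carrier K" and a: "a \<in> carrier A" and s: "s \<in> S"
  shows "c \<odot>\<^bsub>localization A S\<^esub> fraction A S a s = fraction A S (c \<odot> a) s"
proof -
  note D = mult_setD[OF S]
  have eq: "fraction A S (c \<odot> a') s' = fraction A S (c \<odot> a) s"
    if as: "(a', s') \<in> fraction A S a s" for a' s'
  proof -
    obtain u where u: "u \<in> S" "u \<otimes> (s' \<otimes> a) = u \<otimes> (s \<otimes> a')"
      using as by (auto simp: mem_fraction_iff)
    have a': "a' \<in> carrier A" "s' \<in> S" using as by (auto simp: mem_fraction_iff)
    have "u \<otimes> (s \<otimes> (c \<odot> a')) = c \<odot> (u \<otimes> (s \<otimes> a'))"
      using u a' s c D by (simp add: smult_mult_right)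
    also have "\<dots> = u \<otimes> (s' \<otimes> (c \<odot> a))"
      using u(1) u(2)[symmetric] a a' s c D by (simp add: smult_mult_right)
    finally show ?thesis
      using fraction_eq_iff[OF S, of "c \<odot> a'" "c \<odot> a" s' s] a' a s c u by auto
  qed
  have "c \<odot>\<^bsub>localization A S\<^esub> fraction A S a s = (\<Union>(a', s')\<in>fraction A S a s. fraction A S (c \<odot> a') s')"
    by (simp add: localization_def)
  also have "\<dots> = (\<Union>x\<in>fraction A S a s. fraction A S (c \<odot> a) s)"
    by (intro SUP_cong refl) (auto simp: eq split: prod.splits)
  also have "\<dots> = fraction A S (c \<odot> a) s"
    using fraction_self[OF S a s] by auto
  finally show ?thesis .
qed

section \<open>The Zariski topology\<close>

lemma topspace_zariski: "topspace (zariski A) = prime_spectrum A"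
proof -
  have "\<Union>{{p \<in> prime_spectrum A. f \<notin> p} |f. f \<in> A\<^sub>0} = prime_spectrum A"
    using primeD(3) one_even by blast
  then show ?thesis by (simp add: zariski_def topology_generated_by_topspace)
qed

lemma openin_basic: "f \<in> A\<^sub>0 \<Longrightarrow> openin (zariski A) {p \<in> prime_spectrum A. f \<notin> p}"
  unfolding zariski_def by (rule topology_generated_by_Basis) auto

lemma openin_zariski_subset: "openin (zariski A) V \<Longrightarrow> V \<subseteq> prime_spectrum A"
  using openin_subset topspace_zariski by metis

lemma basic_nbhd:
  assumes "openin (zariski A) V" "p \<in> V"
  shows "\<exists>u\<in>A\<^sub>0. u \<notin> p \<and> (\<forall>q\<in>prime_spectrum A. u \<notin> q \<longrightarrow> q \<in> V)"
proof -
  have "generate_topology_on {{p \<in> prime_spectrum A. f \<notin> p} |f. f \<in> A\<^sub>0} V"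
    using assms(1) unfolding zariski_def openin_topology_generated_by_iff .
  moreover have "p \<in> prime_spectrum A" using openin_zariski_subset assms by auto
  ultimately show ?thesis using assms(2)
  proof (induction)
    case Empty then show ?case by simp
  next
    case (Int V W)
    then obtain u v where uv: "u \<in> A\<^sub>0" "u \<notin> p" "\<And>q. q \<in> prime_spectrum A \<Longrightarrow> u \<notin> q \<Longrightarrow> q \<in> V"
       "v \<in> A\<^sub>0" "v \<notin> p" "\<And>q. q \<in> prime_spectrum A \<Longrightarrow> v \<notin> q \<Longrightarrow> q \<in> W" by auto
    show ?case
    proof (intro bexI[of _ "u \<otimes> v"] conjI ballI impI)
      show "u \<otimes> v \<notin> p" using primeD(6)[OF Int.prems(1)] uv by blast
      fix q assume q: "q \<in> prime_spectrum A" "u \<otimes> v \<notin> q"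
      then have "u \<notin> q" "v \<notin> q" using primeD(5)[OF q(1)] uv even_central[of u v] by (metis even_carrier)+
      then show "q \<in> V \<inter> W" using uv q by auto
    qed (use uv in auto)
  next
    case (UN \<V>)
    then show ?case by blast
  next
    case (Basis V)
    then show ?case by auto
  qed
qed


section \<open>Global sections of the superspectrum\<close>

abbreviation frac :: "'a set \<Rightarrow> 'a \<Rightarrow> 'a \<Rightarrow> ('a \<times> 'a) set" where
  "frac p a s \<equiv> fraction A (A\<^sub>0 - p) a s"

abbreviation Spec :: "'a set set" where "Spec \<equiv> prime_spectrum A"

lemma frac_eq_iff:
  assumes "p \<in> Spec" "a \<in> carrier A" "b \<in> carrier A" "s \<in> A\<^sub>0" "s \<notin> p" "t \<in> A\<^sub>0" "t \<notin> p"
  shows "frac p a s = frac p b t \<longleftrightarrow> (\<exists>u\<in>A\<^sub>0. u \<notin> p \<and> u \<otimes> (t \<otimes> a) = u \<otimes> (s \<otimes> b))"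
  using fraction_eq_iff[OF mult_set_prime[OF assms(1)] assms(2,3), of s t] assms by auto

lemma frac_scale:
  assumes "p \<in> Spec" "a \<in> carrier A" "s \<in> A\<^sub>0" "s \<notin> p" "u \<in> A\<^sub>0" "u \<notin> p"
  shows "frac p (u \<otimes> a) (u \<otimes> s) = frac p a s"
proof -
  have "u \<otimes> s \<notin> p" using primeD(6)[OF assms(1)] assms by blast
  moreover have "\<one> \<otimes> (s \<otimes> (u \<otimes> a)) = \<one> \<otimes> ((u \<otimes> s) \<otimes> a)"
    using assms by (simp add: A.m_assoc even_left_commute)
  ultimately show ?thesis
    using frac_eq_iff[of p "u \<otimes> a" a "u \<otimes> s" s] assms primeD(3)[OF assms(1)] one_even
    by (meson A.m_closed even_carrier even_even)
qed

lemma frac_mult: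
  assumes "p \<in> Spec" "a \<in> carrier A" "b \<in> carrier A" "s \<in> A\<^sub>0" "s \<notin> p" "t \<in> A\<^sub>0" "t \<notin> p"
  shows "frac p a s \<otimes>\<^bsub>loc_at A p\<^esub> frac p b t = frac p (a \<otimes> b) (s \<otimes> t)"
  using fraction_mult[OF mult_set_prime[OF assms(1)] assms(2,3)] assms by auto

lemma frac_add:
  assumes "p \<in> Spec" "a \<in> carrier A" "b \<in> carrier A"
  shows "frac p a \<one> \<oplus>\<^bsub>loc_at A p\<^esub> frac p b \<one> = frac p (a \<oplus> b) \<one>"
  using fraction_add[OF mult_set_prime[OF assms(1)] assms(2,3), of \<one> \<one>] assms
    primeD(3)[OF assms(1)] by auto

lemma frac_in_loc: "a \<in> carrier A \<Longrightarrow> s \<in> A\<^sub>0 \<Longrightarrow> s \<notin> p \<Longrightarrow> frac p a s \<in> carrier (loc_at A p)"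
  by (auto simp: localization_def)

lemma SSpec_base [simp]: "base (SSpec A) = zariski A"
  and SSpec_res [simp]: "res (SSpec A) U V s = restrict s V"
  and SSpec_carrier [simp]: "carrier (sect (SSpec A) U) = SSpec_sections A U"
  by (simp_all add: SSpec_def)

lemma SSpec_sections_point:
  assumes "s \<in> SSpec_sections A U" "p \<in> U"
  obtains V a f where "openin (zariski A) V" "p \<in> V" "V \<subseteq> U" "a \<in> carrier A" "f \<in> A\<^sub>0"
    "\<forall>q\<in>V. f \<notin> q" "\<forall>q\<in>V. s q = frac q a f"
proof -
  have "\<forall>p\<in>U. \<exists>V a f. openin (zariski A) V \<and> p \<in> V \<and> V \<subseteq> U \<and> a \<in> carrier A \<and> f \<in> A\<^sub>0 \<and>
      (\<forall>q\<in>V. f \<notin> q \<and> s q = frac q a f)"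
    using assms(1) unfolding SSpec_sections_def mem_Collect_eq by (rule conjunct2)
  from bspec[OF this assms(2)] show thesis using that by metis
qed

lemma fraction_section:
  assumes V: "openin (zariski A) V" and a: "a \<in> carrier A" and f: "f \<in> A\<^sub>0" "\<And>q. q \<in> V \<Longrightarrow> f \<notin> q"
  shows "(\<lambda>q\<in>V. frac q a f) \<in> SSpec_sections A V"
  unfolding SSpec_sections_def
proof (intro CollectI conjI ballI)
  show "(\<lambda>q\<in>V. frac q a f) \<in> (\<Pi>\<^sub>E p\<in>V. carrier (loc_at A p))"
    using a f by (auto intro: frac_in_loc)
  fix p assume "p \<in> V"
  then show "\<exists>W b g. openin (zariski A) W \<and> p \<in> W \<and> W \<subseteq> V \<and> b \<in> carrier A \<and> g \<in> A\<^sub>0 \<and>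
      (\<forall>q\<in>W. g \<notin> q \<and> (\<lambda>q\<in>V. frac q a f) q = frac q b g)"
    using V a f by (intro exI[of _ V] exI[of _ a] exI[of _ f]) auto
qed

lemma global_section_eq: "global_section A a = (\<lambda>p\<in>Spec. frac p a \<one>)"
  by (simp add: global_section_def topspace_zariski)

lemma open_Spec [simp]: "openin (zariski A) Spec"
  using openin_topspace topspace_zariski by metis

lemma global_section_closed [simp]: "a \<in> carrier A \<Longrightarrow> global_section A a \<in> SSpec_sections A Spec"
  unfolding global_section_eq by (rule fraction_section) (auto dest: primeD)

lemma ann_even_ideal:
  assumes "a \<in> carrier A" "b \<in> carrier A"
  shows "even_ideal {h \<in> A\<^sub>0. h \<otimes> a = h \<otimes> b}"
  unfolding even_ideal_def using assms by (auto simp: A.l_distr A.m_assoc)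

lemma global_section_inj:
  assumes ab: "a \<in> carrier A" "b \<in> carrier A" and eq: "global_section A a = global_section A b"
  shows "a = b"
proof -
  have "\<one> \<in> {h \<in> A\<^sub>0. h \<otimes> a = h \<otimes> b}"
  proof (rule one_in_even_ideal[OF ann_even_ideal[OF ab]])
    fix p assume p: "p \<in> Spec"
    have "frac p a \<one> = frac p b \<one>"
      using fun_cong[OF eq, of p] p by (simp add: global_section_eq)
    then obtain u where "u \<in> A\<^sub>0" "u \<notin> p" "u \<otimes> (\<one> \<otimes> a) = u \<otimes> (\<one> \<otimes> b)"
      using frac_eq_iff[OF p ab, of \<one> \<one>] primeD(3)[OF p] by auto
    then show "\<exists>h\<in>{h \<in> A\<^sub>0. h \<otimes> a = h \<otimes> b}. h \<notin> p" using ab by auto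
  qed
  then show ?thesis using ab by simp
qed

text \<open>The even \<open>h\<close> for which \<open>h \<otimes> a\<close> has the given parity form an ideal, and a local representation of
\<open>a\<close> by a fraction of that parity supplies such an \<open>h\<close> outside the prime.\<close>

lemma loc_parity_reflect:
  assumes N: "N = A\<^sub>0 \<or> N = A\<^sub>1" and a: "a \<in> carrier A"
    and loc: "\<And>p. p \<in> Spec \<Longrightarrow> \<exists>b\<in>N. \<exists>s\<in>A\<^sub>0 - p. frac p a \<one> = frac p b s"
  shows "a \<in> N"
proof -
  have "\<one> \<in> {h \<in> A\<^sub>0. h \<otimes> a \<in> N}"
  proof (rule one_in_even_ideal)
    show "even_ideal {h \<in> A\<^sub>0. h \<otimes> a \<in> N}"
      unfolding even_ideal_def using N a by (auto simp: A.l_distr A.m_assoc)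
    fix p assume p: "p \<in> Spec"
    obtain b s where b: "b \<in> N" "s \<in> A\<^sub>0" "s \<notin> p" "frac p a \<one> = frac p b s"
      using loc[OF p] by auto
    have bc: "b \<in> carrier A" using b N by auto
    obtain u where u: "u \<in> A\<^sub>0" "u \<notin> p" "u \<otimes> (s \<otimes> a) = u \<otimes> (\<one> \<otimes> b)"
      using frac_eq_iff[OF p a bc, of \<one> s] b primeD(3)[OF p] by auto
    have "(u \<otimes> s) \<otimes> a \<in> N" using u b N bc a by (auto simp: A.m_assoc)
    moreover have "u \<otimes> s \<notin> p" using primeD(6)[OF p, of u s] u b by auto
    ultimately show "\<exists>h\<in>{h \<in> A\<^sub>0. h \<otimes> a \<in> N}. h \<notin> p"
      using u(1) b(2) by (intro bexI[of _ "u \<otimes> s"]) auto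
  qed
  then show ?thesis using a by simp
qed

lemma even_part_sections:
  "s \<in> even_part (sect (SSpec A) U) \<longleftrightarrow> s \<in> SSpec_sections A U \<and>
    (\<forall>p\<in>U. \<exists>b\<in>A\<^sub>0. \<exists>t\<in>A\<^sub>0 - p. s p = frac p b t)"
  unfolding SSpec_def localization_def by simp blast

lemma odd_part_sections:
  "s \<in> odd_part (sect (SSpec A) U) \<longleftrightarrow> s \<in> SSpec_sections A U \<and>
    (\<forall>p\<in>U. \<exists>b\<in>A\<^sub>1. \<exists>t\<in>A\<^sub>0 - p. s p = frac p b t)"
  unfolding SSpec_def localization_def by simp blast

lemma global_section_even:
  assumes "a \<in> carrier A"
  shows "global_section A a \<in> even_part (sect (SSpec A) Spec) \<longleftrightarrow> a \<in> A\<^sub>0"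
proof
  assume "global_section A a \<in> even_part (sect (SSpec A) Spec)"
  then show "a \<in> A\<^sub>0"
    using loc_parity_reflect[of "A\<^sub>0" a] assms
    by (auto simp: even_part_sections global_section_eq)
next
  assume "a \<in> A\<^sub>0"
  then show "global_section A a \<in> even_part (sect (SSpec A) Spec)"
    unfolding even_part_sections using primeD(3) one_even assms
    by (simp add: global_section_eq[symmetric]) (force simp: global_section_eq)
qed

lemma global_section_odd:
  assumes "a \<in> carrier A"
  shows "global_section A a \<in> odd_part (sect (SSpec A) Spec) \<longleftrightarrow> a \<in> A\<^sub>1"
proof
  assume "global_section A a \<in> odd_part (sect (SSpec A) Spec)"
  then show "a \<in> A\<^sub>1"
    using loc_parity_reflect[of "A\<^sub>1" a] assms
    by (auto simp: odd_part_sections global_section_eq)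
next
  assume "a \<in> A\<^sub>1"
  then show "global_section A a \<in> odd_part (sect (SSpec A) Spec)"
    unfolding odd_part_sections using primeD(3) one_even assms
    by (simp add: global_section_eq[symmetric]) (force simp: global_section_eq)
qed

lemma sections_mult: "p \<in> U \<Longrightarrow> (s \<otimes>\<^bsub>sect (SSpec A) U\<^esub> t) p = s p \<otimes>\<^bsub>loc_at A p\<^esub> t p"
  by (simp add: SSpec_def)

lemma global_section_hom: "global_section A \<in> superalg_hom K A (sect (SSpec A) Spec)"
proof -
  have "global_section A \<in> ring_hom A (sect (SSpec A) Spec)"
  proof (rule ring_hom_memI)
    show "global_section A \<one> = \<one>\<^bsub>sect (SSpec A) Spec\<^esub>"
      by (auto simp: SSpec_def localization_def global_section_eq)
  qed (auto simp: SSpec_def global_section_eq frac_mult frac_add primeD(3) fun_eq_iff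
        intro: fraction_section)
  moreover have "global_section A (c \<odot> a) = c \<odot>\<^bsub>sect (SSpec A) Spec\<^esub> global_section A a"
    if "c \<in> carrier K" "a \<in> carrier A" for c a
    using that fraction_smult[OF mult_set_prime that, of _ \<one>] primeD(3)
    by (auto simp: SSpec_def global_section_eq fun_eq_iff)
  ultimately show ?thesis
    by (auto simp: superalg_hom_def global_section_even global_section_odd)
qed


text \<open>The even elements whose basic open set is covered by finitely many members of the family form
an ideal, so no choice of coefficients in a partition of unity is involved.\<close>

lemma Spec_compact:
  assumes H: "H \<subseteq> A\<^sub>0" and cov: "\<And>p. p \<in> Spec \<Longrightarrow> \<exists>h\<in>H. h \<notin> p"
  obtains F where "finite F" "F \<subseteq> H" "\<And>p. p \<in> Spec \<Longrightarrow> \<exists>h\<in>F. h \<notin> p"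
proof -
  define I where "I = {h \<in> A\<^sub>0. \<exists>F. finite F \<and> F \<subseteq> H \<and> (\<forall>p\<in>Spec. h \<notin> p \<longrightarrow> (\<exists>f\<in>F. f \<notin> p))}"
  have "\<one> \<in> I"
  proof (rule one_in_even_ideal)
    show "even_ideal I"
      unfolding even_ideal_def
    proof (intro conjI ballI)
      show "\<zero> \<in> I" using primeD(2) by (auto simp: I_def)
    next
      fix a b assume "a \<in> I" "b \<in> I"
      then obtain F G where F: "a \<in> A\<^sub>0" "b \<in> A\<^sub>0" "finite F" "F \<subseteq> H" "finite G" "G \<subseteq> H"
        "\<forall>p\<in>Spec. a \<notin> p \<longrightarrow> (\<exists>f\<in>F. f \<notin> p)" "\<forall>p\<in>Spec. b \<notin> p \<longrightarrow> (\<exists>f\<in>G. f \<notin> p)"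
        by (auto simp: I_def)
      have "\<forall>p\<in>Spec. a \<oplus> b \<notin> p \<longrightarrow> (\<exists>f\<in>F \<union> G. f \<notin> p)"
      proof (intro ballI impI)
        fix p assume p: "p \<in> Spec" and "a \<oplus> b \<notin> p"
        then have "a \<notin> p \<or> b \<notin> p" using primeD(4)[OF p, of a b] by auto
        then show "\<exists>f\<in>F \<union> G. f \<notin> p" using F(7,8) p by auto
      qed
      then show "a \<oplus> b \<in> I" using F(1-6) unfolding I_def by (auto intro!: exI[of _ "F \<union> G"])
    next
      fix c a assume c: "c \<in> A\<^sub>0" and "a \<in> I"
      then obtain F where F: "a \<in> A\<^sub>0" "finite F" "F \<subseteq> H" "\<forall>p\<in>Spec. a \<notin> p \<longrightarrow> (\<exists>f\<in>F. f \<notin> p)"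
        by (auto simp: I_def)
      have "\<forall>p\<in>Spec. c \<otimes> a \<notin> p \<longrightarrow> (\<exists>f\<in>F. f \<notin> p)"
        using F(4) primeD(5)[OF _ c, of _ a] by metis
      then show "c \<otimes> a \<in> I" using F(1-3) c unfolding I_def by auto
    qed (auto simp: I_def)
    fix p assume "p \<in> Spec"
    then obtain h where h: "h \<in> H" "h \<notin> p" using cov by auto
    moreover have "h \<in> I" using h H unfolding I_def by (auto intro!: exI[of _ "{h}"])
    ultimately show "\<exists>h\<in>I. h \<notin> p" by auto
  qed
  then show thesis using that primeD(3) unfolding I_def by auto
qed

text \<open>The annihilator of \<open>k \<otimes> a \<ominus> h \<otimes> b\<close> is contained in no prime avoiding \<open>h \<otimes> k\<close>, so it contains a
power of \<open>h \<otimes> k\<close>. All larger exponents work too, which allows one exponent for finitely many pairs.\<close>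

lemma fractions_agree_power:
  assumes ab: "a \<in> carrier A" "b \<in> carrier A" and hk: "h \<in> A\<^sub>0" "k \<in> A\<^sub>0"
    and agree: "\<And>q. q \<in> Spec \<Longrightarrow> h \<notin> q \<Longrightarrow> k \<notin> q \<Longrightarrow> frac q a h = frac q b k"
  shows "\<exists>N. \<forall>n\<ge>N. (h \<otimes> k) [^] (n::nat) \<otimes> (k \<otimes> a) = (h \<otimes> k) [^] n \<otimes> (h \<otimes> b)"
proof -
  have c: "k \<otimes> a \<in> carrier A" "h \<otimes> b \<in> carrier A" using ab hk by auto
  obtain N :: nat where N: "(h \<otimes> k) [^] N \<in> {e \<in> A\<^sub>0. e \<otimes> (k \<otimes> a) = e \<otimes> (h \<otimes> b)}"
  proof (atomize_elim, rule pow_in_even_ideal[OF ann_even_ideal[OF c]])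
    show "h \<otimes> k \<in> A\<^sub>0" using hk by simp
    fix p assume p: "p \<in> Spec" and "h \<otimes> k \<notin> p"
    then have "h \<notin> p" "k \<notin> p"
      using primeD(5)[OF p, of k h] primeD(5)[OF p, of h k] hk even_central[of h k] by auto
    then show "\<exists>e\<in>{e \<in> A\<^sub>0. e \<otimes> (k \<otimes> a) = e \<otimes> (h \<otimes> b)}. e \<notin> p"
      using agree[OF p] frac_eq_iff[OF p ab, of h k] hk by auto
  qed
  show ?thesis
  proof (intro exI[of _ N] allI impI)
    fix n assume "N \<le> n"
    then have "(h \<otimes> k) [^] n = (h \<otimes> k) [^] (n - N) \<otimes> (h \<otimes> k) [^] N"
      using hk by (simp add: A.nat_pow_mult)
    then show "(h \<otimes> k) [^] n \<otimes> (k \<otimes> a) = (h \<otimes> k) [^] n \<otimes> (h \<otimes> b)"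
      using N c hk by (simp add: A.m_assoc)
  qed
qed

text \<open>Shrinking the open set to a basic one and multiplying numerator and denominator by the element
that defines it makes the denominator itself describe where the fraction is valid.\<close>

lemma section_local_fraction:
  assumes s: "s \<in> SSpec_sections A Spec" and p: "p \<in> Spec"
  obtains a h where "a \<in> carrier A" "h \<in> A\<^sub>0" "h \<notin> p" "\<forall>q\<in>Spec. h \<notin> q \<longrightarrow> s q = frac q a h"
proof -
  obtain V a f where V: "openin (zariski A) V" "p \<in> V" "V \<subseteq> Spec" "a \<in> carrier A" "f \<in> A\<^sub>0"
    "\<forall>q\<in>V. f \<notin> q" "\<forall>q\<in>V. s q = frac q a f"
    using SSpec_sections_point[OF s p] .
  obtain u where u: "u \<in> A\<^sub>0" "u \<notin> p" "\<forall>q\<in>Spec. u \<notin> q \<longrightarrow> q \<in> V"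
    using basic_nbhd[OF V(1,2)] by auto
  show thesis
  proof (rule that[of "u \<otimes> a" "u \<otimes> f"])
    show "u \<otimes> f \<notin> p" using primeD(6)[OF p] u V by blast
    show "\<forall>q\<in>Spec. u \<otimes> f \<notin> q \<longrightarrow> s q = frac q (u \<otimes> a) (u \<otimes> f)"
    proof (intro ballI impI)
      fix q assume q: "q \<in> Spec" and "u \<otimes> f \<notin> q"
      then have "u \<notin> q" "f \<notin> q"
        using primeD(5)[OF q, of u f] primeD(5)[OF q, of f u] u(1) V(5) even_central[of u f] by auto
      then show "s q = frac q (u \<otimes> a) (u \<otimes> f)"
        using frac_scale[OF q V(4,5)] u q V(7) by auto
    qed
  qed (use u V in auto)
qed

text \<open>By compactness a section is given by finitely many fractions \<open>b / k\<close>. After raising to a common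
power the numerators \<open>k [^] n \<otimes> b\<close> and denominators \<open>k [^] Suc n\<close> of any two of them satisfy the exact
cross relation. Those even \<open>e\<close> for which \<open>e\<close> times the section is global form an ideal that
contains all the denominators, hence \<open>\<one>\<close>.\<close>

lemma global_section_surj:
  assumes s: "s \<in> SSpec_sections A Spec"
  obtains a where "a \<in> carrier A" "s = global_section A a"
proof -
  define P where "P = {(a, h). a \<in> carrier A \<and> h \<in> A\<^sub>0 \<and> (\<forall>q\<in>Spec. h \<notin> q \<longrightarrow> s q = frac q a h)}"
  have "\<exists>h\<in>snd ` P. h \<notin> p" if p: "p \<in> Spec" for p
  proof -
    obtain a h where "a \<in> carrier A" "h \<in> A\<^sub>0" "h \<notin> p" "\<forall>q\<in>Spec. h \<notin> q \<longrightarrow> s q = frac q a h"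
      using section_local_fraction[OF s p] by metis
    then have "(a, h) \<in> P" "h \<notin> p" by (simp_all add: P_def)
    then show ?thesis by force
  qed
  moreover have "snd ` P \<subseteq> A\<^sub>0" by (auto simp: P_def)
  ultimately obtain G where G: "finite G" "G \<subseteq> snd ` P" "\<And>p. p \<in> Spec \<Longrightarrow> \<exists>h\<in>G. h \<notin> p"
    using Spec_compact[of "snd ` P"] by metis
  then obtain F where F: "finite F" "F \<subseteq> P" "G = snd ` F"
    by (meson finite_subset_image)
  have FP: "b \<in> carrier A" "k \<in> A\<^sub>0" "\<And>q. q \<in> Spec \<Longrightarrow> k \<notin> q \<Longrightarrow> s q = frac q b k"
    if "(b, k) \<in> F" for b k
    using that F(2) unfolding P_def by auto
  define Q where "Q z n \<longleftrightarrow> (case z of ((a, h), (b, k)) \<Rightarrow>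
    (h \<otimes> k) [^] n \<otimes> (k \<otimes> a) = (h \<otimes> k) [^] n \<otimes> (h \<otimes> b))" for z and n :: nat
  have "eventually (Q z) sequentially" if z: "z \<in> F \<times> F" for z
  proof -
    obtain a h b k where z_eq: "z = ((a, h), (b, k))" by (metis surj_pair)
    then have "(a, h) \<in> F" "(b, k) \<in> F" using z by auto
    then have "\<exists>N. \<forall>n\<ge>N. (h \<otimes> k) [^] (n::nat) \<otimes> (k \<otimes> a) = (h \<otimes> k) [^] n \<otimes> (h \<otimes> b)"
      by (intro fractions_agree_power) (use FP[of a h] FP[of b k] in auto)
    then show ?thesis by (simp add: Q_def z_eq eventually_sequentially)
  qed
  then have "eventually (\<lambda>n. \<forall>z\<in>F \<times> F. Q z n) sequentially"
    using F(1) by (intro eventually_ball_finite) auto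
  then obtain n where "\<forall>z\<in>F \<times> F. Q z n"
    by (auto simp: eventually_sequentially)
  then have n: "(h \<otimes> k) [^] n \<otimes> (k \<otimes> a) = (h \<otimes> k) [^] n \<otimes> (h \<otimes> b)"
    if "(a, h) \<in> F" "(b, k) \<in> F" for a h b k
    using that by (force simp: Q_def)
  \<comment> \<open>the denominators \<open>e\<close> for which \<open>e\<close> times the section is the global element \<open>a\<close>\<close>
  define I where "I = {e \<in> A\<^sub>0. \<exists>a\<in>carrier A. \<forall>(b, k)\<in>F. e \<otimes> (k [^] n \<otimes> b) = k [^] Suc n \<otimes> a}"
  have "\<one> \<in> I"
  proof (rule one_in_even_ideal)
    show "even_ideal I"
      unfolding even_ideal_def
    proof (intro conjI ballI)
      show "\<zero> \<in> I" unfolding I_def using FP by (auto intro!: bexI[of _ \<zero>])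
    next
      fix d e assume "d \<in> I" "e \<in> I"
      then obtain a a' where *: "d \<in> A\<^sub>0" "e \<in> A\<^sub>0" "a \<in> carrier A" "a' \<in> carrier A"
        "\<forall>(b, k)\<in>F. d \<otimes> (k [^] n \<otimes> b) = k [^] Suc n \<otimes> a"
        "\<forall>(b, k)\<in>F. e \<otimes> (k [^] n \<otimes> b) = k [^] Suc n \<otimes> a'"
        by (auto simp: I_def)
      have "\<forall>(b, k)\<in>F. (d \<oplus> e) \<otimes> (k [^] n \<otimes> b) = k [^] Suc n \<otimes> (a \<oplus> a')"
      proof clarify
        fix b k assume bk: "(b, k) \<in> F"
        then have c: "b \<in> carrier A" "k \<in> A\<^sub>0" using FP by auto
        then have "(d \<oplus> e) \<otimes> (k [^] n \<otimes> b) = d \<otimes> (k [^] n \<otimes> b) \<oplus> e \<otimes> (k [^] n \<otimes> b)"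
          using * by (simp add: A.l_distr)
        also have "\<dots> = k [^] Suc n \<otimes> (a \<oplus> a')"
          unfolding bspec[OF *(5) bk, unfolded prod.case] bspec[OF *(6) bk, unfolded prod.case]
          using *(3,4) c even_pow[of k "Suc n"] by (intro A.r_distr[symmetric]) auto
        finally show "(d \<oplus> e) \<otimes> (k [^] n \<otimes> b) = k [^] Suc n \<otimes> (a \<oplus> a')" .
      qed
      then show "d \<oplus> e \<in> I" using *(1-4) unfolding I_def by (auto intro!: bexI[of _ "a \<oplus> a'"])
    next
      fix c e assume c: "c \<in> A\<^sub>0" and "e \<in> I"
      then obtain a where *: "e \<in> A\<^sub>0" "a \<in> carrier A"
        "\<forall>(b, k)\<in>F. e \<otimes> (k [^] n \<otimes> b) = k [^] Suc n \<otimes> a"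
        by (auto simp: I_def)
      have "\<forall>(b, k)\<in>F. (c \<otimes> e) \<otimes> (k [^] n \<otimes> b) = k [^] Suc n \<otimes> (c \<otimes> a)"
      proof clarify
        fix b k assume bk: "(b, k) \<in> F"
        then have bc: "b \<in> carrier A" "k \<in> A\<^sub>0" using FP by auto
        then have "(c \<otimes> e) \<otimes> (k [^] n \<otimes> b) = c \<otimes> (e \<otimes> (k [^] n \<otimes> b))"
          using * c by (simp add: A.m_assoc)
        also have "\<dots> = c \<otimes> (k [^] Suc n \<otimes> a)"
          unfolding bspec[OF *(3) bk, unfolded prod.case] ..
        also have "\<dots> = k [^] Suc n \<otimes> (c \<otimes> a)"
          using c bc *(2) even_pow[of k "Suc n"] by (intro even_left_commute) auto
        finally show "(c \<otimes> e) \<otimes> (k [^] n \<otimes> b) = k [^] Suc n \<otimes> (c \<otimes> a)" .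
      qed
      then show "c \<otimes> e \<in> I" using *(1,2) c unfolding I_def by (auto intro!: bexI[of _ "c \<otimes> a"])
    qed (auto simp: I_def)
    fix p assume p: "p \<in> Spec"
    then obtain b k where bk: "(b, k) \<in> F" "k \<notin> p" using G(3) F(3) by fastforce
    have c: "b \<in> carrier A" "k \<in> A\<^sub>0" using FP[OF bk(1)] by auto
    have "\<forall>(d, h)\<in>F. k [^] Suc n \<otimes> (h [^] n \<otimes> d) = h [^] Suc n \<otimes> (k [^] n \<otimes> b)"
    proof clarify
      fix d h assume dh: "(d, h) \<in> F"
      then have e: "d \<in> carrier A" "h \<in> A\<^sub>0" using FP by auto
      have "k [^] Suc n \<otimes> (h [^] n \<otimes> d) = (h \<otimes> k) [^] n \<otimes> (k \<otimes> d)"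
        using c e by (simp add: even_pow_mult A.m_assoc even_left_commute)
      also have "\<dots> = (h \<otimes> k) [^] n \<otimes> (h \<otimes> b)" using n[OF dh bk(1)] .
      also have "\<dots> = h [^] Suc n \<otimes> (k [^] n \<otimes> b)"
        using c e by (simp add: even_pow_mult A.m_assoc even_left_commute)
      finally show "k [^] Suc n \<otimes> (h [^] n \<otimes> d) = h [^] Suc n \<otimes> (k [^] n \<otimes> b)" .
    qed
    then have "k [^] Suc n \<in> I"
      unfolding I_def using c even_pow[OF c(2), of "Suc n"]
      by (auto intro!: bexI[of _ "k [^] n \<otimes> b"])
    moreover have "k [^] Suc n \<notin> p" using prime_pow[OF p c(2)] bk by blast
    ultimately show "\<exists>h\<in>I. h \<notin> p" by auto
  qed
  then obtain a where a: "a \<in> carrier A" "\<forall>(b, k)\<in>F. \<one> \<otimes> (k [^] n \<otimes> b) = k [^] Suc n \<otimes> a"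
    by (auto simp: I_def)
  have "s = global_section A a"
  proof
    fix p show "s p = global_section A a p"
    proof (cases "p \<in> Spec")
      case False
      then show ?thesis using s by (auto simp: SSpec_sections_def global_section_eq PiE_def extensional_def)
    next
      case p: True
      then obtain b k where bk: "(b, k) \<in> F" "k \<notin> p" using G(3) F(3) by fastforce
      have c: "b \<in> carrier A" "k \<in> A\<^sub>0" using FP[OF bk(1)] by auto
      have "\<one> \<otimes> (k [^] n \<otimes> b) = k [^] Suc n \<otimes> a"
        using bspec[OF a(2) bk(1)] by (simp only: prod.case)
      then have "k [^] n \<otimes> (\<one> \<otimes> b) = k [^] n \<otimes> (k \<otimes> a)" using c a(1) by (simp add: A.m_assoc)
      moreover have "k [^] n \<notin> p" "k [^] n \<in> A\<^sub>0" using prime_pow[OF p c(2)] bk(2) c by auto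
      ultimately have "frac p b k = frac p a \<one>"
        using frac_eq_iff[OF p c(1) a(1), of k \<one>] c bk primeD(3)[OF p] by auto
      then show ?thesis using FP(3)[OF bk(1) p bk(2)] p by (simp add: global_section_eq)
    qed
  qed
  then show thesis using that a by blast
qed

lemma superalg_homD:
  assumes "\<phi> \<in> superalg_hom K R B"
  shows "s \<in> carrier R \<Longrightarrow> \<phi> s \<in> carrier B"
    "s \<in> carrier R \<Longrightarrow> t \<in> carrier R \<Longrightarrow> \<phi> (s \<otimes>\<^bsub>R\<^esub> t) = \<phi> s \<otimes>\<^bsub>B\<^esub> \<phi> t"
    "s \<in> carrier R \<Longrightarrow> t \<in> carrier R \<Longrightarrow> \<phi> (s \<oplus>\<^bsub>R\<^esub> t) = \<phi> s \<oplus>\<^bsub>B\<^esub> \<phi> t"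
    "\<phi> \<one>\<^bsub>R\<^esub> = \<one>\<^bsub>B\<^esub>"
    "c \<in> carrier K \<Longrightarrow> s \<in> carrier R \<Longrightarrow> \<phi> (c \<odot>\<^bsub>R\<^esub> s) = c \<odot>\<^bsub>B\<^esub> \<phi> s"
    "s \<in> even_part R \<Longrightarrow> \<phi> s \<in> even_part B"
    "s \<in> odd_part R \<Longrightarrow> \<phi> s \<in> odd_part B"
  using assms unfolding superalg_hom_def ring_hom_def by auto

text \<open>Since global sections are elements of \<open>A\<close>, including their parity, a homomorphism into the
global sections is one into \<open>A\<close>.\<close>

lemma lift_to_global:
  assumes \<sigma>: "\<sigma> \<in> superalg_hom K R (sect (SSpec A) Spec)" and R: "superalgebra K R"
  shows "\<exists>\<phi>\<in>superalg_hom K R A. \<forall>s\<in>carrier R. \<sigma> s = global_section A (\<phi> s)"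
proof -
  interpret R: superalgebra K R by fact
  define \<phi> where "\<phi> s = (THE a. a \<in> carrier A \<and> \<sigma> s = global_section A a)" for s
  note \<sigma>D = superalg_homD[OF \<sigma>] and gD = superalg_homD[OF global_section_hom]
  have \<phi>: "\<phi> s \<in> carrier A \<and> \<sigma> s = global_section A (\<phi> s)" if "s \<in> carrier R" for s
  proof -
    have "\<sigma> s \<in> SSpec_sections A Spec" using \<sigma>D(1)[OF that] by simp
    then have "\<exists>!a. a \<in> carrier A \<and> \<sigma> s = global_section A a"
      using global_section_surj global_section_inj by metis
    then show ?thesis unfolding \<phi>_def by (rule theI')
  qed
  have inj: "\<phi> s = a" if "s \<in> carrier R" "a \<in> carrier A" "\<sigma> s = global_section A a" for s a
    using global_section_inj \<phi> that by metis
  have ev: "even_part R \<subseteq> carrier R" and od: "odd_part R \<subseteq> carrier R"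
    using R.submoduleE(1)[OF R.even_submodule] R.submoduleE(1)[OF R.odd_submodule] by auto
  have "\<phi> \<in> superalg_hom K R A"
    unfolding superalg_hom_def
  proof (intro CollectI conjI ballI ring_hom_memI subsetI)
    fix s t assume st: "s \<in> carrier R" "t \<in> carrier R"
    show "\<phi> (s \<otimes>\<^bsub>R\<^esub> t) = \<phi> s \<otimes> \<phi> t" "\<phi> (s \<oplus>\<^bsub>R\<^esub> t) = \<phi> s \<oplus> \<phi> t"
      by (rule inj; use st \<phi> \<sigma>D gD in simp)+
  next
    show "\<phi> \<one>\<^bsub>R\<^esub> = \<one>" by (rule inj; use \<sigma>D gD in simp)
  next
    fix c s assume "c \<in> carrier K" "s \<in> carrier R"
    then show "\<phi> (c \<odot>\<^bsub>R\<^esub> s) = c \<odot> \<phi> s" by (intro inj) (use \<phi> \<sigma>D gD in simp_all)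
  next
    fix a assume "a \<in> \<phi> ` even_part R"
    then show "a \<in> A\<^sub>0" using \<phi> ev \<sigma>D(6) global_section_even by (metis (no_types, lifting) imageE subsetD)
  next
    fix a assume "a \<in> \<phi> ` odd_part R"
    then show "a \<in> A\<^sub>1" using \<phi> od \<sigma>D(7) global_section_odd by (metis (no_types, lifting) imageE subsetD)
  qed (use \<phi> in auto)
  then show ?thesis using \<phi> by blast
qed

end


lemma (in supercomm) superalg_hom_zero_minus:
  assumes "\<phi> \<in> superalg_hom K A B" and "superalgebra K B"
  shows "\<phi> \<zero> = \<zero>\<^bsub>B\<^esub>"
    and "a \<in> carrier A \<Longrightarrow> b \<in> carrier A \<Longrightarrow> \<phi> (a \<ominus> b) = \<phi> a \<ominus>\<^bsub>B\<^esub> \<phi> b"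
proof -
  interpret B: superalgebra K B by fact
  interpret h: ring_hom_ring A B \<phi>
    by (rule ring_hom_ringI2) (use assms A.ring_axioms B.A.ring_axioms in \<open>auto simp: superalg_hom_def\<close>)
  show "\<phi> \<zero> = \<zero>\<^bsub>B\<^esub>" by simp
  show "a \<in> carrier A \<Longrightarrow> b \<in> carrier A \<Longrightarrow> \<phi> (a \<ominus> b) = \<phi> a \<ominus>\<^bsub>B\<^esub> \<phi> b"
    by (simp add: a_minus_def)
qed

lemma (in supercomm) sections_mult_restrict:
  "(\<lambda>q\<in>V. f q) \<otimes>\<^bsub>sect (SSpec A) V\<^esub> (\<lambda>q\<in>V. g q) = (\<lambda>q\<in>V. f q \<otimes>\<^bsub>loc_at A q\<^esub> g q)"
  unfolding SSpec_def by (simp cong: restrict_cong)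

lemma (in supercomm) sections_one: "\<one>\<^bsub>sect (SSpec A) V\<^esub> = (\<lambda>q\<in>V. frac q \<one> \<one>)"
  unfolding SSpec_def localization_def by simp

lemma supercommI: "superalgebra K A \<Longrightarrow> supercomm K A"
  by (simp add: supercomm_def)

section \<open>Functoriality of the superspectrum\<close>

lemma preimage_prime:
  assumes A: "supercomm K A" and B: "supercomm K B" and h: "h \<in> superalg_hom K A B"
    and q: "q \<in> prime_spectrum B"
  shows "{a \<in> even_part A. h a \<in> q} \<in> prime_spectrum A"
proof -
  interpret A: supercomm K A by fact
  interpret B: supercomm K B by fact
  note hD = A.superalg_homD[OF h] and qD = B.primeD[OF q]
    and h0 = A.superalg_hom_zero_minus(1)[OF h B.superalgebra_axioms]
  show ?thesis
    unfolding A.prime_spectrum_iff A.even_ideal_def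
    using hD h0 qD(2-5) qD(6)[OF hD(6) hD(6)] by (auto simp: A.even_even)
qed

lemma SSpec_point_map_eq:
  assumes "supercomm K B" "q \<in> prime_spectrum B"
  shows "SSpec_point_map A B h q = {a \<in> even_part A. h a \<in> q}"
  using assms by (simp add: SSpec_point_map_def supercomm.topspace_zariski[OF assms(1)])

lemma SSpec_map_global_section:
  assumes A: "supercomm K A" and B: "supercomm K B" and h: "h \<in> superalg_hom K A B"
    and a: "a \<in> carrier A"
  shows "snd (SSpec_map A B h) (prime_spectrum A) (global_section A a) = global_section B (h a)"
proof -
  interpret A: supercomm K A by fact
  interpret B: supercomm K B by fact
  note hD = A.superalg_homD[OF h]
  have pre: "preimage_in (SSpec B) (SSpec_point_map A B h) A.Spec = B.Spec"
    using preimage_prime[OF A B h] SSpec_point_map_eq[OF B, of _ A h]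
    by (auto simp: preimage_in_def B.topspace_zariski)
  have eq: "(\<Union>(c, f)\<in>A.frac {x \<in> A.A\<^sub>0. h x \<in> q} a \<one>\<^bsub>A\<^esub>. B.frac q (h c) (h f)) = B.frac q (h a) \<one>\<^bsub>B\<^esub>"
    (is "\<Union>?S = ?R") if q: "q \<in> B.Spec" for q
  proof -
    let ?p = "{x \<in> A.A\<^sub>0. h x \<in> q}"
    have p: "?p \<in> A.Spec" using preimage_prime[OF A B h q] .
    have "B.frac q (h c) (h f) = ?R" if cf: "(c, f) \<in> A.frac ?p a \<one>\<^bsub>A\<^esub>" for c f
    proof -
      obtain u where u: "u \<in> A.A\<^sub>0" "h u \<notin> q" "u \<otimes>\<^bsub>A\<^esub> (f \<otimes>\<^bsub>A\<^esub> a) = u \<otimes>\<^bsub>A\<^esub> (\<one>\<^bsub>A\<^esub> \<otimes>\<^bsub>A\<^esub> c)"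
        and c: "c \<in> carrier A" "f \<in> A.A\<^sub>0" "h f \<notin> q"
        using cf unfolding A.mem_fraction_iff by blast
      have "h u \<otimes>\<^bsub>B\<^esub> (\<one>\<^bsub>B\<^esub> \<otimes>\<^bsub>B\<^esub> h c) = h u \<otimes>\<^bsub>B\<^esub> (h f \<otimes>\<^bsub>B\<^esub> h a)"
      proof -
        have "h u \<otimes>\<^bsub>B\<^esub> (h f \<otimes>\<^bsub>B\<^esub> h a) = h (u \<otimes>\<^bsub>A\<^esub> (f \<otimes>\<^bsub>A\<^esub> a))"
          using hD c a u(1) by simp
        also have "\<dots> = h u \<otimes>\<^bsub>B\<^esub> (\<one>\<^bsub>B\<^esub> \<otimes>\<^bsub>B\<^esub> h c)"
          unfolding u(3) using hD c a u(1) by simp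
        finally show ?thesis by simp
      qed
      then show ?thesis
        using B.frac_eq_iff[OF q, of "h c" "h a" "h f" "\<one>\<^bsub>B\<^esub>"] hD u c a B.primeD(3)[OF q] by auto
    qed
    moreover have "(a, \<one>\<^bsub>A\<^esub>) \<in> A.frac ?p a \<one>\<^bsub>A\<^esub>"
      using A.fraction_self[OF A.mult_set_prime[OF p] a] A.primeD(3)[OF p] by auto
    ultimately show ?thesis by (auto split: prod.splits) 
  qed
  show ?thesis
    unfolding SSpec_map_def snd_conv
    using a eq preimage_prime[OF A B h] SSpec_point_map_eq[OF B, of _ A h]
    by (simp add: pre B.global_section_eq) (rule restrict_ext, simp add: A.global_section_eq)
qed

section \<open>Affine charts\<close>

lemma Mor_point: "f \<in> Mor K X Y \<Longrightarrow> x \<in> topspace (base X) \<Longrightarrow> fst f x \<in> topspace (base Y)"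
  unfolding Mor_def by (auto dest: continuous_map_funspace)

lemma Mor_preimage_open:
  assumes "f \<in> Mor K X Y" "openin (base Y) V"
  shows "openin (base X) (preimage_in X (fst f) V)"
  using assms openin_continuous_map_preimage[of "base X" "base Y" "fst f" V]
  unfolding Mor_def preimage_in_def by simp

lemma Mor_hom:
  "\<lbrakk>f \<in> Mor K X Y; openin (base Y) V\<rbrakk>
    \<Longrightarrow> snd f V \<in> superalg_hom K (sect Y V) (sect X (preimage_in X (fst f) V))"
  by (simp add: Mor_def)

lemma Mor_natural:
  "\<lbrakk>f \<in> Mor K X Y; openin (base Y) V; openin (base Y) W; W \<subseteq> V; t \<in> carrier (sect Y V)\<rbrakk>
    \<Longrightarrow> snd f W (res Y V W t) = res X (preimage_in X (fst f) V) (preimage_in X (fst f) W) (snd f V t)"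
  by (simp add: Mor_def)

definition invertible_near :: "('k, 'p, 's) superspace \<Rightarrow> 'p set \<Rightarrow> 's \<Rightarrow> 'p \<Rightarrow> bool" where
  "invertible_near X U F y \<longleftrightarrow> (\<exists>W. openin (base X) W \<and> y \<in> W \<and> W \<subseteq> U \<and>
    (\<exists>e\<in>carrier (sect X W). e \<otimes>\<^bsub>sect X W\<^esub> res X U W F = \<one>\<^bsub>sect X W\<^esub>))"

text \<open>What an affine open subspace offers for local computations. A chart provides a superalgebra \<open>B\<close> with a
homomorphism \<open>\<beta>\<close> to the functions on \<open>U\<close>, and attaches a prime \<open>pt y\<close> of \<open>B\<close> to each point. An element
outside the prime becomes a unit near the point, and a section over any open set is near \<open>y\<close> of
the form \<open>b / h\<close> with a denominator \<open>h\<close> that is invertible there; both are transported from the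
definition of the structure sheaf of \<open>SSpec B\<close>.\<close>

lemma affine_chart:
  fixes X :: "('k, 'p, 's) superspace"
  assumes X: "geometric_superspace K X" and U: "affine_open K X U"
  obtains B :: "('k, 's) superalg" and \<beta> and pt where
    "supercomm K B" "\<beta> \<in> superalg_hom K B (sect X U)"
    "inj_on pt U" "\<And>y. y \<in> U \<Longrightarrow> pt y \<in> prime_spectrum B"
    "\<And>y h. y \<in> U \<Longrightarrow> h \<in> even_part B \<Longrightarrow> h \<notin> pt y \<Longrightarrow> invertible_near X U (\<beta> h) y"
    "\<And>y W s. y \<in> U \<Longrightarrow> openin (base X) W \<Longrightarrow> y \<in> W \<Longrightarrow> s \<in> carrier (sect X W) \<Longrightarrow>
      \<exists>W' b h e. openin (base X) W' \<and> y \<in> W' \<and> W' \<subseteq> W \<inter> U \<and> b \<in> carrier B \<and> h \<in> even_part B \<and>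
        e \<in> carrier (sect X W') \<and> e \<otimes>\<^bsub>sect X W'\<^esub> res X U W' (\<beta> h) = \<one>\<^bsub>sect X W'\<^esub> \<and>
        res X U W' (\<beta> h) \<otimes>\<^bsub>sect X W'\<^esub> res X W W' s = res X U W' (\<beta> b)"
proof -
  interpret X: geometric_superspace K X by fact
  let ?XU = "open_subspace X U"
  obtain B :: "('k, 's) superalg" where oU: "openin (base X) U" and B: "superalgebra K B"
    and iso: "isomorphic K ?XU (SSpec B)"
    using U by (auto simp: affine_open_def)
  obtain f g where f: "f \<in> Mor K ?XU (SSpec B)" and g: "g \<in> Mor K (SSpec B) ?XU"
    and gf: "comp_mor ?XU (SSpec B) ?XU g f = id_mor ?XU"
    using iso by (auto simp: isomorphic_def)
  interpret B: supercomm K B using supercommI[OF B] .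
  have sub: "U \<subseteq> topspace (base X)" using openin_subset oU by auto
  have base [simp]: "base ?XU = subtopology (base X) U" "sect ?XU = sect X" "res ?XU = res X"
    by (simp_all add: open_subspace_def)
  have tU [simp]: "topspace (subtopology (base X) U) = U" using sub by auto
  have oXU: "openin (subtopology (base X) U) W \<longleftrightarrow> openin (base X) W \<and> W \<subseteq> U" for W
    using openin_open_subtopology[OF oU] .
  have pt: "fst f y \<in> B.Spec" if "y \<in> U" for y
    using Mor_point[OF f, of y] that subsetD[OF sub that] by (simp add: B.topspace_zariski)
  have gfp: "fst g (fst f y) = y" if "y \<in> U" for y
    using fun_cong[OF arg_cong[OF gf, of fst], of y] that subsetD[OF sub that] by (simp add: comp_mor_def id_mor_def)
  have gfs: "snd f (preimage_in (SSpec B) (fst g) W) (snd g W s) = s"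
    if "openin (base X) W" "W \<subseteq> U" "s \<in> carrier (sect X W)" for W s
    using fun_cong[OF fun_cong[OF arg_cong[OF gf, of snd], of W], of s] that
    by (simp add: comp_mor_def id_mor_def oXU)
  define pre where "pre V = preimage_in ?XU (fst f) V" for V
  have pre_eq: "pre V = {y \<in> U. fst f y \<in> V}" for V
    using sub by (auto simp: pre_def preimage_in_def)
  have pre_open: "openin (base X) (pre V)" "pre V \<subseteq> U" if "openin (zariski B) V" for V
    using Mor_preimage_open[OF f, of V] that by (simp_all add: pre_def oXU)
  have pre_Spec: "pre B.Spec = U" using pt by (auto simp: pre_eq)
  have f_hom: "snd f V \<in> superalg_hom K (sect (SSpec B) V) (sect X (pre V))" if "openin (zariski B) V" for V
    using Mor_hom[OF f, of V] that by (simp add: pre_def)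
  have f_nat: "snd f W (restrict t W) = res X (pre V) (pre W) (snd f V t)"
    if "openin (zariski B) V" "openin (zariski B) W" "W \<subseteq> V" "t \<in> SSpec_sections B V" for V W t
    using Mor_natural[OF f, of V W t] that by (simp add: pre_def)
  define \<beta> where "\<beta> b = snd f B.Spec (global_section B b)" for b
  have \<beta>: "\<beta> \<in> superalg_hom K B (sect X U)"
    using B.superalg_homD[OF B.global_section_hom] B.superalg_homD[OF f_hom[OF B.open_Spec]]
    unfolding pre_Spec superalg_hom_def \<beta>_def by (auto intro!: ring_hom_memI)
  have \<beta>_res: "res X U (pre V) (\<beta> b) = snd f V (\<lambda>q\<in>V. B.frac q b \<one>\<^bsub>B\<^esub>)"
    if V: "openin (zariski B) V" and b: "b \<in> carrier B" for V b
  proof -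
    have VS: "V \<subseteq> B.Spec" using B.openin_zariski_subset[OF V] .
    have "restrict (global_section B b) V = (\<lambda>q\<in>V. B.frac q b \<one>\<^bsub>B\<^esub>)"
      using VS by (auto simp: B.global_section_eq fun_eq_iff)
    then show ?thesis
      using f_nat[OF B.open_Spec V VS, of "global_section B b"] b by (simp add: pre_Spec \<beta>_def)
  qed
  have unit: "\<exists>e\<in>carrier (sect X (pre V)). e \<otimes>\<^bsub>sect X (pre V)\<^esub> res X U (pre V) (\<beta> h) = \<one>\<^bsub>sect X (pre V)\<^esub>"
    if V: "openin (zariski B) V" and h: "h \<in> B.A\<^sub>0" "\<forall>q\<in>V. h \<notin> q" for V h
  proof -
    have VS: "V \<subseteq> B.Spec" using B.openin_zariski_subset[OF V] .
    note fD = B.superalg_homD[OF f_hom[OF V]]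
    let ?e = "\<lambda>q\<in>V. B.frac q \<one>\<^bsub>B\<^esub> h" and ?h = "\<lambda>q\<in>V. B.frac q h \<one>\<^bsub>B\<^esub>"
    have sec: "?e \<in> SSpec_sections B V" "?h \<in> SSpec_sections B V"
      by (intro B.fraction_section[OF V]; use h VS B.primeD(3) in auto)+
    have "B.frac q h h = B.frac q \<one>\<^bsub>B\<^esub> \<one>\<^bsub>B\<^esub>" if "q \<in> V" for q
      using B.frac_scale[of q "\<one>\<^bsub>B\<^esub>" "\<one>\<^bsub>B\<^esub>" h] that h VS B.primeD(3)[of q] by auto
    then have "?e \<otimes>\<^bsub>sect (SSpec B) V\<^esub> ?h = \<one>\<^bsub>sect (SSpec B) V\<^esub>"
      using VS h B.primeD(3)
      by (simp only: B.sections_mult_restrict B.sections_one, intro restrict_ext) (auto simp: B.frac_mult subset_eq)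
    then have "snd f V ?e \<otimes>\<^bsub>sect X (pre V)\<^esub> snd f V ?h = \<one>\<^bsub>sect X (pre V)\<^esub>"
      using fD(2)[of ?e ?h] fD(4) sec by simp
    then show ?thesis using fD(1)[of ?e] sec \<beta>_res[OF V, of h] h by auto
  qed
  show thesis
  proof (rule that[of B \<beta> "fst f"])
    show "supercomm K B" by (rule B.supercomm_axioms)
    show "\<beta> \<in> superalg_hom K B (sect X U)" by fact
    show "inj_on (fst f) U" using gfp by (metis inj_onI)
    show "fst f y \<in> B.Spec" if "y \<in> U" for y using pt that .
  next
    fix y h assume y: "y \<in> U" and h: "h \<in> B.A\<^sub>0" "h \<notin> fst f y"
    let ?V = "{q \<in> B.Spec. h \<notin> q}"
    have V: "openin (zariski B) ?V" using B.openin_basic[OF h(1)] .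
    show "invertible_near X U (\<beta> h) y"
      unfolding invertible_near_def
      using unit[OF V h(1)] pre_open[OF V] y pt h by (intro exI[of _ "pre ?V"]) (auto simp: pre_eq)
  next
    fix y W s assume y: "y \<in> U" and W: "openin (base X) W" "y \<in> W" and s: "s \<in> carrier (sect X W)"
    define W1 where "W1 = W \<inter> U"
    have W1: "openin (base X) W1" "W1 \<subseteq> U" "W1 \<subseteq> W" "y \<in> W1" using W oU y by (auto simp: W1_def)
    define s1 where "s1 = res X W W1 s"
    have s1: "s1 \<in> carrier (sect X W1)"
      unfolding s1_def using B.superalg_homD(1)[OF X.res_hom[OF W(1) W1(1,3)] s] .
    define W2 where "W2 = preimage_in (SSpec B) (fst g) W1"
    have W2: "openin (zariski B) W2"
      using Mor_preimage_open[OF g, of W1] W1 by (simp add: W2_def oXU)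
    define \<sigma> where "\<sigma> = snd g W1 s1"
    have \<sigma>: "\<sigma> \<in> SSpec_sections B W2"
      using B.superalg_homD(1)[OF Mor_hom[OF g, of W1]] W1 s1 by (simp add: W2_def \<sigma>_def oXU)
    have pre_W2: "pre W2 = W1"
      using W1 pt gfp by (auto simp: pre_eq W2_def preimage_in_def B.topspace_zariski)
    have f\<sigma>: "snd f W2 \<sigma> = s1" unfolding W2_def \<sigma>_def using gfs W1 s1 by simp
    have "fst f y \<in> W2" using W1(4) pre_W2 by (auto simp: pre_eq)
    obtain V b h where V: "openin (zariski B) V" "fst f y \<in> V" "V \<subseteq> W2" "b \<in> carrier B" "h \<in> B.A\<^sub>0"
      "\<forall>q\<in>V. h \<notin> q" "\<forall>q\<in>V. \<sigma> q = B.frac q b h"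
      using B.SSpec_sections_point[OF \<sigma> \<open>fst f y \<in> W2\<close>] .
    have VS: "V \<subseteq> B.Spec" using B.openin_zariski_subset[OF V(1)] .
    obtain e where e: "e \<in> carrier (sect X (pre V))"
      "e \<otimes>\<^bsub>sect X (pre V)\<^esub> res X U (pre V) (\<beta> h) = \<one>\<^bsub>sect X (pre V)\<^esub>"
      using unit[OF V(1,5,6)] by auto
    have sub_pre: "pre V \<subseteq> W1" using V(3) pre_W2 by (auto simp: pre_eq)
    have "res X W (pre V) s = res X W1 (pre V) s1"
      unfolding s1_def using X.res_res[of W W1 "pre V" s] W W1 pre_open[OF V(1)] sub_pre s by auto
    also have "\<dots> = snd f V (restrict \<sigma> V)"
      using f_nat[OF W2 V(1,3) \<sigma>] f\<sigma> by (simp add: pre_W2)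
    also have "restrict \<sigma> V = (\<lambda>q\<in>V. B.frac q b h)"
      using V(7) by (intro restrict_ext) auto
    finally have ress: "res X W (pre V) s = snd f V (\<lambda>q\<in>V. B.frac q b h)" .
    note fD = B.superalg_homD[OF f_hom[OF V(1)]]
    let ?h = "\<lambda>q\<in>V. B.frac q h \<one>\<^bsub>B\<^esub>" and ?s = "\<lambda>q\<in>V. B.frac q b h" and ?b = "\<lambda>q\<in>V. B.frac q b \<one>\<^bsub>B\<^esub>"
    have sec: "?h \<in> SSpec_sections B V" "?s \<in> SSpec_sections B V"
      by (intro B.fraction_section[OF V(1)]; use V VS B.primeD(3) in auto)+
    have "B.frac q (h \<otimes>\<^bsub>B\<^esub> b) h = B.frac q b \<one>\<^bsub>B\<^esub>" if "q \<in> V" for q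
      using B.frac_scale[of q b "\<one>\<^bsub>B\<^esub>" h] that V VS B.primeD(3)[of q] by auto
    then have "?h \<otimes>\<^bsub>sect (SSpec B) V\<^esub> ?s = ?b"
      using VS V B.primeD(3)
      by (simp only: B.sections_mult_restrict, intro restrict_ext) (auto simp: B.frac_mult subset_eq)
    then have "res X U (pre V) (\<beta> h) \<otimes>\<^bsub>sect X (pre V)\<^esub> res X W (pre V) s = res X U (pre V) (\<beta> b)"
      using fD(2)[of ?h ?s] sec V \<beta>_res[OF V(1)] ress by simp
    moreover have "y \<in> pre V" using y V(2) by (simp add: pre_eq)
    moreover have "pre V \<subseteq> W \<inter> U" using sub_pre by (auto simp: W1_def)
    moreover note pre_open(1)[OF V(1)]
    ultimately show "\<exists>W' b h e. openin (base X) W' \<and> y \<in> W' \<and> W' \<subseteq> W \<inter> U \<and> b \<in> carrier B \<and> h \<in> B.A\<^sub>0 \<and>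
        e \<in> carrier (sect X W') \<and> e \<otimes>\<^bsub>sect X W'\<^esub> res X U W' (\<beta> h) = \<one>\<^bsub>sect X W'\<^esub> \<and>
        res X U W' (\<beta> h) \<otimes>\<^bsub>sect X W'\<^esub> res X W W' s = res X U W' (\<beta> b)"
      using V(4,5) e by (intro exI[of _ "pre V"] exI[of _ b] exI[of _ h] exI[of _ e] conjI)
  qed
qed


section \<open>Quotients and the base field as superalgebras\<close>

text \<open>The one axiom that does not pass to an image by itself is that even and odd part meet only in
zero; it is the last hypothesis.\<close>

lemma (in supercomm) surjective_image_superalgebra:
  fixes Q :: "('k, 'b) superalg" and \<pi> :: "'a \<Rightarrow> 'b"
  assumes surj: "carrier Q = \<pi> ` carrier A"
    and mult: "\<And>a b. a \<in> carrier A \<Longrightarrow> b \<in> carrier A \<Longrightarrow> \<pi> a \<otimes>\<^bsub>Q\<^esub> \<pi> b = \<pi> (a \<otimes> b)"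
    and add: "\<And>a b. a \<in> carrier A \<Longrightarrow> b \<in> carrier A \<Longrightarrow> \<pi> a \<oplus>\<^bsub>Q\<^esub> \<pi> b = \<pi> (a \<oplus> b)"
    and one: "\<one>\<^bsub>Q\<^esub> = \<pi> \<one>" and zero: "\<zero>\<^bsub>Q\<^esub> = \<pi> \<zero>"
    and smult: "\<And>c a. c \<in> carrier K \<Longrightarrow> a \<in> carrier A \<Longrightarrow> c \<odot>\<^bsub>Q\<^esub> \<pi> a = \<pi> (c \<odot> a)"
    and even: "even_part Q = \<pi> ` A\<^sub>0" and odd: "odd_part Q = \<pi> ` A\<^sub>1"
    and inter: "\<And>a b. a \<in> A\<^sub>0 \<Longrightarrow> b \<in> A\<^sub>1 \<Longrightarrow> \<pi> a = \<pi> b \<Longrightarrow> \<pi> a = \<pi> \<zero>"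
  shows "superalgebra K Q"
proof -
  have ag: "abelian_group Q"
  proof (rule abelian_groupI, unfold surj zero)
    fix x assume "x \<in> \<pi> ` carrier A"
    then obtain a where "a \<in> carrier A" "x = \<pi> a" by auto
    then show "\<exists>y\<in>\<pi> ` carrier A. y \<oplus>\<^bsub>Q\<^esub> x = \<pi> \<zero>"
      by (intro bexI[of _ "\<pi> (\<ominus> a)"]) (auto simp: add A.l_neg)
  qed (auto simp: add A.a_ac)
  have rQ: "ring Q"
  proof (rule ringI[OF ag])
    show "monoid Q"
      by (rule monoidI, unfold surj one) (auto simp: mult A.m_assoc)
  qed (unfold surj, auto simp: mult add A.l_distr A.r_distr)
  interpret Q: ring Q by fact
  have mQ: "module K Q"
  proof (rule moduleI[OF K.is_cring ag], unfold surj)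
  qed (auto simp: smult add smult_l_distr smult_r_distr smult_assoc1)
  interpret Q: module K Q by fact
  have neg: "\<ominus>\<^bsub>Q\<^esub> \<pi> a = \<pi> (\<ominus> a)" if "a \<in> carrier A" for a
    using that by (intro Q.minus_equality) (auto simp: add zero surj A.l_neg)
  have even_sub: "submodule (even_part Q) K Q" and odd_sub: "submodule (odd_part Q) K Q"
    by (intro Q.submoduleI; unfold even odd surj zero; force simp: neg add smult)+
  have eo: "even_part Q <+>\<^bsub>Q\<^esub> odd_part Q = carrier Q"
  proof
    show "even_part Q <+>\<^bsub>Q\<^esub> odd_part Q \<subseteq> carrier Q"
      unfolding set_add_def' even odd surj by (auto simp: add)
    show "carrier Q \<subseteq> even_part Q <+>\<^bsub>Q\<^esub> odd_part Q"
    proof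
      fix x assume "x \<in> carrier Q"
      then obtain a where a: "a \<in> carrier A" "x = \<pi> a" using surj by auto
      then obtain b c where "b \<in> A\<^sub>0" "c \<in> A\<^sub>1" "a = b \<oplus> c" using even_odd_decomp by metis
      then have "x = \<pi> b \<oplus>\<^bsub>Q\<^esub> \<pi> c" "\<pi> b \<in> even_part Q" "\<pi> c \<in> odd_part Q"
        using a by (auto simp: add even odd)
      then show "x \<in> even_part Q <+>\<^bsub>Q\<^esub> odd_part Q" unfolding set_add_def' by blast
    qed
  qed
  have io: "even_part Q \<inter> odd_part Q = {\<zero>\<^bsub>Q\<^esub>}"
    unfolding even odd zero using inter by (auto dest: inter)
  have anti: "\<pi> (a \<otimes> b) = \<ominus>\<^bsub>Q\<^esub> \<pi> (b \<otimes> a)" if "a \<in> A\<^sub>1" "b \<in> A\<^sub>1" for a b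
    using that odd_anticommute[OF that] by (simp add: neg)
  have cent: "\<pi> (a \<otimes> b) = \<pi> (b \<otimes> a)" if "a \<in> A\<^sub>0" "b \<in> carrier A" for a b
    by (simp only: even_central[OF that])
  show ?thesis
    by (intro superalgebra.intro superalgebra_axioms.intro K.field_axioms rQ mQ even_sub odd_sub eo io)
      (auto simp: surj even odd one mult smult smult_mult_left smult_mult_right
        intro: anti cent)
qed

context supercomm begin

lemma quot_superalg_simps:
  "carrier (quot_superalg A I) = carrier (A Quot I)" "mult (quot_superalg A I) = mult (A Quot I)"
  "one (quot_superalg A I) = one (A Quot I)" "zero (quot_superalg A I) = zero (A Quot I)"
  "add (quot_superalg A I) = add (A Quot I)"
  "even_part (quot_superalg A I) = quot_map A I ` A\<^sub>0" "odd_part (quot_superalg A I) = quot_map A I ` A\<^sub>1"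
  by (simp_all add: quot_superalg_def)

lemma quot_map_eq_iff:
  "\<lbrakk>ideal I A; a \<in> carrier A; b \<in> carrier A\<rbrakk> \<Longrightarrow> quot_map A I a = quot_map A I b \<longleftrightarrow> a \<ominus> b \<in> I"
  by (simp add: quot_map_def A.quotient_eq_iff_same_a_r_cos)

lemma quot_carrier: "ideal I A \<Longrightarrow> carrier (quot_superalg A I) = quot_map A I ` carrier A"
  unfolding quot_superalg_simps quot_map_def FactRing_def A_RCOSETS_def' by auto

lemma smult_ideal: "\<lbrakk>ideal I A; c \<in> carrier K; a \<in> I\<rbrakk> \<Longrightarrow> c \<odot> a \<in> I"
  using ideal.I_l_closed[of I A a "c \<odot> \<one>"] ideal.Icarr[of I A a] by (simp add: smult_one_mult)

lemma quot_smult: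
  assumes I: "ideal I A" and c: "c \<in> carrier K" and a: "a \<in> carrier A"
  shows "c \<odot>\<^bsub>quot_superalg A I\<^esub> quot_map A I a = quot_map A I (c \<odot> a)"
proof -
  interpret I: ideal I A by fact
  have eq: "quot_map A I (c \<odot> b) = quot_map A I (c \<odot> a)" if b: "b \<in> quot_map A I a" for b
  proof -
    obtain i where i: "i \<in> I" "b = i \<oplus> a"
      using b unfolding quot_map_def a_r_coset_def' by auto
    have ic: "i \<in> carrier A" using i I.Icarr by auto
    have "c \<odot> b \<ominus> c \<odot> a = c \<odot> i"
      using i ic a c by (simp add: smult_r_distr a_minus_def A.a_assoc A.r_neg)
    then have "c \<odot> b \<ominus> c \<odot> a \<in> I" using smult_ideal[OF I c i(1)] by (simp only:)
    moreover have "b \<in> carrier A" using i(2) ic a by simp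
    ultimately show ?thesis using quot_map_eq_iff[OF I] c a by simp
  qed
  have "a \<in> quot_map A I a"
    using I.a_rcos_self[OF a] by (simp add: quot_map_def)
  then have "(\<Union>b\<in>quot_map A I a. quot_map A I (c \<odot> a)) = quot_map A I (c \<odot> a)" by blast
  moreover have "(\<Union>b\<in>quot_map A I a. quot_map A I (c \<odot> b)) = (\<Union>b\<in>quot_map A I a. quot_map A I (c \<odot> a))"
    by (rule SUP_cong[OF refl eq])
  ultimately show ?thesis by (simp add: quot_superalg_def)
qed

lemma quot_map_hom: 
  assumes "ideal I A"
  shows "quot_map A I \<in> superalg_hom K A (quot_superalg A I)"
proof -
  have "quot_map A I \<in> ring_hom A (quot_superalg A I)"
    using ideal.rcos_ring_hom[OF assms] unfolding ring_hom_def quot_superalg_simps quot_map_def by simp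
  then show ?thesis
    using quot_smult[OF assms] by (auto simp: superalg_hom_def quot_superalg_simps)
qed

lemma quot_superalgebra:
  assumes I: "ideal I A" and graded: "\<And>a b. a \<in> A\<^sub>0 \<Longrightarrow> b \<in> A\<^sub>1 \<Longrightarrow> a \<ominus> b \<in> I \<Longrightarrow> a \<in> I"
  shows "superalgebra K (quot_superalg A I)"
proof (rule surjective_image_superalgebra[where \<pi> = "quot_map A I"])
  note h = superalg_homD[OF quot_map_hom[OF I]]
  interpret I: ideal I A by fact
  show "\<zero>\<^bsub>quot_superalg A I\<^esub> = quot_map A I \<zero>"
    using I.a_subset by (auto simp: quot_superalg_simps FactRing_def quot_map_def a_r_coset_def')
  fix a b assume "a \<in> A\<^sub>0" "b \<in> A\<^sub>1" "quot_map A I a = quot_map A I b"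
  then show "quot_map A I a = quot_map A I \<zero>"
    using graded[of a b] by (auto simp: quot_map_eq_iff[OF I] a_minus_def)
qed (use superalg_homD[OF quot_map_hom[OF I]] quot_carrier[OF I] in
    \<open>auto simp: quot_superalg_simps(6,7)\<close>)

lemma hom_descends_to_quot:
  assumes I: "ideal I A" and \<phi>: "\<phi> \<in> superalg_hom K A B" and B: "superalgebra K B"
    and ker: "\<And>a. a \<in> I \<Longrightarrow> \<phi> a = \<zero>\<^bsub>B\<^esub>"
  shows "\<exists>\<psi>\<in>superalg_hom K (quot_superalg A I) B. \<forall>a\<in>carrier A. \<psi> (quot_map A I a) = \<phi> a"
proof -
  interpret B: superalgebra K B by fact
  let ?\<pi> = "quot_map A I"
  note \<phi>D = superalg_homD[OF \<phi>] and \<pi>D = superalg_homD[OF quot_map_hom[OF I]]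
  define \<psi> where "\<psi> x = \<phi> (SOME a. a \<in> carrier A \<and> ?\<pi> a = x)" for x
  have \<psi>: "\<psi> (?\<pi> a) = \<phi> a" if a: "a \<in> carrier A" for a
  proof -
    define b where "b = (SOME b. b \<in> carrier A \<and> ?\<pi> b = ?\<pi> a)"
    have b: "b \<in> carrier A \<and> ?\<pi> b = ?\<pi> a" unfolding b_def by (rule someI[of _ a]) (use a in simp)
    then have "\<phi> (b \<ominus> a) = \<zero>\<^bsub>B\<^esub>" using ker quot_map_eq_iff[OF I] a by blast
    then have "\<phi> b \<ominus>\<^bsub>B\<^esub> \<phi> a = \<zero>\<^bsub>B\<^esub>" using superalg_hom_zero_minus(2)[OF \<phi> B] a b by simp
    then show ?thesis unfolding \<psi>_def b_def[symmetric] using \<phi>D(1) a b by simp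
  qed
  have "\<psi> \<in> superalg_hom K (quot_superalg A I) B"
    unfolding superalg_hom_def
  proof (intro CollectI conjI ballI ring_hom_memI subsetI; (unfold quot_carrier[OF I])?)
    fix x y assume "x \<in> ?\<pi> ` carrier A" "y \<in> ?\<pi> ` carrier A"
    then obtain a b where ab: "a \<in> carrier A" "b \<in> carrier A" "x = ?\<pi> a" "y = ?\<pi> b" by auto
    show "\<psi> (x \<otimes>\<^bsub>quot_superalg A I\<^esub> y) = \<psi> x \<otimes>\<^bsub>B\<^esub> \<psi> y"
      using ab \<psi> \<phi>D \<pi>D(2)[symmetric] by simp
    show "\<psi> (x \<oplus>\<^bsub>quot_superalg A I\<^esub> y) = \<psi> x \<oplus>\<^bsub>B\<^esub> \<psi> y"
      using ab \<psi> \<phi>D \<pi>D(3)[symmetric] by simp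
  next
    show "\<psi> \<one>\<^bsub>quot_superalg A I\<^esub> = \<one>\<^bsub>B\<^esub>" using \<psi> \<phi>D \<pi>D(4)[symmetric] by simp
  qed (use \<psi> \<phi>D quot_smult[OF I] in \<open>auto simp: quot_superalg_simps(6,7)\<close>)
  then show ?thesis using \<psi> by blast
qed

end

lemma field_superalg_superalgebra:
  fixes K :: "'k ring"
  assumes "field K"
  shows "superalgebra K (field_superalg K)"
proof -
  interpret K: field K by fact
  have s: "carrier (field_superalg K) = carrier K" "mult (field_superalg K) = mult K"
    "one (field_superalg K) = one K" "zero (field_superalg K) = zero K" "add (field_superalg K) = add K"
    "smult (field_superalg K) = mult K" "even_part (field_superalg K) = carrier K"
    "odd_part (field_superalg K) = {\<zero>\<^bsub>K\<^esub>}"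
    by (simp_all add: field_superalg_def)
  have ag: "abelian_group (field_superalg K)"
    by (rule abelian_groupI, unfold s) (auto simp: K.a_ac intro: bexI[of _ "\<ominus>\<^bsub>K\<^esub> x" for x] K.l_neg)
  have r: "ring (field_superalg K)"
    by (rule ringI[OF ag], rule monoidI, unfold s) (auto simp: K.m_assoc K.l_distr K.r_distr)
  have m: "module K (field_superalg K)"
    by (rule moduleI[OF K.is_cring ag], unfold s) (auto simp: K.m_assoc K.l_distr K.r_distr)
  interpret F: module K "field_superalg K" by fact
  have neg: "\<ominus>\<^bsub>field_superalg K\<^esub> x = \<ominus>\<^bsub>K\<^esub> x" if "x \<in> carrier K" for x
    using that by (intro F.M.minus_equality) (auto simp: s K.l_neg)
  have "submodule (carrier K) K (field_superalg K)" "submodule {\<zero>\<^bsub>K\<^esub>} K (field_superalg K)"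
    by (intro F.submoduleI; auto simp: s neg)+
  then show ?thesis
    by (intro superalgebra.intro superalgebra_axioms.intro K.field_axioms r m; (unfold s)?)
      (auto simp: K.m_ac neg set_add_def' s)
qed


section \<open>Nilpotent ideals and the nilradical\<close>

lemma two_nonzero_of_field_char:
  fixes K :: "'k ring"
  assumes "field K" and char: "field_char K = 0 \<or> odd (field_char K)"
  shows "\<one>\<^bsub>K\<^esub> \<oplus>\<^bsub>K\<^esub> \<one>\<^bsub>K\<^esub> \<noteq> \<zero>\<^bsub>K\<^esub>"
proof
  interpret K: field K by fact
  assume "\<one>\<^bsub>K\<^esub> \<oplus>\<^bsub>K\<^esub> \<one>\<^bsub>K\<^esub> = \<zero>\<^bsub>K\<^esub>"
  then have "add_pow K (2::nat) \<one>\<^bsub>K\<^esub> = \<zero>\<^bsub>K\<^esub>"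
    by (simp add: numeral_2_eq_2 add_pow_def)
  then have "field_char K dvd 2"
    unfolding field_char_def using K.add.pow_eq_id[of "\<one>\<^bsub>K\<^esub>"] by simp
  moreover have "field_char K \<noteq> 1"
    unfolding field_char_def using K.add.ord_eq_1[of "\<one>\<^bsub>K\<^esub>"] by simp
  moreover have "field_char K \<le> 2" using \<open>field_char K dvd 2\<close> by (simp add: dvd_imp_le)
  ultimately show False using char by (auto simp: le_Suc_eq numeral_2_eq_2)
qed

context supercomm begin

lemma idealI_elementary:
  assumes "I \<subseteq> carrier A" "\<zero> \<in> I" "\<And>a b. a \<in> I \<Longrightarrow> b \<in> I \<Longrightarrow> a \<oplus> b \<in> I"
    "\<And>a c. a \<in> I \<Longrightarrow> c \<in> carrier A \<Longrightarrow> c \<otimes> a \<in> I"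
    "\<And>a c. a \<in> I \<Longrightarrow> c \<in> carrier A \<Longrightarrow> a \<otimes> c \<in> I"
  shows "ideal I A"
proof (rule idealI[OF A.ring_axioms])
  have "\<ominus> a \<in> I" if "a \<in> I" for a
    using assms(4)[OF that, of "\<ominus> \<one>"] assms(1) that by (auto simp: A.l_minus)
  then show "subgroup I (add_monoid A)"
    by (intro A.add.subgroupI) (use assms in \<open>auto simp: a_inv_def\<close>)
qed (use assms in auto)

lemma ideal_power_0: "ideal_power A I 0 = carrier A"
  and ideal_power_Suc: "ideal_power A I (Suc n) = ideal_prod A (ideal_power A I n) I"
  by (simp_all add: ideal_power_def nat_pow_def ideals_set_def)

lemma ideal_power_ideal: "ideal I A \<Longrightarrow> ideal (ideal_power A I n) A"
  by (induction n) (auto simp: ideal_power_0 ideal_power_Suc A.oneideal intro: A.ideal_prod_is_ideal)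

lemma pow_in_ideal_power: "ideal I A \<Longrightarrow> a \<in> I \<Longrightarrow> a [^] (n::nat) \<in> ideal_power A I n"
  by (induction n) (auto simp: ideal_power_0 ideal_power_Suc intro: ideal_prod.prod)

lemma hom_ideal_power:
  assumes \<phi>: "\<phi> \<in> superalg_hom K A B" and I: "ideal I A" and sub: "\<phi> ` I \<subseteq> J"
    and a: "a \<in> ideal_power A I n"
  shows "\<phi> a \<in> ideal_power B J n"
  using a
proof (induction n arbitrary: a)
  case 0
  then show ?case using superalg_homD(1)[OF \<phi>]
    by (simp add: ideal_power_def nat_pow_def ideals_set_def)
next
  case (Suc n)
  have S: "ideal_power B J (Suc n) = ideal_prod B (ideal_power B J n) J"
    by (simp add: ideal_power_def nat_pow_def ideals_set_def)
  have car: "ideal_power A I n \<subseteq> carrier A" "I \<subseteq> carrier A"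
    using ideal.Icarr[OF ideal_power_ideal[OF I]] ideal.Icarr[OF I] by auto
  have prod_car: "s \<in> carrier A" if "s \<in> ideal_prod A (ideal_power A I n) I" for s
    using A.ideal_prod_in_carrier[OF ideal_power_ideal[OF I] I] that by auto
  from Suc.prems show ?case
    unfolding ideal_power_Suc S
  proof (induction a rule: ideal_prod.induct)
    case (prod i j)
    then have "\<phi> (i \<otimes> j) = \<phi> i \<otimes>\<^bsub>B\<^esub> \<phi> j" using car superalg_homD(2)[OF \<phi>] by auto
    then show ?case using Suc.IH prod sub by (auto intro: ideal_prod.prod)
  next
    case (sum s t)
    then have "\<phi> (s \<oplus> t) = \<phi> s \<oplus>\<^bsub>B\<^esub> \<phi> t" using prod_car superalg_homD(3)[OF \<phi>] by auto
    then show ?case using sum by (auto intro: ideal_prod.sum)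
  qed
qed

definition nilpotent_ideal :: "'a set \<Rightarrow> bool" where
  "nilpotent_ideal I \<longleftrightarrow> ideal I A \<and> (\<exists>n. ideal_power A I n \<subseteq> {\<zero>})"

lemma mem_set_add: "x \<in> I <+>\<^bsub>A\<^esub> J \<longleftrightarrow> (\<exists>i\<in>I. \<exists>j\<in>J. x = i \<oplus> j)"
  by (auto simp: set_add_def')

text \<open>A product of \<open>m + n\<close> sums expands into products that contain at least \<open>m\<close> factors from \<open>I\<close> or
at least \<open>n\<close> from \<open>J\<close>. Splitting off one factor, its \<open>I\<close>-part is absorbed by the induction
hypothesis for \<open>(m - 1, n)\<close> and its \<open>J\<close>-part by the one for \<open>(m, n - 1)\<close>.\<close>

lemma ideal_power_sum:
  assumes I: "ideal I A" and J: "ideal J A"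
  shows "ideal_power A (I <+>\<^bsub>A\<^esub> J) (m + n) \<subseteq> ideal_power A I m <+>\<^bsub>A\<^esub> ideal_power A J n"
proof (induction "m + n" arbitrary: m n)
  case 0
  then show ?case by (auto simp: ideal_power_0 mem_set_add) (metis A.r_zero A.zero_closed)
next
  case (Suc k)
  let ?S = "I <+>\<^bsub>A\<^esub> J"
  have S: "ideal ?S A" using A.add_ideals[OF I J] .
  note pS = ideal_power_ideal[OF S] and pI = ideal_power_ideal[OF I] and pJ = ideal_power_ideal[OF J]
  note car = ideal.Icarr[OF pS] ideal.Icarr[OF pI] ideal.Icarr[OF pJ] ideal.Icarr[OF I] ideal.Icarr[OF J]
  consider "m = 0" | "n = 0" | m' n' where "m = Suc m'" "n = Suc n'" by (metis not0_implies_Suc)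
  then show ?case
  proof cases
    case 1
    have "\<zero> \<in> ideal_power A J n" using pJ additive_subgroup.zero_closed ideal.axioms(1) by blast
    then show ?thesis using 1 car(1) by (auto simp: ideal_power_0 mem_set_add) (metis A.r_zero)
  next
    case 2
    have "\<zero> \<in> ideal_power A I m" using pI additive_subgroup.zero_closed ideal.axioms(1) by blast
    then show ?thesis using 2 car(1) by (auto simp: ideal_power_0 mem_set_add) (metis A.l_zero)
  next
    case 3
    let ?T = "ideal_power A I m <+>\<^bsub>A\<^esub> ideal_power A J n"
    have T: "ideal ?T A" using A.add_ideals[OF pI pJ] .
    have IH: "ideal_power A ?S k \<subseteq> ideal_power A I m' <+>\<^bsub>A\<^esub> ideal_power A J n"
      "ideal_power A ?S k \<subseteq> ideal_power A I m <+>\<^bsub>A\<^esub> ideal_power A J n'"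
      using Suc.hyps(1)[of m' n] Suc.hyps(1)[of m n'] Suc.hyps(2) 3 by auto
    have "x \<in> ?T" if "x \<in> ideal_prod A (ideal_power A ?S k) ?S" for x
      using that
    proof (induction x rule: ideal_prod.induct)
      case (prod y z)
      obtain i j where ij: "i \<in> I" "j \<in> J" "z = i \<oplus> j" using prod by (auto simp: mem_set_add)
      obtain a b where ab: "a \<in> ideal_power A I m'" "b \<in> ideal_power A J n" "y = a \<oplus> b"
        using subsetD[OF IH(1) prod(1)] unfolding mem_set_add by blast
      obtain c d where cd: "c \<in> ideal_power A I m" "d \<in> ideal_power A J n'" "y = c \<oplus> d"
        using subsetD[OF IH(2) prod(1)] unfolding mem_set_add by blast
      have "a \<otimes> i \<in> ideal_power A I m" using ab ij 3 by (auto simp: ideal_power_Suc intro: ideal_prod.prod)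
      moreover have "b \<otimes> i \<in> ideal_power A J n" using ideal.I_r_closed[OF pJ ab(2)] car ij by auto
      moreover have "y \<otimes> i = a \<otimes> i \<oplus> b \<otimes> i"
        unfolding ab(3) using ab(1,2) ij car by (simp add: A.l_distr)
      ultimately have yi: "y \<otimes> i \<in> ?T" unfolding mem_set_add by blast
      have "d \<otimes> j \<in> ideal_power A J n" using cd ij 3 by (auto simp: ideal_power_Suc intro: ideal_prod.prod)
      moreover have "c \<otimes> j \<in> ideal_power A I m" using ideal.I_r_closed[OF pI cd(1)] car ij by auto
      moreover have "y \<otimes> j = c \<otimes> j \<oplus> d \<otimes> j"
        unfolding cd(3) using cd(1,2) ij car by (simp add: A.l_distr)
      ultimately have yj: "y \<otimes> j \<in> ?T" unfolding mem_set_add by blast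
      have "y \<otimes> z = y \<otimes> i \<oplus> y \<otimes> j"
        unfolding ij(3) using prod(1) ij(1,2) car by (simp add: A.r_distr)
      then show ?case
        using yi yj additive_subgroup.a_closed[OF ideal.axioms(1)[OF T]] by simp
    next
      case (sum s t)
      then show ?case using additive_subgroup.a_closed[OF ideal.axioms(1)[OF T]] by simp
    qed
    then show ?thesis unfolding Suc.hyps(2)[symmetric] ideal_power_Suc by blast
  qed
qed

lemma nilpotent_ideal_sum:
  assumes "nilpotent_ideal I" "nilpotent_ideal J"
  shows "nilpotent_ideal (I <+>\<^bsub>A\<^esub> J)"
proof -
  obtain m n where I: "ideal I A" "ideal_power A I m \<subseteq> {\<zero>}" and J: "ideal J A" "ideal_power A J n \<subseteq> {\<zero>}"
    using assms by (auto simp: nilpotent_ideal_def)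
  have "ideal_power A (I <+>\<^bsub>A\<^esub> J) (m + n) \<subseteq> {\<zero>}"
    using ideal_power_sum[OF I(1) J(1), of m n] I(2) J(2) by (force simp: mem_set_add)
  then show ?thesis using A.add_ideals[OF I(1) J(1)] by (auto simp: nilpotent_ideal_def)
qed

text \<open>Normality allows all factors \<open>y\<close> in a product of multiples of \<open>y\<close> to be moved to the right, where
they collect to a power of \<open>y\<close>. Homogeneous elements are normal.\<close>

lemma nilpotent_principal:
  assumes y: "y \<in> carrier A" and y0: "y [^] (n::nat) = \<zero>"
    and normal: "\<And>b. b \<in> carrier A \<Longrightarrow> \<exists>b'\<in>carrier A. y \<otimes> b = b' \<otimes> y"
  shows "nilpotent_ideal {a \<otimes> y |a. a \<in> carrier A}"
proof -
  let ?J = "{a \<otimes> y |a. a \<in> carrier A}"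
  have normal_pow: "\<exists>b'\<in>carrier A. y [^] k \<otimes> b = b' \<otimes> y [^] k" if "b \<in> carrier A" for b and k :: nat
    using that
  proof (induction k arbitrary: b)
    case (Suc k)
    obtain c where c: "c \<in> carrier A" "y \<otimes> b = c \<otimes> y" using normal[OF Suc.prems] by auto
    obtain d where d: "d \<in> carrier A" "y [^] k \<otimes> c = d \<otimes> y [^] k" using Suc.IH[OF c(1)] by auto
    have "y [^] Suc k \<otimes> b = y [^] k \<otimes> (c \<otimes> y)" using y Suc.prems c by (simp add: A.m_assoc)
    also have "\<dots> = (y [^] k \<otimes> c) \<otimes> y" using y c by (simp add: A.m_assoc)
    also have "\<dots> = d \<otimes> y [^] Suc k" unfolding d(2) using y d(1) by (simp add: A.m_assoc)
    finally show ?case using d(1) by blast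
  qed auto
  have J: "ideal ?J A"
  proof (rule idealI_elementary)
    show "\<zero> \<in> ?J" using y by (auto intro!: exI[of _ \<zero>])
    show "a \<oplus> b \<in> ?J" if ab: "a \<in> ?J" "b \<in> ?J" for a b
    proof -
      obtain d e where de: "d \<in> carrier A" "e \<in> carrier A" "a = d \<otimes> y" "b = e \<otimes> y" using ab by auto
      then have "a \<oplus> b = (d \<oplus> e) \<otimes> y" using y by (simp add: A.l_distr)
      then show ?thesis using de by blast
    qed
    show "c \<otimes> a \<in> ?J" if ac: "a \<in> ?J" "c \<in> carrier A" for a c
    proof -
      obtain d where d: "d \<in> carrier A" "a = d \<otimes> y" using ac by auto
      then have "c \<otimes> a = (c \<otimes> d) \<otimes> y" using y ac(2) by (simp add: A.m_assoc)
      then show ?thesis using d ac(2) by blast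
    qed
    show "a \<otimes> c \<in> ?J" if ac: "a \<in> ?J" "c \<in> carrier A" for a c
    proof -
      obtain d where d: "d \<in> carrier A" "a = d \<otimes> y" using ac by auto
      obtain c' where c': "c' \<in> carrier A" "y \<otimes> c = c' \<otimes> y" using normal[OF ac(2)] by auto
      have "a \<otimes> c = (d \<otimes> c') \<otimes> y" using d c' y ac(2) by (simp add: A.m_assoc)
      then show ?thesis using d c' by blast
    qed
  qed (use y in auto)
  have "ideal_power A ?J k \<subseteq> {a \<otimes> y [^] k |a. a \<in> carrier A}" for k
  proof (induction k)
    case 0
    then show ?case by (force simp: ideal_power_0)
  next
    case (Suc k)
    have "x \<in> {a \<otimes> y [^] Suc k |a. a \<in> carrier A}" if "x \<in> ideal_prod A (ideal_power A ?J k) ?J" for x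
      using that
    proof (induction x rule: ideal_prod.induct)
      case (prod i j)
      obtain a where a: "a \<in> carrier A" "i = a \<otimes> y [^] k" using prod Suc.IH by auto
      obtain b where b: "b \<in> carrier A" "j = b \<otimes> y" using prod by auto
      obtain b' where b': "b' \<in> carrier A" "y [^] k \<otimes> b = b' \<otimes> y [^] k" using normal_pow[OF b(1)] by auto
      have "i \<otimes> j = a \<otimes> ((y [^] k \<otimes> b) \<otimes> y)" using a b y by (simp add: A.m_assoc)
      also have "\<dots> = (a \<otimes> b') \<otimes> y [^] Suc k" unfolding b'(2) using a(1) b'(1) y by (simp add: A.m_assoc)
      finally show ?case using a(1) b'(1) by blast
    next
      case (sum s t)
      then obtain a b where "a \<in> carrier A" "b \<in> carrier A" "s = a \<otimes> y [^] Suc k" "t = b \<otimes> y [^] Suc k" by auto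
      then have "s \<oplus> t = (a \<oplus> b) \<otimes> y [^] Suc k" "a \<oplus> b \<in> carrier A" using y by (auto simp: A.l_distr)
      then show ?case by blast
    qed
    then show ?case unfolding ideal_power_Suc by blast
  qed
  from this[of n] have "ideal_power A ?J n \<subseteq> {\<zero>}" unfolding y0 by auto
  then show ?thesis using J by (auto simp: nilpotent_ideal_def)
qed

end

locale supercomm_char_not_two = supercomm K A
  for K :: "'k ring" and A :: "('k, 'a) superalg" (structure) +
  assumes two_nonzero: "\<one>\<^bsub>K\<^esub> \<oplus>\<^bsub>K\<^esub> \<one>\<^bsub>K\<^esub> \<noteq> \<zero>\<^bsub>K\<^esub>"
begin

lemma odd_square:
  assumes "b \<in> A\<^sub>1"
  shows "b \<otimes> b = \<zero>"
proof -
  let ?t = "\<one>\<^bsub>K\<^esub> \<oplus>\<^bsub>K\<^esub> \<one>\<^bsub>K\<^esub>"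
  have t: "?t \<in> Units K" using two_nonzero by (simp add: K.field_Units)
  have bb: "b \<otimes> b \<in> carrier A" using assms by simp
  have "b \<otimes> b \<oplus> b \<otimes> b = \<zero>"
    using odd_anticommute[OF assms assms] bb by (metis A.r_neg)
  then have "?t \<odot> (b \<otimes> b) = \<zero>" using bb by (simp add: smult_l_distr)
  then have "inv\<^bsub>K\<^esub> ?t \<odot> (?t \<odot> (b \<otimes> b)) = \<zero>" using K.Units_inv_closed[OF t] by simp
  then show ?thesis
    using smult_assoc1[OF K.Units_inv_closed[OF t], of ?t "b \<otimes> b"] K.Units_l_inv[OF t] bb by simp
qed

text \<open>Since \<open>a1\<close> squares to zero and \<open>a0\<close> is central, at most one factor \<open>a1\<close> survives in a power of
\<open>a0 \<oplus> a1\<close>; its coefficient is an integer multiple of a power of \<open>a0\<close>, and only its evenness matters.\<close>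

lemma pow_formula:
  assumes "a0 \<in> A\<^sub>0" "a1 \<in> A\<^sub>1"
  shows "\<exists>k\<in>A\<^sub>0. (a0 \<oplus> a1) [^] Suc n = a0 [^] n \<otimes> (a0 \<oplus> k \<otimes> a1)"
proof (induction n)
  case 0
  show ?case using assms by (auto intro!: bexI[of _ \<one>])
next
  case (Suc n)
  then obtain k where k: "k \<in> A\<^sub>0" "(a0 \<oplus> a1) [^] Suc n = a0 [^] n \<otimes> (a0 \<oplus> k \<otimes> a1)" by auto
  have "(a0 \<oplus> k \<otimes> a1) \<otimes> (a0 \<oplus> a1) = a0 \<otimes> a0 \<oplus> (a0 \<otimes> a1 \<oplus> (k \<otimes> (a1 \<otimes> a0) \<oplus> k \<otimes> (a1 \<otimes> a1)))"
    using assms k(1) by (simp add: A.l_distr A.r_distr A.m_assoc A.a_ac)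
  also have "\<dots> = a0 \<otimes> (a0 \<oplus> (\<one> \<oplus> k) \<otimes> a1)"
    using assms k(1) odd_square[OF assms(2)]
    by (simp add: even_comm[of a0 a1] even_left_commute[of k a0] A.r_distr A.l_distr)
  finally have e: "(a0 \<oplus> k \<otimes> a1) \<otimes> (a0 \<oplus> a1) = a0 \<otimes> (a0 \<oplus> (\<one> \<oplus> k) \<otimes> a1)" .
  have "(a0 \<oplus> a1) [^] Suc (Suc n) = (a0 [^] n \<otimes> (a0 \<oplus> k \<otimes> a1)) \<otimes> (a0 \<oplus> a1)"
    using k(2) by simp
  also have "\<dots> = a0 [^] n \<otimes> (a0 \<otimes> (a0 \<oplus> (\<one> \<oplus> k) \<otimes> a1))"
    unfolding e[symmetric] using assms k(1) by (intro A.m_assoc) auto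
  also have "\<dots> = a0 [^] Suc n \<otimes> (a0 \<oplus> (\<one> \<oplus> k) \<otimes> a1)"
    using assms k(1) by (simp add: A.m_assoc)
  finally show ?case using k(1) by (auto intro!: bexI[of _ "\<one> \<oplus> k"])
qed

lemma nilradical_iff:
  assumes a: "a0 \<in> A\<^sub>0" "a1 \<in> A\<^sub>1"
  shows "a0 \<oplus> a1 \<in> nilradical A \<longleftrightarrow> (\<exists>n::nat. a0 [^] n = \<zero>)"
proof
  assume "a0 \<oplus> a1 \<in> nilradical A"
  then obtain m :: nat where m: "(a0 \<oplus> a1) [^] m = \<zero>" by (auto simp: nilradical_def)
  obtain k where k: "k \<in> A\<^sub>0" "(a0 \<oplus> a1) [^] Suc m = a0 [^] m \<otimes> (a0 \<oplus> k \<otimes> a1)"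
    using pow_formula[OF a] by blast
  have "a0 [^] Suc m \<oplus> a0 [^] m \<otimes> (k \<otimes> a1) = \<zero> \<oplus> \<zero>"
    using k m a by (simp add: A.r_distr)
  then have "a0 [^] Suc m = \<zero>" by (rule even_odd_unique(1)[rotated 4]) (use a k in auto)
  then show "\<exists>n::nat. a0 [^] n = \<zero>" by blast
next
  assume "\<exists>n::nat. a0 [^] n = \<zero>"
  then obtain n :: nat where n: "a0 [^] n = \<zero>" by auto
  obtain k where "k \<in> A\<^sub>0" "(a0 \<oplus> a1) [^] Suc n = a0 [^] n \<otimes> (a0 \<oplus> k \<otimes> a1)"
    using pow_formula[OF a] by blast
  then have "(a0 \<oplus> a1) [^] Suc n = \<zero>" using n a by simp
  then show "a0 \<oplus> a1 \<in> nilradical A" using a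
    unfolding nilradical_def by (intro CollectI conjI exI[of _ "Suc n"]) auto
qed

lemma even_nilpotent_iff:
  assumes "a \<in> A\<^sub>0"
  shows "(\<exists>n::nat. a [^] n = \<zero>) \<longleftrightarrow> (\<forall>p\<in>Spec. a \<in> p)"
proof
  assume "\<exists>n::nat. a [^] n = \<zero>"
  then show "\<forall>p\<in>Spec. a \<in> p" using prime_pow[OF _ assms] primeD(2) by metis
next
  assume "\<forall>p\<in>Spec. a \<in> p"
  then have "\<exists>n::nat. a [^] n \<in> {\<zero>}"
    using assms by (intro pow_in_even_ideal) (auto simp: even_ideal_def)
  then show "\<exists>n::nat. a [^] n = \<zero>" by auto
qed

text \<open>Describing nilpotency by primes turns the closure of nilpotent elements under addition into that
of prime ideals, without a binomial expansion.\<close>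

lemma nilradical_iff_primes:
  "\<lbrakk>a0 \<in> A\<^sub>0; a1 \<in> A\<^sub>1\<rbrakk> \<Longrightarrow> a0 \<oplus> a1 \<in> nilradical A \<longleftrightarrow> (\<forall>p\<in>Spec. a0 \<in> p)"
  by (simp add: nilradical_iff even_nilpotent_iff)

lemma odd_mult_in_prime:
  assumes p: "p \<in> Spec" and ab: "a \<in> A\<^sub>1" "b \<in> A\<^sub>1"
  shows "a \<otimes> b \<in> p"
proof -
  have "(a \<otimes> b) \<otimes> (a \<otimes> b) = (a \<otimes> b) \<otimes> (\<ominus> (b \<otimes> a))"
    using odd_anticommute[OF ab] by simp
  also have "\<dots> = \<ominus> (a \<otimes> (b \<otimes> b) \<otimes> a)" using ab by (simp add: A.r_minus A.m_assoc)
  also have "\<dots> = \<zero>" using odd_square ab by simp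
  finally have "(a \<otimes> b) \<otimes> (a \<otimes> b) \<in> p" using primeD(2)[OF p] by simp
  then show ?thesis using primeD(6)[OF p, of "a \<otimes> b" "a \<otimes> b"] ab by auto
qed

lemma nilradical_ideal: "ideal (nilradical A) A"
proof (rule idealI_elementary)
  have iff: "a0 \<oplus> a1 \<in> nilradical A \<longleftrightarrow> (\<forall>p\<in>Spec. a0 \<in> p)" if "a0 \<in> A\<^sub>0" "a1 \<in> A\<^sub>1" for a0 a1
    using nilradical_iff_primes that .
  show "\<zero> \<in> nilradical A" using iff[of \<zero> \<zero>] primeD(2) by simp
  show sub: "nilradical A \<subseteq> carrier A" by (auto simp: nilradical_def)
  fix a b assume a: "a \<in> nilradical A"
  obtain a0 a1 where a': "a0 \<in> A\<^sub>0" "a1 \<in> A\<^sub>1" "a = a0 \<oplus> a1"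
    using a sub even_odd_decomp by blast
  have ap: "\<forall>p\<in>Spec. a0 \<in> p" using iff a a' by simp
  {
    assume b: "b \<in> nilradical A"
    obtain b0 b1 where b': "b0 \<in> A\<^sub>0" "b1 \<in> A\<^sub>1" "b = b0 \<oplus> b1"
      using b sub even_odd_decomp by blast
    have bp: "\<forall>p\<in>Spec. b0 \<in> p" using iff b b' by simp
    have "a \<oplus> b = (a0 \<oplus> b0) \<oplus> (a1 \<oplus> b1)" using a' b' by (simp add: A.a_ac)
    then show "a \<oplus> b \<in> nilradical A" using iff[of "a0 \<oplus> b0" "a1 \<oplus> b1"] a' b' ap bp primeD(4) by simp
  }
  {
    assume b: "b \<in> carrier A"
    obtain b0 b1 where b': "b0 \<in> A\<^sub>0" "b1 \<in> A\<^sub>1" "b = b0 \<oplus> b1"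
      using b even_odd_decomp by blast
    have "b \<otimes> a = (b0 \<otimes> a0 \<oplus> b1 \<otimes> a1) \<oplus> (b0 \<otimes> a1 \<oplus> b1 \<otimes> a0)"
      using a' b' by (simp add: A.l_distr A.r_distr A.a_ac)
    moreover have "\<forall>p\<in>Spec. b0 \<otimes> a0 \<oplus> b1 \<otimes> a1 \<in> p"
      using ap a'(2) b'(1,2) by (simp add: primeD(4,5) odd_mult_in_prime)
    ultimately show "b \<otimes> a \<in> nilradical A"
      using iff[of "b0 \<otimes> a0 \<oplus> b1 \<otimes> a1" "b0 \<otimes> a1 \<oplus> b1 \<otimes> a0"] a' b' by simp
    have "a \<otimes> b = (b0 \<otimes> a0 \<oplus> a1 \<otimes> b1) \<oplus> (a0 \<otimes> b1 \<oplus> a1 \<otimes> b0)"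
      using a' b' by (simp add: A.l_distr A.r_distr A.a_ac even_comm[of b0 a0])
    moreover have "\<forall>p\<in>Spec. b0 \<otimes> a0 \<oplus> a1 \<otimes> b1 \<in> p"
      using ap a'(2) b'(1,2) by (simp add: primeD(4,5) odd_mult_in_prime)
    ultimately show "a \<otimes> b \<in> nilradical A"
      using iff[of "b0 \<otimes> a0 \<oplus> a1 \<otimes> b1" "a0 \<otimes> b1 \<oplus> a1 \<otimes> b0"] a' b' by simp
  }
qed

lemma nilradical_even_subset_prime: "\<lbrakk>p \<in> Spec; a \<in> A\<^sub>0; a \<in> nilradical A\<rbrakk> \<Longrightarrow> a \<in> p"
  using nilradical_iff_primes[of a \<zero>] by simp

text \<open>Nilpotency depends only on the even component, so the nilradical is a graded ideal.\<close>

lemma nilradical_quot_superalgebra: "superalgebra K (quot_superalg A (nilradical A))"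
proof (rule quot_superalgebra[OF nilradical_ideal])
  fix a b assume "a \<in> A\<^sub>0" "b \<in> A\<^sub>1" "a \<ominus> b \<in> nilradical A"
  then show "a \<in> nilradical A"
    using nilradical_iff_primes[of a "\<ominus> b"] nilradical_iff_primes[of a \<zero>] by (simp add: a_minus_def)
qed

text \<open>The homogeneous components of a nilpotent element are both nilpotent and normal; the principal
ideals that they generate are nilpotent, hence so is their sum.\<close>

lemma nilradical_in_nilpotent_ideal:
  assumes "a \<in> nilradical A"
  shows "\<exists>J. nilpotent_ideal J \<and> a \<in> J"
proof -
  obtain a0 a1 where a: "a0 \<in> A\<^sub>0" "a1 \<in> A\<^sub>1" "a = a0 \<oplus> a1"
    using assms even_odd_decomp by (auto simp: nilradical_def)
  obtain n :: nat where n: "a0 [^] n = \<zero>" using nilradical_iff[OF a(1,2)] assms a(3) by auto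
  let ?I = "{c \<otimes> a0 |c. c \<in> carrier A}" and ?J = "{c \<otimes> a1 |c. c \<in> carrier A}"
  have "nilpotent_ideal ?I"
    using a n by (intro nilpotent_principal[of a0 n]) (auto intro: even_central)
  moreover have "nilpotent_ideal ?J"
  proof (rule nilpotent_principal)
    show "a1 [^] (2::nat) = \<zero>" using odd_square[OF a(2)] a(2) by (simp add: numeral_2_eq_2)
    fix b assume "b \<in> carrier A"
    then obtain b0 b1 where b: "b0 \<in> A\<^sub>0" "b1 \<in> A\<^sub>1" "b = b0 \<oplus> b1" using even_odd_decomp by blast
    have "a1 \<otimes> b = b0 \<otimes> a1 \<oplus> \<ominus> (b1 \<otimes> a1)"
      using a b odd_anticommute[OF a(2) b(2)] even_comm[of b0 a1] by (simp add: A.r_distr)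
    also have "\<dots> = (b0 \<oplus> \<ominus> b1) \<otimes> a1"
      using a b by (simp add: A.l_distr A.l_minus)
    finally show "\<exists>b'\<in>carrier A. a1 \<otimes> b = b' \<otimes> a1" using b by auto
  qed (use a in auto)
  ultimately have "nilpotent_ideal (?I <+>\<^bsub>A\<^esub> ?J)" by (rule nilpotent_ideal_sum)
  moreover have "a0 \<in> ?I" "a1 \<in> ?J" using a by (auto intro!: exI[of _ \<one>])
  then have "a \<in> ?I <+>\<^bsub>A\<^esub> ?J" unfolding mem_set_add a(3) by blast
  ultimately show ?thesis by blast
qed

lemma finite_in_nilpotent_ideal:
  assumes "finite Y" "Y \<subseteq> nilradical A"
  shows "\<exists>J. nilpotent_ideal J \<and> Y \<subseteq> J"
  using assms
proof (induction Y)
  case empty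
  have "ideal_power A {\<zero>} 1 \<subseteq> {\<zero>}"
    using A.ideal_prod_inter[OF A.oneideal A.zeroideal] by (simp add: ideal_power_Suc ideal_power_0)
  then show ?case using A.zeroideal unfolding nilpotent_ideal_def by blast
next
  case (insert y Y)
  then obtain I J where I: "nilpotent_ideal I" "y \<in> I" and J: "nilpotent_ideal J" "Y \<subseteq> J"
    using nilradical_in_nilpotent_ideal[of y] by auto
  have id: "ideal I A" "ideal J A" using I J by (auto simp: nilpotent_ideal_def)
  then have z: "\<zero> \<in> I" "\<zero> \<in> J" using additive_subgroup.zero_closed ideal.axioms(1) by blast+
  have "i \<in> I <+>\<^bsub>A\<^esub> J" if "i \<in> I" for i
    using that z ideal.Icarr[OF id(1) that] unfolding mem_set_add by (metis A.r_zero)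
  moreover have "j \<in> I <+>\<^bsub>A\<^esub> J" if "j \<in> J" for j
    using that z ideal.Icarr[OF id(2) that] unfolding mem_set_add by (metis A.l_zero)
  ultimately show ?case using nilpotent_ideal_sum[OF I(1) J(1)] I J by blast
qed

end


section \<open>Points of the superspace and their pullbacks\<close>

lemma field_superalg_simps [simp]:
  "carrier (field_superalg K) = carrier K" "mult (field_superalg K) = mult K"
  "one (field_superalg K) = one K" "zero (field_superalg K) = zero K" "add (field_superalg K) = add K"
  "smult (field_superalg K) = mult K" "even_part (field_superalg K) = carrier K"
  "odd_part (field_superalg K) = {\<zero>\<^bsub>K\<^esub>}"
  by (simp_all add: field_superalg_def)

lemma field_superalg_supercomm: "field K \<Longrightarrow> supercomm K (field_superalg K)"
  by (rule supercommI[OF field_superalg_superalgebra])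

lemma prime_spectrum_field:
  assumes "field K"
  shows "prime_spectrum (field_superalg K) = {{\<zero>\<^bsub>K\<^esub>}}"
proof -
  interpret K: field K by fact
  interpret F: supercomm K "field_superalg K" using field_superalg_supercomm[OF assms] .
  have "q = {\<zero>\<^bsub>K\<^esub>}" if q: "q \<in> F.Spec" for q
  proof -
    note qD = F.primeD[OF q, simplified]
    have "a = \<zero>\<^bsub>K\<^esub>" if a: "a \<in> q" for a
    proof (rule ccontr)
      assume "a \<noteq> \<zero>\<^bsub>K\<^esub>"
      then have u: "a \<in> Units K" using a qD(1) by (auto simp: K.field_Units)
      then have "inv\<^bsub>K\<^esub> a \<otimes>\<^bsub>K\<^esub> a \<in> q" using qD(5)[OF _ a, of "inv\<^bsub>K\<^esub> a"] by simp
      then show False using K.Units_l_inv[OF u] qD(3) by (simp only:)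
    qed
    then show ?thesis using qD(2) by blast
  qed
  moreover have "{\<zero>\<^bsub>K\<^esub>} \<in> F.Spec"
    unfolding F.prime_spectrum_iff F.even_ideal_def using K.one_not_zero by (auto simp: K.integral_iff)
  ultimately show ?thesis by blast
qed

context supercomm begin

lemma unit_hom_hom: "unit_hom A \<in> superalg_hom K (field_superalg K) A"
  unfolding superalg_hom_def unit_hom_def
  by (auto intro!: ring_hom_memI simp: smult_l_distr smult_assoc1 smult_mult_left)

lemma superalg_hom_comp:
  "\<lbrakk>\<phi> \<in> superalg_hom K R S; \<psi> \<in> superalg_hom K S T\<rbrakk> \<Longrightarrow> (\<lambda>a. \<psi> (\<phi> a)) \<in> superalg_hom K R T"
  using superalg_homD[of \<phi> R S] superalg_homD[of \<psi> S T]
  by (auto simp: superalg_hom_def intro!: ring_hom_memI)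

lemma hom_nat_pow:
  assumes \<phi>: "\<phi> \<in> superalg_hom K A B" and "superalgebra K B" and a: "a \<in> carrier A"
  shows "\<phi> (a [^] (n::nat)) = \<phi> a [^]\<^bsub>B\<^esub> n"
proof -
  interpret B: superalgebra K B by fact
  show ?thesis
    using superalg_homD[OF \<phi>] a by (induction n) auto
qed

text \<open>If \<open>F\<close> were invertible near the image of \<open>p\<close>, its pullback \<open>w\<close> would be invertible in the
localization at \<open>p\<close>: \<open>u \<otimes> a \<otimes> w = u \<otimes> f\<close> with \<open>u\<close> and \<open>f\<close> outside \<open>p\<close>. The even components of both
sides contradict \<open>w \<in> p\<close>.\<close>

lemma not_invertible_near:
  assumes X: "geometric_superspace K X" and g: "g \<in> Mor K (SSpec A) X"
    and U: "openin (base X) U" and im: "\<And>p. p \<in> Spec \<Longrightarrow> fst g p \<in> U"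
    and F: "F \<in> carrier (sect X U)" and w: "snd g U F = global_section A w" "w \<in> A\<^sub>0"
    and p: "p \<in> Spec" "w \<in> p"
  shows "\<not> invertible_near X U F (fst g p)"
proof
  interpret X: geometric_superspace K X by fact
  assume "invertible_near X U F (fst g p)"
  then obtain W e where W: "openin (base X) W" "fst g p \<in> W" "W \<subseteq> U" and e: "e \<in> carrier (sect X W)"
    and inv: "e \<otimes>\<^bsub>sect X W\<^esub> res X U W F = \<one>\<^bsub>sect X W\<^esub>"
    by (auto simp: invertible_near_def)
  define P where "P = preimage_in (SSpec A) (fst g) W"
  have P: "openin (zariski A) P" "p \<in> P"
    using Mor_preimage_open[OF g W(1)] W(2) p by (auto simp: P_def preimage_in_def topspace_zariski)
  have PS: "P \<subseteq> Spec" using openin_zariski_subset[OF P(1)] .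
  have preU: "preimage_in (SSpec A) (fst g) U = Spec"
    using im by (auto simp: preimage_in_def topspace_zariski)
  note gD = superalg_homD[OF Mor_hom[OF g W(1)], folded P_def]
  have FW: "res X U W F \<in> carrier (sect X W)" using superalg_homD(1)[OF X.res_hom[OF U W(1,3)] F] .
  have gF: "snd g W (res X U W F) = restrict (global_section A w) P"
    using Mor_natural[OF g U W(1,3) F] by (simp add: w(1) P_def[symmetric])
  have sec: "snd g W e \<in> SSpec_sections A P" using gD(1)[OF e] by simp
  obtain a f where af: "a \<in> carrier A" "f \<in> A\<^sub>0" "f \<notin> p" "snd g W e p = frac p a f"
    using SSpec_sections_point[OF sec P(2)] by metis
  have "(snd g W e \<otimes>\<^bsub>sect (SSpec A) P\<^esub> snd g W (res X U W F)) p = \<one>\<^bsub>sect (SSpec A) P\<^esub> p"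
    using gD(2)[OF e FW] gD(4) inv by simp
  then have "frac p (a \<otimes> w) (f \<otimes> \<one>) = frac p \<one> \<one>"
    using P p af w(2) PS primeD(3)[OF p(1)]
    by (simp add: sections_mult gF sections_one global_section_eq frac_mult)
  then have "\<exists>u\<in>A\<^sub>0. u \<notin> p \<and> u \<otimes> (\<one> \<otimes> (a \<otimes> w)) = u \<otimes> (f \<otimes> \<one>)"
    using frac_eq_iff[OF p(1), of "a \<otimes> w" \<one> "f \<otimes> \<one>" \<one>] af w(2) primeD(3)[OF p(1)] by simp
  then obtain u where u: "u \<in> A\<^sub>0" "u \<notin> p" "u \<otimes> (a \<otimes> w) = u \<otimes> f" using af w(2) by auto
  obtain a0 a1 where a: "a0 \<in> A\<^sub>0" "a1 \<in> A\<^sub>1" "a = a0 \<oplus> a1" using even_odd_decomp[OF af(1)] .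
  have "u \<otimes> (a0 \<otimes> w) \<oplus> u \<otimes> (a1 \<otimes> w) = u \<otimes> f \<oplus> \<zero>"
    using u a w(2) af(2) by (simp add: A.l_distr A.r_distr)
  then have "u \<otimes> (a0 \<otimes> w) = u \<otimes> f"
    by (rule even_odd_unique(1)[rotated 4]) (use u a w(2) af(2) in auto)
  moreover have "u \<otimes> (a0 \<otimes> w) \<in> p" using primeD(5)[OF p(1)] u(1) a(1) p(2) by blast
  ultimately show False using primeD(6)[OF p(1), of u f] u af by auto
qed

end

text \<open>The comorphism of \<open>g\<close> over \<open>W\<close>, read as a homomorphism into \<open>A\<close>. It is meaningful for those \<open>W\<close> that
contain the image of \<open>g\<close>, where it is determined on the sections over \<open>W\<close>.\<close>

definition pullback :: "'k ring \<Rightarrow> ('k, 'p, 's) superspace \<Rightarrow> ('k, 'a) superalg \<Rightarrow> ('a, 'p, 's) point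
    \<Rightarrow> 'p set \<Rightarrow> 's \<Rightarrow> 'a" where
  "pullback K X A g W = (SOME \<phi>. \<phi> \<in> superalg_hom K (sect X W) A \<and>
    (\<forall>s\<in>carrier (sect X W). snd g W s = global_section A (\<phi> s)))"

lemma pullback:
  assumes X: "geometric_superspace K X" and A: "supercomm K A" and g: "g \<in> Mor K (SSpec A) X"
    and W: "openin (base X) W" and im: "\<And>p. p \<in> prime_spectrum A \<Longrightarrow> fst g p \<in> W"
  shows "pullback K X A g W \<in> superalg_hom K (sect X W) A"
    and "s \<in> carrier (sect X W) \<Longrightarrow> snd g W s = global_section A (pullback K X A g W s)"
proof -
  interpret X: geometric_superspace K X by fact
  interpret A: supercomm K A by fact
  have "preimage_in (SSpec A) (fst g) W = A.Spec"
    using im by (auto simp: preimage_in_def A.topspace_zariski)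
  then have "snd g W \<in> superalg_hom K (sect X W) (sect (SSpec A) A.Spec)"
    using Mor_hom[OF g W] by simp
  then have "\<exists>\<phi>. \<phi> \<in> superalg_hom K (sect X W) A \<and>
    (\<forall>s\<in>carrier (sect X W). snd g W s = global_section A (\<phi> s))"
    using A.lift_to_global X.sect_superalgebra[OF W] by blast
  from someI_ex[OF this, folded pullback_def]
  show "pullback K X A g W \<in> superalg_hom K (sect X W) A"
    "s \<in> carrier (sect X W) \<Longrightarrow> snd g W s = global_section A (pullback K X A g W s)" by auto
qed

lemma pullback_res:
  assumes X: "geometric_superspace K X" and A: "supercomm K A" and g: "g \<in> Mor K (SSpec A) X"
    and W: "openin (base X) W" "openin (base X) W'" "W' \<subseteq> W"
    and im: "\<And>p. p \<in> prime_spectrum A \<Longrightarrow> fst g p \<in> W'"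
    and s: "s \<in> carrier (sect X W)"
  shows "pullback K X A g W' (res X W W' s) = pullback K X A g W s"
proof -
  interpret X: geometric_superspace K X by fact
  interpret A: supercomm K A by fact
  have im': "fst g p \<in> W" if "p \<in> A.Spec" for p using im[OF that] W(3) by auto
  have pre: "preimage_in (SSpec A) (fst g) W = A.Spec" "preimage_in (SSpec A) (fst g) W' = A.Spec"
    using im im' by (auto simp: preimage_in_def A.topspace_zariski)
  have rs: "res X W W' s \<in> carrier (sect X W')" using A.superalg_homD(1)[OF X.res_hom[OF W] s] .
  have pc: "pullback K X A g W s \<in> carrier A" "pullback K X A g W' (res X W W' s) \<in> carrier A"
    using A.superalg_homD(1)[OF pullback(1)[OF X A g]] W im im' s rs by auto
  have "snd g W' (res X W W' s) = restrict (snd g W s) A.Spec"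
    using Mor_natural[OF g W s] by (simp add: pre)
  also have "\<dots> = snd g W s"
    using pullback(2)[OF X A g W(1) im' s] by (simp add: A.global_section_eq)
  finally show ?thesis
    using pullback(2)[OF X A g W(1) im' s] pullback(2)[OF X A g W(2) im rs] A.global_section_inj pc by metis
qed

text \<open>Both points correspond to primes of the chart \<open>B\<close>. For even \<open>h \<in> B\<close> with value \<open>\<theta> h\<close> at \<open>x\<close>, the
element \<open>h \<ominus> \<theta> h\<close> vanishes at \<open>x\<close> and has nilpotent pullback under \<open>g\<close>, so it is invertible near neither
point and lies in both primes. Hence each prime consists of the \<open>h\<close> with \<open>\<theta> h = \<zero>\<close>.\<close>

lemma point_eq_rational_point:
  fixes K :: "'k ring" and X :: "('k, 'p, 's) superspace" and A :: "('k, 'a) superalg"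
  assumes X: "geometric_superspace K X" and A: "supercomm K A" and g: "g \<in> Mor K (SSpec A) X"
    and x: "x \<in> Mor K (SSpec (field_superalg K)) X" and U: "affine_open K X U"
    and img: "\<And>p. p \<in> prime_spectrum A \<Longrightarrow> fst g p \<in> U"
    and imx: "\<And>q. q \<in> prime_spectrum (field_superalg K) \<Longrightarrow> fst x q \<in> U"
    and nilp: "\<And>m. m \<in> carrier (sect X U) \<Longrightarrow> pullback K X (field_superalg K) x U m = \<zero>\<^bsub>K\<^esub>
      \<Longrightarrow> \<exists>n::nat. pullback K X A g U m [^]\<^bsub>A\<^esub> n = \<zero>\<^bsub>A\<^esub>"
    and p: "p \<in> prime_spectrum A" and q: "q \<in> prime_spectrum (field_superalg K)"
  shows "fst g p = fst x q"
proof -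
  interpret X: geometric_superspace K X by fact
  interpret A: supercomm K A by fact
  interpret F: supercomm K "field_superalg K" by (rule field_superalg_supercomm[OF A.K.field_axioms])
  obtain B :: "('k, 's) superalg" and \<beta> and pt where B: "supercomm K B"
    and \<beta>: "\<beta> \<in> superalg_hom K B (sect X U)" and inj: "inj_on pt U"
    and pt: "\<And>y. y \<in> U \<Longrightarrow> pt y \<in> prime_spectrum B"
    and inv: "\<And>y h. y \<in> U \<Longrightarrow> h \<in> even_part B \<Longrightarrow> h \<notin> pt y \<Longrightarrow> invertible_near X U (\<beta> h) y"
    using affine_chart[OF X U] by metis
  interpret B: supercomm K B by fact
  have oU: "openin (base X) U" using U by (simp add: affine_open_def)
  let ?\<phi> = "pullback K X A g U" and ?\<chi> = "pullback K X (field_superalg K) x U"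
  note \<phi> = pullback(1)[OF X A g oU img] and \<chi> = pullback(1)[OF X F.supercomm_axioms x oU imx]
  define \<theta> where "\<theta> h = ?\<chi> (\<beta> h)" for h
  have \<theta>: "\<theta> \<in> superalg_hom K B (field_superalg K)" unfolding \<theta>_def by (rule B.superalg_hom_comp[OF \<beta> \<chi>])
  note \<theta>D = B.superalg_homD[OF \<theta>]
  have key: "h \<in> pt y \<longleftrightarrow> \<theta> h = \<zero>\<^bsub>K\<^esub>" if y: "y = fst g p \<or> y = fst x q" and h: "h \<in> B.A\<^sub>0" for y h
  proof -
    define c where "c = \<theta> h"
    have c: "c \<in> carrier K" unfolding c_def using \<theta>D(1)[of h] h by simp
    define c1 where "c1 = c \<odot>\<^bsub>B\<^esub> \<one>\<^bsub>B\<^esub>"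
    have c1: "c1 \<in> B.A\<^sub>0" unfolding c1_def using c by simp
    define h' where "h' = h \<ominus>\<^bsub>B\<^esub> c1"
    have h': "h' \<in> B.A\<^sub>0" unfolding h'_def using h c1 by simp
    have "\<theta> c1 = c" unfolding c1_def using \<theta>D(4) \<theta>D(5)[OF c, of "\<one>\<^bsub>B\<^esub>"] c by simp
    then have "\<theta> h' = c \<ominus>\<^bsub>field_superalg K\<^esub> c"
      unfolding h'_def using B.superalg_hom_zero_minus(2)[OF \<theta> F.superalgebra_axioms, of h c1] h c1
      by (simp add: c_def)
    then have \<theta>h': "\<theta> h' = \<zero>\<^bsub>K\<^esub>" using F.A.r_right_minus_eq[of c c] c by simp
    have \<beta>h': "\<beta> h' \<in> carrier (sect X U)" "\<beta> h' \<in> even_part (sect X U)"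
      using B.superalg_homD[OF \<beta>] h' by auto
    have yU: "y \<in> U" using y img[OF p] imx[OF q] by auto
    have "\<not> invertible_near X U (\<beta> h') y"
    proof (cases "y = fst g p")
      case True
      have ev: "?\<phi> (\<beta> h') \<in> A.A\<^sub>0" using B.superalg_homD(6)[OF \<phi>] \<beta>h' by simp
      obtain n :: nat where "?\<phi> (\<beta> h') [^]\<^bsub>A\<^esub> n = \<zero>\<^bsub>A\<^esub>" using nilp[OF \<beta>h'(1)] \<theta>h' by (auto simp: \<theta>_def)
      then have "?\<phi> (\<beta> h') \<in> p" using A.prime_pow[OF p ev, of n] A.primeD(2)[OF p] by simp
      then show ?thesis
        unfolding True using A.not_invertible_near[OF X g oU img \<beta>h'(1) pullback(2)[OF X A g oU img \<beta>h'(1)] ev p]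
        by blast
    next
      case False
      then have y: "y = fst x q" using y by simp
      have "snd x U (\<beta> h') = global_section (field_superalg K) \<zero>\<^bsub>K\<^esub>"
        using pullback(2)[OF X F.supercomm_axioms x oU imx \<beta>h'(1)] \<theta>h' by (simp add: \<theta>_def)
      then show ?thesis
        unfolding y using F.not_invertible_near[OF X x oU imx \<beta>h'(1) _ _ q] F.primeD(2)[OF q] by simp
    qed
    then have h'p: "h' \<in> pt y" using inv[OF yU h'] by blast
    note yD = B.primeD[OF pt[OF yU]]
    show ?thesis
    proof (cases "c = \<zero>\<^bsub>K\<^esub>")
      case True
      then have "h' = h" unfolding h'_def c1_def using h by (simp add: a_minus_def)
      then show ?thesis using h'p True by (simp add: c_def)
    next
      case False
      have u: "c \<in> Units K" using False c by (simp add: A.K.field_Units)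
      have "h \<notin> pt y"
      proof
        assume hp: "h \<in> pt y"
        have "\<ominus>\<^bsub>B\<^esub> \<one>\<^bsub>B\<^esub> \<otimes>\<^bsub>B\<^esub> h' \<in> pt y" using yD(5)[OF _ h'p] by simp
        then have "h \<oplus>\<^bsub>B\<^esub> \<ominus>\<^bsub>B\<^esub> \<one>\<^bsub>B\<^esub> \<otimes>\<^bsub>B\<^esub> h' \<in> pt y" using yD(4)[OF hp] by simp
        moreover have "h \<oplus>\<^bsub>B\<^esub> \<ominus>\<^bsub>B\<^esub> \<one>\<^bsub>B\<^esub> \<otimes>\<^bsub>B\<^esub> h' = c1"
          unfolding h'_def using h c1
          by (simp add: B.A.l_minus a_minus_def B.A.minus_add B.A.r_neg1 B.A.r_neg2)
        ultimately have "c1 \<in> pt y" by simp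
        then have "(inv\<^bsub>K\<^esub> c \<odot>\<^bsub>B\<^esub> \<one>\<^bsub>B\<^esub>) \<otimes>\<^bsub>B\<^esub> c1 \<in> pt y" using yD(5) u by simp
        moreover have "(inv\<^bsub>K\<^esub> c \<odot>\<^bsub>B\<^esub> \<one>\<^bsub>B\<^esub>) \<otimes>\<^bsub>B\<^esub> c1 = \<one>\<^bsub>B\<^esub>"
          unfolding c1_def using u c by (simp add: B.smult_one_mult B.smult_assoc1[symmetric])
        ultimately show False using yD(3) by simp
      qed
      then show ?thesis using False by (simp add: c_def)
    qed
  qed
  \<comment> \<open>a prime of \<open>B\<close> is a set of even elements, so \<open>key\<close> determines it\<close>
  have "pt (fst g p) = pt (fst x q)"
    using key B.primeD(1)[OF pt[OF img[OF p]]] B.primeD(1)[OF pt[OF imx[OF q]]] by blast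
  then show ?thesis using inj_onD[OF inj _ img[OF p] imx[OF q]] by blast
qed

text \<open>Near \<open>y\<close> the section \<open>s\<close> satisfies \<open>h s = b\<close> with functions \<open>h\<close>, \<open>b\<close> on \<open>V\<close> and \<open>h\<close> invertible.
Writing \<open>c\<close> and \<open>d\<close> for the values of \<open>h\<close> and \<open>s\<close> at \<open>x\<close> and \<open>a\<close> for the pullback of \<open>s\<close>, the congruences
for \<open>h\<close> and \<open>b\<close> give that \<open>c (a - d)\<close> lies in \<open>I\<close>, and \<open>c\<close> is a nonzero scalar.\<close>

lemma congruence_spreads:
  fixes K :: "'k ring" and X :: "('k, 'p, 's) superspace" and A :: "('k, 'a) superalg"
  assumes X: "geometric_superspace K X" and A: "supercomm K A" and g: "g \<in> Mor K (SSpec A) X"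
    and x: "x \<in> Mor K (SSpec (field_superalg K)) X" and V: "affine_open K X V"
    and img: "\<And>p. p \<in> prime_spectrum A \<Longrightarrow> fst g p = y"
    and imx: "\<And>q. q \<in> prime_spectrum (field_superalg K) \<Longrightarrow> fst x q = y"
    and I: "ideal I A"
    and cong: "\<And>m. m \<in> carrier (sect X V) \<Longrightarrow>
      pullback K X A g V m \<ominus>\<^bsub>A\<^esub> unit_hom A (pullback K X (field_superalg K) x V m) \<in> I"
    and yV: "y \<in> V" and W: "openin (base X) W" "y \<in> W" and s: "s \<in> carrier (sect X W)"
  shows "pullback K X A g W s \<ominus>\<^bsub>A\<^esub> unit_hom A (pullback K X (field_superalg K) x W s) \<in> I"
proof -
  interpret X: geometric_superspace K X by fact
  interpret A: supercomm K A by fact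
  interpret F: supercomm K "field_superalg K" by (rule field_superalg_supercomm[OF A.K.field_axioms])
  interpret I: ideal I A by fact
  obtain B :: "('k, 's) superalg" and \<beta> where B: "supercomm K B"
    and \<beta>: "\<beta> \<in> superalg_hom K B (sect X V)"
    and loc: "\<exists>W' b h e. openin (base X) W' \<and> y \<in> W' \<and> W' \<subseteq> W \<inter> V \<and> b \<in> carrier B \<and> h \<in> even_part B \<and>
        e \<in> carrier (sect X W') \<and> e \<otimes>\<^bsub>sect X W'\<^esub> res X V W' (\<beta> h) = \<one>\<^bsub>sect X W'\<^esub> \<and>
        res X V W' (\<beta> h) \<otimes>\<^bsub>sect X W'\<^esub> res X W W' s = res X V W' (\<beta> b)"
    using affine_chart[OF X V] W yV s by metis
  interpret B: supercomm K B by fact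
  obtain W' b h e where W': "openin (base X) W'" "y \<in> W'" "W' \<subseteq> W \<inter> V" and b: "b \<in> carrier B"
    and h: "h \<in> even_part B" and e: "e \<in> carrier (sect X W')"
      "e \<otimes>\<^bsub>sect X W'\<^esub> res X V W' (\<beta> h) = \<one>\<^bsub>sect X W'\<^esub>"
    and eq: "res X V W' (\<beta> h) \<otimes>\<^bsub>sect X W'\<^esub> res X W W' s = res X V W' (\<beta> b)"
    using loc by auto
  have oV: "openin (base X) V" using V by (simp add: affine_open_def)
  have sub: "W' \<subseteq> V" "W' \<subseteq> W" using W' by auto
  let ?\<phi> = "pullback K X A g" and ?\<chi> = "pullback K X (field_superalg K) x"
  have \<phi>: "?\<phi> Z \<in> superalg_hom K (sect X Z) A" if "openin (base X) Z" "y \<in> Z" for Z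
    using pullback(1)[OF X A g that(1)] img that(2) by simp
  have \<chi>: "?\<chi> Z \<in> superalg_hom K (sect X Z) (field_superalg K)" if "openin (base X) Z" "y \<in> Z" for Z
    using pullback(1)[OF X F.supercomm_axioms x that(1)] imx that(2) by simp
  have \<phi>_res: "?\<phi> W' (res X Z W' t) = ?\<phi> Z t" if "openin (base X) Z" "W' \<subseteq> Z" "t \<in> carrier (sect X Z)" for Z t
    using pullback_res[OF X A g that(1) W'(1) that(2) _ that(3)] img W'(2) by simp
  have \<chi>_res: "?\<chi> W' (res X Z W' t) = ?\<chi> Z t" if "openin (base X) Z" "W' \<subseteq> Z" "t \<in> carrier (sect X Z)" for Z t
    using pullback_res[OF X F.supercomm_axioms x that(1) W'(1) that(2) _ that(3)] imx W'(2) by simp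
  have car: "\<beta> h \<in> carrier (sect X V)" "\<beta> b \<in> carrier (sect X V)"
    using B.superalg_homD(1)[OF \<beta>] h b by auto
  have rcar: "res X V W' t \<in> carrier (sect X W')" if "t \<in> carrier (sect X V)" for t
    using A.superalg_homD(1)[OF X.res_hom[OF oV W'(1) sub(1)] that] .
  have rs: "res X W W' s \<in> carrier (sect X W')"
    using A.superalg_homD(1)[OF X.res_hom[OF W(1) W'(1) sub(2)] s] .
  define c d where "c = ?\<chi> V (\<beta> h)" and "d = ?\<chi> W s"
  define f k a where "f = ?\<phi> V (\<beta> h)" and "k = ?\<phi> V (\<beta> b)" and "a = ?\<phi> W s"
  have cd: "c \<in> carrier K" "d \<in> carrier K"
    unfolding c_def d_def using A.superalg_homD(1)[OF \<chi>] oV yV W car s by force+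
  have fka: "f \<in> carrier A" "k \<in> carrier A" "a \<in> carrier A"
    unfolding f_def k_def a_def using A.superalg_homD(1)[OF \<phi>] oV yV W car s by force+
  have fa: "f \<otimes>\<^bsub>A\<^esub> a = k"
    using A.superalg_homD(2)[OF \<phi>[OF W'(1,2)] rcar[OF car(1)] rs] eq \<phi>_res[OF oV sub(1)] car \<phi>_res[OF W(1) sub(2) s]
    by (simp add: f_def k_def a_def)
  have cd_eq: "?\<chi> V (\<beta> b) = c \<otimes>\<^bsub>K\<^esub> d"
    using A.superalg_homD(2)[OF \<chi>[OF W'(1,2)] rcar[OF car(1)] rs] eq \<chi>_res[OF oV sub(1)] car \<chi>_res[OF W(1) sub(2) s]
    by (simp add: c_def d_def)
  have "?\<chi> W' e \<otimes>\<^bsub>K\<^esub> c = \<one>\<^bsub>K\<^esub>"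
    using A.superalg_homD(2)[OF \<chi>[OF W'(1,2)] e(1) rcar[OF car(1)]] A.superalg_homD(4)[OF \<chi>[OF W'(1,2)]] e(2)
      \<chi>_res[OF oV sub(1)] car by (simp add: c_def)
  moreover have "?\<chi> W' e \<in> carrier K" using A.superalg_homD(1)[OF \<chi>[OF W'(1,2)] e(1)] by simp
  ultimately have "c \<noteq> \<zero>\<^bsub>K\<^esub>" using A.K.one_not_zero by auto
  then have u: "c \<in> Units K" using cd by (simp add: A.K.field_Units)
  define d1 where "d1 = d \<odot>\<^bsub>A\<^esub> \<one>\<^bsub>A\<^esub>"
  have d1: "d1 \<in> carrier A" unfolding d1_def using cd by simp
  have f_in: "f \<ominus>\<^bsub>A\<^esub> c \<odot>\<^bsub>A\<^esub> \<one>\<^bsub>A\<^esub> \<in> I" and k_in: "k \<ominus>\<^bsub>A\<^esub> c \<odot>\<^bsub>A\<^esub> d1 \<in> I"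
    using cong[OF car(1)] cong[OF car(2)] cd
    by (simp_all add: f_def k_def c_def[symmetric] unit_hom_def cd_eq A.smult_assoc1 d1_def)
  have "(f \<ominus>\<^bsub>A\<^esub> c \<odot>\<^bsub>A\<^esub> \<one>\<^bsub>A\<^esub>) \<otimes>\<^bsub>A\<^esub> a = k \<ominus>\<^bsub>A\<^esub> c \<odot>\<^bsub>A\<^esub> a"
    using fka cd fa by (simp add: a_minus_def A.A.l_distr A.A.l_minus A.smult_one_mult)
  then have ka: "k \<ominus>\<^bsub>A\<^esub> c \<odot>\<^bsub>A\<^esub> a \<in> I" using I.I_r_closed[OF f_in fka(3)] by simp
  have "(k \<ominus>\<^bsub>A\<^esub> c \<odot>\<^bsub>A\<^esub> d1) \<oplus>\<^bsub>A\<^esub> \<ominus>\<^bsub>A\<^esub> (k \<ominus>\<^bsub>A\<^esub> c \<odot>\<^bsub>A\<^esub> a) \<in> I"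
    using I.a_closed[OF k_in I.a_inv_closed[OF ka]] .
  moreover have "(k \<ominus>\<^bsub>A\<^esub> c \<odot>\<^bsub>A\<^esub> d1) \<oplus>\<^bsub>A\<^esub> \<ominus>\<^bsub>A\<^esub> (k \<ominus>\<^bsub>A\<^esub> c \<odot>\<^bsub>A\<^esub> a) = c \<odot>\<^bsub>A\<^esub> (a \<ominus>\<^bsub>A\<^esub> d1)"
  proof -
    have "c \<odot>\<^bsub>A\<^esub> (a \<ominus>\<^bsub>A\<^esub> d1) = c \<odot>\<^bsub>A\<^esub> a \<oplus>\<^bsub>A\<^esub> \<ominus>\<^bsub>A\<^esub> (c \<odot>\<^bsub>A\<^esub> d1)"
      using cd fka d1 by (simp add: a_minus_def A.smult_r_distr A.smult_r_minus)
    then show ?thesis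
      using cd fka d1 by (simp add: a_minus_def A.A.minus_add A.A.a_ac A.A.r_neg1 A.A.r_neg2 A.A.r_neg)
  qed
  ultimately have "inv\<^bsub>K\<^esub> c \<odot>\<^bsub>A\<^esub> (c \<odot>\<^bsub>A\<^esub> (a \<ominus>\<^bsub>A\<^esub> d1)) \<in> I"
    using A.smult_ideal[OF I, of "inv\<^bsub>K\<^esub> c"] u by simp
  moreover have "inv\<^bsub>K\<^esub> c \<odot>\<^bsub>A\<^esub> (c \<odot>\<^bsub>A\<^esub> (a \<ominus>\<^bsub>A\<^esub> d1)) = a \<ominus>\<^bsub>A\<^esub> d1"
    using A.smult_assoc1[of "inv\<^bsub>K\<^esub> c" c "a \<ominus>\<^bsub>A\<^esub> d1"] A.K.Units_l_inv[OF u] A.K.Units_inv_closed[OF u] cd fka d1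
    by simp
  ultimately have "a \<ominus>\<^bsub>A\<^esub> d1 \<in> I" by simp
  then show ?thesis by (simp add: a_def d1_def d_def unit_hom_def)
qed


section \<open>Reduction modulo the nilradical and formal neighborhoods\<close>

context supercomm_char_not_two begin

text \<open>The elements on which \<open>\<phi>\<close> and \<open>\<chi>\<close> agree modulo an ideal form a subalgebra, so it is enough to
choose \<open>J\<close> for the generators.\<close>

lemma finitely_generated_congruence:
  fixes R :: "('k, 'b) superalg"
  assumes R: "superalgebra K R" and fg: "finitely_generated K R"
    and \<phi>: "\<phi> \<in> superalg_hom K R A" and \<chi>: "\<chi> \<in> superalg_hom K R (field_superalg K)"
    and nil: "\<And>s. s \<in> carrier R \<Longrightarrow> \<phi> s \<ominus> unit_hom A (\<chi> s) \<in> nilradical A"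
  shows "\<exists>J. nilpotent_ideal J \<and> (\<forall>s\<in>carrier R. \<phi> s \<ominus> unit_hom A (\<chi> s) \<in> J)"
proof -
  interpret R: superalgebra K R by fact
  obtain G where G: "finite G" "G \<subseteq> carrier R"
    and gen: "\<And>H. subring H R \<Longrightarrow> submodule H K R \<Longrightarrow> G \<subseteq> H \<Longrightarrow> H = carrier R"
    using fg by (auto simp: finitely_generated_def)
  define D where "D s = \<phi> s \<ominus> unit_hom A (\<chi> s)" for s
  have "D ` G \<subseteq> nilradical A" using nil G(2) by (auto simp: D_def)
  then obtain J where J: "nilpotent_ideal J" "D ` G \<subseteq> J"
    using finite_in_nilpotent_ideal[of "D ` G"] G(1) by auto
  have J_id: "ideal J A" using J(1) by (simp add: nilpotent_ideal_def)
  interpret J: ideal J A by fact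
  note \<phi>D = superalg_homD[OF \<phi>] and \<chi>D = superalg_homD[OF \<chi>, simplified]
    and uD = superalg_homD[OF unit_hom_hom, simplified]
  define H where "H = {s \<in> carrier R. D s \<in> J}"
  have D1: "D \<one>\<^bsub>R\<^esub> \<in> J"
    unfolding D_def using \<phi>D(4) \<chi>D(4) uD(4) J.zero_closed by (simp add: a_minus_def A.r_neg)
  have Dadd: "D (s \<oplus>\<^bsub>R\<^esub> t) = D s \<oplus> D t" if "s \<in> carrier R" "t \<in> carrier R" for s t
    unfolding D_def using that \<phi>D(1,3) \<chi>D(1,3) uD(1,3)
    by (simp add: a_minus_def A.minus_add A.a_ac)
  have Dsmult: "D (c \<odot>\<^bsub>R\<^esub> s) = c \<odot> D s" if "c \<in> carrier K" "s \<in> carrier R" for c s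
    unfolding D_def using that \<phi>D(1,5) \<chi>D(1,5) uD(1,5)
    by (simp add: a_minus_def smult_r_distr smult_r_minus)
  have Dmult: "D (s \<otimes>\<^bsub>R\<^esub> t) = D s \<otimes> \<phi> t \<oplus> unit_hom A (\<chi> s) \<otimes> D t"
    if "s \<in> carrier R" "t \<in> carrier R" for s t
    unfolding D_def using that \<phi>D(1,2) \<chi>D(1,2) uD(1,2)
    by (simp add: a_minus_def A.l_distr A.r_distr A.l_minus A.r_minus A.a_assoc A.r_neg1)
  have Hsmult: "c \<odot>\<^bsub>R\<^esub> s \<in> H" if "c \<in> carrier K" "s \<in> H" for c s
    using that Dsmult[of c s] smult_ideal[OF J_id] by (auto simp: H_def)
  have Hneg: "\<ominus>\<^bsub>R\<^esub> s \<in> H" if "s \<in> H" for s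
    using Hsmult[of "\<ominus>\<^bsub>K\<^esub> \<one>\<^bsub>K\<^esub>" s] that by (simp add: H_def R.smult_l_minus)
  have Hadd: "s \<oplus>\<^bsub>R\<^esub> t \<in> H" if "s \<in> H" "t \<in> H" for s t
    using that Dadd[of s t] J.a_closed by (auto simp: H_def)
  have H1: "\<one>\<^bsub>R\<^esub> \<in> H" using D1 by (simp add: H_def)
  have "H = carrier R"
  proof (rule gen)
    show "subring H R"
    proof (rule R.A.subringI)
      show "s \<otimes>\<^bsub>R\<^esub> t \<in> H" if "s \<in> H" "t \<in> H" for s t
        using that Dmult[of s t] J.a_closed J.I_r_closed[of "D s" "\<phi> t"]
          J.I_l_closed[of "D t" "unit_hom A (\<chi> s)"] \<phi>D(1) \<chi>D(1) uD(1) by (auto simp: H_def)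
    qed (use H1 Hneg Hadd in \<open>auto simp: H_def\<close>)
    show "submodule H K R"
    proof (rule R.submoduleI)
      show "\<zero>\<^bsub>R\<^esub> \<in> H" using Hsmult[of "\<zero>\<^bsub>K\<^esub>" "\<one>\<^bsub>R\<^esub>"] H1 by simp
    qed (use Hneg Hadd Hsmult in \<open>auto simp: H_def\<close>)
    show "G \<subseteq> H" using G(2) J(2) by (auto simp: H_def)
  qed
  then show ?thesis using J(1) unfolding H_def D_def by blast
qed

end

text \<open>An open set missing the point \<open>y\<close> has empty preimage, over which the only section is the
extensional function on the empty set.\<close>

lemma points_map_constant:
  fixes K :: "'k ring" and X :: "('k, 'p, 's) superspace" and A :: "('k, 'a) superalg"
    and B :: "('k, 'b) superalg"
  assumes X: "geometric_superspace K X" and A: "supercomm K A" and B: "supercomm K B"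
    and h: "h \<in> superalg_hom K A B" and g: "g \<in> Mor K (SSpec A) X"
    and const: "\<And>p. p \<in> prime_spectrum A \<Longrightarrow> fst g p = y"
  shows "points_map X A B h g = (\<lambda>q\<in>prime_spectrum B. y,
    \<lambda>W\<in>{W. openin (base X) W}. \<lambda>s\<in>carrier (sect X W).
      if y \<in> W then global_section B (h (pullback K X A g W s)) else (\<lambda>_. undefined))"
proof -
  interpret X: geometric_superspace K X by fact
  interpret A: supercomm K A by fact
  interpret B: supercomm K B by fact
  have 1: "(\<lambda>q\<in>topspace (base (SSpec B)). fst g (fst (SSpec_map A B h) q)) = (\<lambda>q\<in>B.Spec. y)"
    using const preimage_prime[OF A B h] SSpec_point_map_eq[OF B, of _ A h]
    by (auto simp: B.topspace_zariski SSpec_map_def intro!: restrict_ext)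
  have 2: "snd (SSpec_map A B h) (preimage_in (SSpec A) (fst g) W) (snd g W s) =
      (if y \<in> W then global_section B (h (pullback K X A g W s)) else (\<lambda>_. undefined))"
    if W: "openin (base X) W" and s: "s \<in> carrier (sect X W)" for W s
  proof (cases "y \<in> W")
    case True
    have im: "fst g p \<in> W" if "p \<in> A.Spec" for p using const[OF that] True by simp
    have "preimage_in (SSpec A) (fst g) W = A.Spec"
      using im by (auto simp: preimage_in_def A.topspace_zariski)
    moreover have "snd g W s = global_section A (pullback K X A g W s)"
      using pullback(2)[OF X A g W im s] .
    moreover have "pullback K X A g W s \<in> carrier A"
      using A.superalg_homD(1)[OF pullback(1)[OF X A g W im] s] .
    ultimately show ?thesis using True SSpec_map_global_section[OF A B h] by simp
  next
    case False
    have pre: "preimage_in (SSpec A) (fst g) W = {}"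
      using const False by (auto simp: preimage_in_def A.topspace_zariski)
    have "snd g W s \<in> SSpec_sections A {}"
      using A.superalg_homD(1)[OF Mor_hom[OF g W] s] by (simp add: pre)
    then show ?thesis using False unfolding pre
      by (simp add: SSpec_map_def preimage_in_def restrict_def)
  qed
  show ?thesis
    unfolding points_map_def comp_mor_def 1
    by (auto simp: 2 intro!: restrict_ext)
qed

lemma rational_point_constant:
  assumes "field K"
  shows "q \<in> prime_spectrum (field_superalg K) \<Longrightarrow> fst x q = fst x {\<zero>\<^bsub>K\<^esub>}"
    "{\<zero>\<^bsub>K\<^esub>} \<in> prime_spectrum (field_superalg K)"
  using prime_spectrum_field[OF assms] by auto

text \<open>The image of \<open>p\<close> in the quotient is disjoint from that of its complement, because \<open>p\<close> contains
the even nilpotents; a prime separating the two restricts to \<open>p\<close>.\<close>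

lemma (in supercomm_char_not_two) Spec_reduction_surj:
  assumes p: "p \<in> Spec"
  defines "N \<equiv> nilradical A"
  shows "\<exists>q\<in>prime_spectrum (quot_superalg A N). {a \<in> A\<^sub>0. quot_map A N a \<in> q} = p"
proof -
  let ?Q = "quot_superalg A N" and ?\<pi> = "quot_map A N"
  interpret Q: supercomm K ?Q
    unfolding N_def using supercommI[OF nilradical_quot_superalgebra] .
  have N: "ideal N A" unfolding N_def by (rule nilradical_ideal)
  note \<pi>D = superalg_homD[OF quot_map_hom[OF N]] and pD = primeD[OF p]
  have z: "?\<pi> \<zero> = \<zero>\<^bsub>?Q\<^esub>" using superalg_hom_zero_minus(1)[OF quot_map_hom[OF N] Q.superalgebra_axioms] .
  have "\<exists>q\<in>Q.Spec. ?\<pi> ` p \<subseteq> q \<and> q \<inter> ?\<pi> ` (A\<^sub>0 - p) = {}"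
  proof (rule Q.exists_prime_avoiding)
    show "Q.even_ideal (?\<pi> ` p)"
      unfolding Q.even_ideal_def
    proof (intro conjI ballI)
      show "?\<pi> ` p \<subseteq> even_part ?Q" using pD(1) by (auto simp: quot_superalg_simps(6))
      show "\<zero>\<^bsub>?Q\<^esub> \<in> ?\<pi> ` p" using pD(2) z by (metis imageI)
    next
      fix x y assume "x \<in> ?\<pi> ` p" "y \<in> ?\<pi> ` p"
      then obtain a b where ab: "a \<in> p" "b \<in> p" "x = ?\<pi> a" "y = ?\<pi> b" by auto
      note ab(3,4)
      moreover have "a \<in> carrier A" "b \<in> carrier A" using ab pD(1) by auto
      ultimately have "x \<oplus>\<^bsub>?Q\<^esub> y = ?\<pi> (a \<oplus> b)" using \<pi>D(3)[of a b] by simp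
      then show "x \<oplus>\<^bsub>?Q\<^esub> y \<in> ?\<pi> ` p" using pD(4) ab by auto
    next
      fix x y assume "x \<in> even_part ?Q" "y \<in> ?\<pi> ` p"
      then obtain a b where ab: "a \<in> A\<^sub>0" "b \<in> p" "x = ?\<pi> a" "y = ?\<pi> b"
        by (auto simp: quot_superalg_simps(6))
      note ab(3,4)
      moreover have "a \<in> carrier A" "b \<in> carrier A" using ab pD(1) by auto
      ultimately have "x \<otimes>\<^bsub>?Q\<^esub> y = ?\<pi> (a \<otimes> b)" using \<pi>D(2)[of a b] by simp
      then show "x \<otimes>\<^bsub>?Q\<^esub> y \<in> ?\<pi> ` p" using pD(5) ab by auto
    qed
    show "?\<pi> ` (A\<^sub>0 - p) \<subseteq> even_part ?Q" by (auto simp: quot_superalg_simps(6))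
    show "?\<pi> ` (A\<^sub>0 - p) \<noteq> {}" using pD(3) one_even by blast
    show "s \<otimes>\<^bsub>?Q\<^esub> t \<in> ?\<pi> ` (A\<^sub>0 - p)" if st: "s \<in> ?\<pi> ` (A\<^sub>0 - p)" "t \<in> ?\<pi> ` (A\<^sub>0 - p)" for s t
    proof -
      obtain a b where ab: "a \<in> A\<^sub>0 - p" "b \<in> A\<^sub>0 - p" "s = ?\<pi> a" "t = ?\<pi> b" using st by auto
      then have "s \<otimes>\<^bsub>?Q\<^esub> t = ?\<pi> (a \<otimes> b)" using \<pi>D(2) by auto
      moreover have "a \<otimes> b \<in> A\<^sub>0 - p" using pD(6)[of a b] ab by auto
      ultimately show ?thesis by blast
    qed
    show "?\<pi> ` p \<inter> ?\<pi> ` (A\<^sub>0 - p) = {}"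
    proof (rule ccontr)
      assume "\<not> ?thesis"
      then obtain a b where ab: "a \<in> p" "b \<in> A\<^sub>0" "b \<notin> p" "?\<pi> b = ?\<pi> a" by auto
      have a0: "a \<in> A\<^sub>0" using ab pD(1) by auto
      have "b \<ominus> a \<in> N" using quot_map_eq_iff[OF N] ab a0 by auto
      then have "b \<ominus> a \<in> p"
        unfolding N_def using nilradical_even_subset_prime[OF p, of "b \<ominus> a"] ab a0 by simp
      then have "(b \<ominus> a) \<oplus> a \<in> p" using pD(4) ab by simp
      then show False using ab a0 by (simp add: a_minus_def A.a_assoc A.l_neg)
    qed
  qed
  then obtain q where q: "q \<in> Q.Spec" "?\<pi> ` p \<subseteq> q" "q \<inter> ?\<pi> ` (A\<^sub>0 - p) = {}" by auto
  have "a \<in> p" if "a \<in> A\<^sub>0" "?\<pi> a \<in> q" for a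
    using q(3) that by (metis DiffI IntI empty_iff imageI)
  then have "{a \<in> A\<^sub>0. ?\<pi> a \<in> q} = p" using pD(1) q(2) by auto
  then show ?thesis using q(1) by auto
qed

text \<open>Equality of morphisms after reduction, read off the two components: the point map by surjectivity
on spectra, the comorphisms by injectivity of the map to global sections.\<close>

lemma reduction_eq_base_point_iff:
  fixes K :: "'k ring" and X :: "('k, 'p, 's) superspace" and A :: "('k, 'a) superalg"
  assumes X: "geometric_superspace K X" and A: "supercomm_char_not_two K A" and g: "g \<in> Mor K (SSpec A) X"
    and x: "x \<in> Mor K (SSpec (field_superalg K)) X"
  defines "N \<equiv> nilradical A" and "y \<equiv> fst x {\<zero>\<^bsub>K\<^esub>}"
  shows "points_map X A (quot_superalg A N) (quot_map A N) g = base_point K X x (quot_superalg A N) \<longleftrightarrow>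
    (\<forall>p\<in>prime_spectrum A. fst g p = y) \<and>
    (\<forall>W s. openin (base X) W \<and> y \<in> W \<and> s \<in> carrier (sect X W) \<longrightarrow>
      pullback K X A g W s \<ominus>\<^bsub>A\<^esub> unit_hom A (pullback K X (field_superalg K) x W s) \<in> N)"
    (is "?l = ?r \<longleftrightarrow> ?const \<and> ?cong")
proof -
  interpret X: geometric_superspace K X by fact
  interpret A: supercomm_char_not_two K A by fact
  interpret F: supercomm K "field_superalg K" by (rule field_superalg_supercomm[OF A.K.field_axioms])
  let ?Q = "quot_superalg A N" and ?\<pi> = "quot_map A N"
  interpret Q: supercomm K ?Q
    unfolding N_def using supercommI[OF A.nilradical_quot_superalgebra] .
  have N: "ideal N A" unfolding N_def by (rule A.nilradical_ideal)
  note \<pi> = A.quot_map_hom[OF N]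
  have xy: "fst x q = y" if "q \<in> F.Spec" for q
    using rational_point_constant(1)[OF A.K.field_axioms that] by (simp add: y_def)
  let ?\<phi> = "pullback K X A g" and ?\<chi> = "pullback K X (field_superalg K) x"
  have r: "?r = (\<lambda>q\<in>Q.Spec. y, \<lambda>W\<in>{W. openin (base X) W}. \<lambda>s\<in>carrier (sect X W).
      if y \<in> W then global_section ?Q (unit_hom ?Q (?\<chi> W s)) else (\<lambda>_. undefined))"
    unfolding base_point_def
    by (rule points_map_constant[OF X F.supercomm_axioms Q.supercomm_axioms Q.unit_hom_hom x xy])
  have cong_iff: "global_section ?Q (?\<pi> (?\<phi> W s)) = global_section ?Q (unit_hom ?Q (?\<chi> W s)) \<longleftrightarrow>
      ?\<phi> W s \<ominus>\<^bsub>A\<^esub> unit_hom A (?\<chi> W s) \<in> N"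
    if c: ?const and W: "openin (base X) W" "y \<in> W" and s: "s \<in> carrier (sect X W)" for W s
  proof -
    have a: "?\<phi> W s \<in> carrier A"
      using A.superalg_homD(1)[OF pullback(1)[OF X A.supercomm_axioms g W(1)] s] c W(2) by simp
    have k: "?\<chi> W s \<in> carrier K"
      using A.superalg_homD(1)[OF pullback(1)[OF X F.supercomm_axioms x W(1)] s] xy W(2) by simp
    have uk: "unit_hom A (?\<chi> W s) \<in> carrier A" using k by (simp add: unit_hom_def)
    have u: "unit_hom ?Q (?\<chi> W s) = ?\<pi> (unit_hom A (?\<chi> W s))"
      using k A.superalg_homD(4,5)[OF \<pi>] by (simp add: unit_hom_def)
    show ?thesis
      unfolding u A.quot_map_eq_iff[OF N a uk, symmetric]
      using Q.global_section_inj[OF A.superalg_homD(1)[OF \<pi> a] A.superalg_homD(1)[OF \<pi> uk]] by auto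
  qed
  show ?thesis
  proof
    assume eq: "?l = ?r"
    have c: ?const
    proof
      fix p assume p: "p \<in> A.Spec"
      obtain q where q: "q \<in> Q.Spec" "{a \<in> A.A\<^sub>0. ?\<pi> a \<in> q} = p"
        using A.Spec_reduction_surj[OF p, folded N_def] by blast
      have "fst ?l q = fst g p"
        using q SSpec_point_map_eq[OF Q.supercomm_axioms q(1), of A ?\<pi>]
        by (simp add: points_map_def comp_mor_def SSpec_map_def Q.topspace_zariski)
      moreover have "fst ?r q = y" unfolding r using q by simp
      ultimately show "fst g p = y" using eq by simp
    qed
    have l: "?l = (\<lambda>q\<in>Q.Spec. y, \<lambda>W\<in>{W. openin (base X) W}. \<lambda>s\<in>carrier (sect X W).
      if y \<in> W then global_section ?Q (?\<pi> (?\<phi> W s)) else (\<lambda>_. undefined))"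
      by (rule points_map_constant[OF X A.supercomm_axioms Q.supercomm_axioms \<pi> g]) (use c in auto)
    have ?cong
    proof (intro allI impI, elim conjE)
      fix W s assume W: "openin (base X) W" "y \<in> W" and s: "s \<in> carrier (sect X W)"
      have "snd ?l W s = snd ?r W s" using eq by simp
      then have "global_section ?Q (?\<pi> (?\<phi> W s)) = global_section ?Q (unit_hom ?Q (?\<chi> W s))"
        unfolding l r using W s by simp
      then show "?\<phi> W s \<ominus>\<^bsub>A\<^esub> unit_hom A (?\<chi> W s) \<in> N" using cong_iff[OF c W s] by simp
    qed
    then show "?const \<and> ?cong" using c by simp
  next
    assume cc: "?const \<and> ?cong"
    then have c: ?const by simp
    have l: "?l = (\<lambda>q\<in>Q.Spec. y, \<lambda>W\<in>{W. openin (base X) W}. \<lambda>s\<in>carrier (sect X W).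
      if y \<in> W then global_section ?Q (?\<pi> (?\<phi> W s)) else (\<lambda>_. undefined))"
      by (rule points_map_constant[OF X A.supercomm_axioms Q.supercomm_axioms \<pi> g]) (use c in auto)
    show "?l = ?r"
      unfolding l r using cong_iff[OF c] cc by (auto intro!: restrict_ext)
  qed
qed

text \<open>The point ideal, defined by the vanishing of a global section over the spectrum of the field, is
the kernel of a homomorphism into the field itself.\<close>

lemma point_ideal_eq:
  fixes K :: "'k ring" and X :: "('k, 'p, 's) superspace"
  assumes X: "geometric_superspace K X" and K: "field K"
    and x: "x \<in> Mor K (SSpec (field_superalg K)) X"
    and U: "openin (base X) U" and im: "\<And>q. q \<in> prime_spectrum (field_superalg K) \<Longrightarrow> fst x q \<in> U"
  shows "point_ideal K X U x = {s \<in> carrier (sect X U). pullback K X (field_superalg K) x U s = \<zero>\<^bsub>K\<^esub>}"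
    and "ideal (point_ideal K X U x) (sect X U)"
proof -
  interpret X: geometric_superspace K X by fact
  interpret F: supercomm K "field_superalg K" by (rule field_superalg_supercomm[OF K])
  interpret O: supercomm K "sect X U" by (rule supercommI[OF X.sect_superalgebra[OF U]])
  let ?\<chi> = "pullback K X (field_superalg K) x U"
  have \<chi>: "?\<chi> \<in> superalg_hom K (sect X U) (field_superalg K)"
    by (rule pullback(1)[OF X F.supercomm_axioms x U im])
  note \<chi>D = F.superalg_homD[OF \<chi>]
  have "\<zero>\<^bsub>sect (SSpec (field_superalg K)) F.Spec\<^esub> = global_section (field_superalg K) \<zero>\<^bsub>K\<^esub>"
    by (simp add: SSpec_def F.global_section_eq localization_def)
  moreover have "global_section (field_superalg K) (?\<chi> s) = global_section (field_superalg K) \<zero>\<^bsub>K\<^esub>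
      \<longleftrightarrow> ?\<chi> s = \<zero>\<^bsub>K\<^esub>" if "s \<in> carrier (sect X U)" for s
    using F.global_section_inj[of "?\<chi> s" "\<zero>\<^bsub>K\<^esub>"] \<chi>D(1)[OF that] by auto
  ultimately show eq: "point_ideal K X U x = {s \<in> carrier (sect X U). ?\<chi> s = \<zero>\<^bsub>K\<^esub>}"
    using pullback(2)[OF X F.supercomm_axioms x U im]
    by (auto simp: point_ideal_def a_kernel_def' F.topspace_zariski)
  have "?\<chi> \<zero>\<^bsub>sect X U\<^esub> = \<zero>\<^bsub>K\<^esub>"
    using O.superalg_hom_zero_minus(1)[OF \<chi> F.superalgebra_axioms] by simp
  then show "ideal (point_ideal K X U x) (sect X U)"
    unfolding eq using \<chi>D(1-3) by (intro O.idealI_elementary) auto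
qed

theorem proposition9p7:
  fixes K :: "'k ring"
    and X :: "('k, 'p, 's) superspace"
    and x :: "('k, 'p, 's) point"
    and A :: "('k, 'a) superalg"
  assumes "field K"
    and "field_char K = 0 \<or> odd (field_char K)"
    and "locally_algebraic K X"
    and "x \<in> points K X (field_superalg K)"
    and "superalgebra K A"
  shows "formal_nbhd K X x A =
    {g \<in> points K X A.
      points_map X A (quot_superalg A (nilradical A)) (quot_map A (nilradical A)) g =
      base_point K X x (quot_superalg A (nilradical A))}"
proof -
  have X: "geometric_superspace K X" using assms(3) by (simp add: locally_algebraic_def superscheme_def)
  interpret X: geometric_superspace K X by fact
  interpret A: supercomm_char_not_two K A
    by (intro supercomm_char_not_two.intro supercommI[OF assms(5)] supercomm_char_not_two_axioms.intro
        two_nonzero_of_field_char assms)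
  interpret F: supercomm K "field_superalg K" by (rule field_superalg_supercomm[OF assms(1)])
  let ?N = "nilradical A"
  have N: "ideal ?N A" by (rule A.nilradical_ideal)
  have x: "x \<in> Mor K (SSpec (field_superalg K)) X" using assms(4) by (simp add: points_def)
  define y where "y = fst x {\<zero>\<^bsub>K\<^esub>}"
  note pt0 = rational_point_constant[OF assms(1)]
  have xy: "fst x q = y" if "q \<in> F.Spec" for q using pt0(1)[OF that] by (simp add: y_def)
  have yX: "y \<in> topspace (base X)"
    unfolding y_def using Mor_point[OF x] pt0(2) by (simp add: F.topspace_zariski)
  have open_pts: "x \<in> open_points K X W (field_superalg K) \<longleftrightarrow> y \<in> W" for W
    using xy pt0(2) assms(4) by (auto simp: open_points_def F.topspace_zariski)
  define U where "U = affine_nbhd K X x"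
  \<comment> \<open>the neighborhood selected by the choice operator is affine and contains the point\<close>
  have "\<exists>U. affine_open K X U \<and> x \<in> open_points K X U (field_superalg K)"
    using assms(3) yX unfolding open_pts locally_algebraic_def by blast
  from someI_ex[OF this] have U: "affine_open K X U" "y \<in> U"
    unfolding open_pts U_def affine_nbhd_def by auto
  have oU: "openin (base X) U" using U by (simp add: affine_open_def)
  interpret O: supercomm K "sect X U" by (rule supercommI[OF X.sect_superalgebra[OF oU]])
  let ?\<chi> = "pullback K X (field_superalg K) x"
  have imx: "fst x q \<in> U" if "q \<in> F.Spec" for q using xy[OF that] U(2) by simp
  define M where "M = point_ideal K X U x"
  have M: "M = {s \<in> carrier (sect X U). ?\<chi> U s = \<zero>\<^bsub>K\<^esub>}" "ideal M (sect X U)"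
    unfolding M_def by (rule point_ideal_eq[OF X assms(1) x oU], rule imx, assumption)+
  have \<chi>: "?\<chi> U \<in> superalg_hom K (sect X U) (field_superalg K)"
    by (rule pullback(1)[OF X F.supercomm_axioms x oU imx])
  note criterion = reduction_eq_base_point_iff[OF X A.supercomm_char_not_two_axioms _ x, folded y_def]
  have inf: "inf_nbhd K X x n A = closed_points K X U (ideal_power (sect X U) M (n + 1)) A" for n
    by (simp add: inf_nbhd_def U_def M_def Let_def)
  show ?thesis
  proof (intro Set.set_eqI iffI)
    fix g assume "g \<in> formal_nbhd K X x A"
    then obtain n where "g \<in> closed_points K X U (ideal_power (sect X U) M (n + 1)) A"
      unfolding formal_nbhd_def inf by auto
    then obtain \<psi> where g: "g \<in> points K X A" and img0: "fst g ` topspace (base (SSpec A)) \<subseteq> U"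
      and \<psi>: "\<psi> \<in> superalg_hom K (quot_superalg (sect X U) (ideal_power (sect X U) M (n + 1))) A"
      and g\<psi>: "\<forall>s\<in>carrier (sect X U). snd g U s =
        global_section A (\<psi> (quot_map (sect X U) (ideal_power (sect X U) M (n + 1)) s))"
      by (auto simp: closed_points_def open_points_def)
    have gM: "g \<in> Mor K (SSpec A) X" using g by (simp add: points_def)
    have img: "fst g p \<in> U" if "p \<in> A.Spec" for p using img0 that by (auto simp: A.topspace_zariski)
    let ?I = "ideal_power (sect X U) M (n + 1)"
    have I: "ideal ?I (sect X U)" using O.ideal_power_ideal[OF M(2)] .
    let ?\<phi> = "pullback K X A g"
    have \<phi>: "?\<phi> U \<in> superalg_hom K (sect X U) A"
      by (rule pullback(1)[OF X A.supercomm_axioms gM oU img])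
    have \<phi>\<psi>: "?\<phi> U s = \<psi> (quot_map (sect X U) ?I s)" if s: "s \<in> carrier (sect X U)" for s
    proof (rule A.global_section_inj)
      show "?\<phi> U s \<in> carrier A" using A.superalg_homD(1)[OF \<phi> s] .
      show "\<psi> (quot_map (sect X U) ?I s) \<in> carrier A"
        using A.superalg_homD(1)[OF O.superalg_hom_comp[OF O.quot_map_hom[OF I] \<psi>] s] .
      show "global_section A (?\<phi> U s) = global_section A (\<psi> (quot_map (sect X U) ?I s))"
        using g\<psi> s pullback(2)[OF X A.supercomm_axioms gM oU img s] by simp
    qed
    have \<phi>0: "?\<phi> U s = \<zero>\<^bsub>A\<^esub>" if s: "s \<in> ?I" for s
    proof -
      have sc: "s \<in> carrier (sect X U)" using ideal.Icarr[OF I s] .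
      have "quot_map (sect X U) ?I s = quot_map (sect X U) ?I \<zero>\<^bsub>sect X U\<^esub>"
        using O.quot_map_eq_iff[OF I sc, of "\<zero>\<^bsub>sect X U\<^esub>"] s sc by (simp add: a_minus_def)
      then have "?\<phi> U s = ?\<phi> U \<zero>\<^bsub>sect X U\<^esub>" using \<phi>\<psi> sc by simp
      then show ?thesis using O.superalg_hom_zero_minus(1)[OF \<phi> A.superalgebra_axioms] by simp
    qed
    have nilp: "?\<phi> U m [^]\<^bsub>A\<^esub> (n + 1) = \<zero>\<^bsub>A\<^esub>" if m: "m \<in> M" for m
    proof -
      have mc: "m \<in> carrier (sect X U)" using m unfolding M(1) by simp
      have "?\<phi> U m [^]\<^bsub>A\<^esub> (n + 1) = ?\<phi> U (m [^]\<^bsub>sect X U\<^esub> (n + 1))"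
        using O.hom_nat_pow[OF \<phi> A.superalgebra_axioms mc, of "n + 1"] by simp
      also have "\<dots> = \<zero>\<^bsub>A\<^esub>" using \<phi>0 O.pow_in_ideal_power[OF M(2) m, of "n + 1"] by simp
      finally show ?thesis .
    qed
    \<comment> \<open>elements of \<open>M\<close> have nilpotent pullback, so only \<open>y\<close> can be a value of \<open>g\<close>\<close>
    have const: "fst g p = y" if p: "p \<in> A.Spec" for p
    proof -
      have "\<exists>k::nat. ?\<phi> U m [^]\<^bsub>A\<^esub> k = \<zero>\<^bsub>A\<^esub>" if "m \<in> carrier (sect X U)" "?\<chi> U m = \<zero>\<^bsub>K\<^esub>" for m
        using nilp[of m] that unfolding M(1) by blast
      then show ?thesis
        using point_eq_rational_point[OF X A.supercomm_axioms gM x U(1) img imx _ p pt0(2)] by (simp add: y_def)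
    qed
    have cong: "?\<phi> U m \<ominus>\<^bsub>A\<^esub> unit_hom A (?\<chi> U m) \<in> ?N" if m: "m \<in> carrier (sect X U)" for m
    proof -
      define c where "c = ?\<chi> U m"
      have c: "c \<in> carrier K" using A.superalg_homD(1)[OF \<chi> m] by (simp add: c_def)
      \<comment> \<open>subtracting its value at \<open>x\<close> moves \<open>m\<close> into \<open>M\<close>\<close>
      define m' where "m' = m \<ominus>\<^bsub>sect X U\<^esub> c \<odot>\<^bsub>sect X U\<^esub> \<one>\<^bsub>sect X U\<^esub>"
      have m'c: "m' \<in> carrier (sect X U)" unfolding m'_def using m c by simp
      have "?\<chi> U m' = c \<ominus>\<^bsub>field_superalg K\<^esub> c"
        unfolding m'_def using O.superalg_hom_zero_minus(2)[OF \<chi> F.superalgebra_axioms m]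
          A.superalg_homD(4,5)[OF \<chi>] c by (simp add: c_def[symmetric])
      then have "m' \<in> M" unfolding M(1) using m'c c F.A.r_right_minus_eq[of c c] by simp
      moreover have "?\<phi> U m' = ?\<phi> U m \<ominus>\<^bsub>A\<^esub> unit_hom A c"
        unfolding m'_def using O.superalg_hom_zero_minus(2)[OF \<phi> A.superalgebra_axioms m]
          A.superalg_homD(4,5)[OF \<phi>] c by (simp add: unit_hom_def)
      ultimately have "(?\<phi> U m \<ominus>\<^bsub>A\<^esub> unit_hom A c) [^]\<^bsub>A\<^esub> (n + 1) = \<zero>\<^bsub>A\<^esub>"
        "?\<phi> U m \<ominus>\<^bsub>A\<^esub> unit_hom A c \<in> carrier A"
        using nilp[of m'] A.superalg_homD(1)[OF \<phi> m'c] by simp_all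
      then show ?thesis unfolding c_def nilradical_def by blast
    qed
    have "?\<phi> W s \<ominus>\<^bsub>A\<^esub> unit_hom A (?\<chi> W s) \<in> ?N"
      if "openin (base X) W" "y \<in> W" "s \<in> carrier (sect X W)" for W s
      using congruence_spreads[OF X A.supercomm_axioms gM x U(1) const xy N cong U(2) that] .
    then show "g \<in> {g \<in> points K X A. points_map X A (quot_superalg A ?N) (quot_map A ?N) g =
        base_point K X x (quot_superalg A ?N)}"
      using g const unfolding mem_Collect_eq criterion[OF gM] by blast
  next
    fix g assume gg: "g \<in> {g \<in> points K X A. points_map X A (quot_superalg A ?N) (quot_map A ?N) g =
        base_point K X x (quot_superalg A ?N)}"
    then have g: "g \<in> points K X A" by simp
    have gM: "g \<in> Mor K (SSpec A) X" using g by (simp add: points_def)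
    let ?\<phi> = "pullback K X A g"
    have const: "fst g p = y" if "p \<in> A.Spec" for p
      using gg that unfolding mem_Collect_eq criterion[OF gM] by blast
    have cong: "?\<phi> W s \<ominus>\<^bsub>A\<^esub> unit_hom A (?\<chi> W s) \<in> ?N"
      if "openin (base X) W" "y \<in> W" "s \<in> carrier (sect X W)" for W s
      using gg that unfolding mem_Collect_eq criterion[OF gM] by blast
    \<comment> \<open>finiteness is available on some affine \<open>V\<close> around \<open>y\<close>, from which it is carried over to \<open>U\<close>\<close>
    obtain V where V: "affine_open K X V" "y \<in> V" and fg: "finitely_generated K (sect X V)"
      using assms(3) yX unfolding locally_algebraic_def by blast
    have oV: "openin (base X) V" using V by (simp add: affine_open_def)
    have imgV: "fst g p \<in> V" if "p \<in> A.Spec" for p using const[OF that] V(2) by simp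
    have imxV: "fst x q \<in> V" if "q \<in> F.Spec" for q using xy[OF that] V(2) by simp
    have \<phi>V: "?\<phi> V \<in> superalg_hom K (sect X V) A"
      by (rule pullback(1)[OF X A.supercomm_axioms gM oV imgV])
    have \<chi>V: "?\<chi> V \<in> superalg_hom K (sect X V) (field_superalg K)"
      by (rule pullback(1)[OF X F.supercomm_axioms x oV imxV])
    obtain J where J: "A.nilpotent_ideal J"
      and JV: "\<forall>m\<in>carrier (sect X V). ?\<phi> V m \<ominus>\<^bsub>A\<^esub> unit_hom A (?\<chi> V m) \<in> J"
      using A.finitely_generated_congruence[OF X.sect_superalgebra[OF oV] fg \<phi>V \<chi>V cong[OF oV V(2)]] by blast
    have J_id: "ideal J A" using J by (simp add: A.nilpotent_ideal_def)
    note congV = bspec[OF JV]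
    have img: "fst g p \<in> U" if "p \<in> A.Spec" for p using const[OF that] U(2) by simp
    have \<phi>: "?\<phi> U \<in> superalg_hom K (sect X U) A"
      by (rule pullback(1)[OF X A.supercomm_axioms gM oU img])
    have "?\<phi> U m \<in> J" if "m \<in> M" for m
    proof -
      have m: "m \<in> carrier (sect X U)" "?\<chi> U m = \<zero>\<^bsub>K\<^esub>" using that by (auto simp: M(1))
      have "?\<phi> U m \<ominus>\<^bsub>A\<^esub> unit_hom A (?\<chi> U m) \<in> J"
        using congruence_spreads[OF X A.supercomm_axioms gM x V(1) const xy J_id congV V(2) oU U(2) m(1)] .
      then show ?thesis using m A.superalg_homD(1)[OF \<phi> m(1)] by (simp add: unit_hom_def a_minus_def)
    qed
    then have sub: "?\<phi> U ` M \<subseteq> J" by auto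
    obtain k where k: "ideal_power A J k \<subseteq> {\<zero>\<^bsub>A\<^esub>}" using J by (auto simp: A.nilpotent_ideal_def)
    \<comment> \<open>the union defining the formal neighborhood starts at 1, so an exponent above \<open>k\<close> is chosen\<close>
    define n where "n = k + 1"
    have power_antimono: "ideal_power A J (Suc i) \<subseteq> ideal_power A J i" for i
      using A.A.ideal_prod_inter[OF A.ideal_power_ideal[OF J_id] J_id] by (auto simp: A.ideal_power_Suc)
    have "ideal_power A J (n + 1) \<subseteq> {\<zero>\<^bsub>A\<^esub>}"
      using power_antimono[of k] power_antimono[of "Suc k"] k by (simp add: n_def)
    then have ker: "?\<phi> U a = \<zero>\<^bsub>A\<^esub>" if "a \<in> ideal_power (sect X U) M (n + 1)" for a
      using O.hom_ideal_power[OF \<phi> M(2) sub that] by blast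
    obtain \<psi> where \<psi>: "\<psi> \<in> superalg_hom K (quot_superalg (sect X U) (ideal_power (sect X U) M (n + 1))) A"
      "\<forall>s\<in>carrier (sect X U). \<psi> (quot_map (sect X U) (ideal_power (sect X U) M (n + 1)) s) = ?\<phi> U s"
      using O.hom_descends_to_quot[OF O.ideal_power_ideal[OF M(2)] \<phi> A.superalgebra_axioms ker] by blast
    have "g \<in> closed_points K X U (ideal_power (sect X U) M (n + 1)) A"
      unfolding closed_points_def open_points_def
    proof (intro CollectI conjI bexI[of _ \<psi>] ballI)
      show "g \<in> points K X A" by (rule g)
      show "fst g ` topspace (base (SSpec A)) \<subseteq> U" using img by (auto simp: A.topspace_zariski)
      show "snd g U s = global_section A (\<psi> (quot_map (sect X U) (ideal_power (sect X U) M (n + 1)) s))"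
        if "s \<in> carrier (sect X U)" for s
        using pullback(2)[OF X A.supercomm_axioms gM oU img that] \<psi>(2) that by simp
    qed (rule \<psi>(1))
    then show "g \<in> formal_nbhd K X x A"
      unfolding formal_nbhd_def inf by (auto simp: n_def)
  qed
qed

end
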